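(* Let $p>2$ and let $V$ be a symmetric real random variable which is not almost surely equal to $0$, such that $V\in L_{p+\delta}$ for some $\delta>0$ if $2<p<4$, and $V\in L_p$ if $p\geq 4$. Then the best (i.e. smallest) constant ${\bf C}_{p,V}$ such that for every sequence $X_1, X_2,\dots$ of independent $V$-mixtures and every $n\geq1$ the inequality \[ \left\|\sum_{j=1}^n X_j\right\|_p \leq {\bf C}_{p,V}\max\left\{\left(\sum_{j=1}^n \|X_j\|_2^2\right)^{1/2}, \left(\sum_{j=1}^n \|X_j\|_p^p\right)^{1/p}\right\} \] holds is \[ {\bf C}_{p,V} = \begin{cases} (1 + \|Z\|_p^p)^{1/p}, & 2 < p \leq 4, \\[2pt] \left(\dfrac{\|V\|_2^2}{\|V\|_p^p}\right)^{\frac{1}{p-2}}\left\|\displaystyle\sum_{j=1}^\xi \tilde V_j\right\|_p, & p \geq 4, \end{cases} \] where $Z$ is a standard Gaussian random variable, $\tilde V_1, \tilde V_2, \dots$ are i.i.d. random variables distributed as $V$ conditioned on the event $\{V \neq 0\}$, and $\xi$ is a Poisson random variable, independent of $(\tilde V_j)_{j\ge1}$, with parameter $\left(\frac{\|V\|_p}{\|V\|_2}\right)^{\frac{2p}{p-2}}\bigl(1-\mathbb{P}(V=0)\bigr)$.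
   Context: For a random variable $Y$, $\|Y\|_p = (\mathbb{E}|Y|^p)^{1/p}$. A random variable $X$ is symmetric if $X$ and $-X$ have the same distribution. Given a symmetric random variable $V$, a random variable $X$ is called a $V$-mixture if it has the same distribution as $RV$ for some nonnegative random variable $R$ independent of $V$. An empty sum (when $\xi=0$) equals $0$. *)

theory Defs
  imports "HOL-Probability.Probability"
begin

text \<open>
  Real power of an extended nonnegative real, with infinity raised to \<open>a\<close> equal to infinity.
  Only meant for exponents \<open>a > 0\<close>.
\<close>

definition epowr :: "ennreal \<Rightarrow> real \<Rightarrow> ennreal" where
  "epowr x a = (if x = \<top> then \<top> else ennreal (enn2real x powr a))"

text \<open>
  The norm takes the value infinity outside \<open>L\<^sub>p\<close>; a Bochner integral would
  wrongly give \<open>0\<close> there.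
\<close>

definition eLp_norm :: "'a measure \<Rightarrow> real \<Rightarrow> ('a \<Rightarrow> real) \<Rightarrow> ennreal" where
  "eLp_norm M p Y = epowr (\<integral>\<^sup>+ \<omega>. ennreal (\<bar>Y \<omega>\<bar> powr p) \<partial>M) (1 / p)"

definition symmetric_rv :: "'a measure \<Rightarrow> ('a \<Rightarrow> real) \<Rightarrow> bool" where
  "symmetric_rv M X \<longleftrightarrow>
     X \<in> borel_measurable M \<and> distr M borel X = distr M borel (\<lambda>\<omega>. - X \<omega>)"

text \<open>
  The pair \<open>(R, W)\<close>, with \<open>W\<close> a copy of \<open>V\<close>, may live on a probability space of its own.
  Only the joint law of \<open>(R, W)\<close> matters, so the sample space \<open>real \<times> real\<close> is no restriction.
\<close>

definition V_mixture ::
    "'b measure \<Rightarrow> ('b \<Rightarrow> real) \<Rightarrow> 'a measure \<Rightarrow> ('a \<Rightarrow> real) \<Rightarrow> bool" where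
  "V_mixture N V M X \<longleftrightarrow> X \<in> borel_measurable M \<and>
     (\<exists>(S :: (real \<times> real) measure) R W.
        prob_space S \<and> prob_space.indep_var S borel R borel W \<and>
        (\<forall>\<omega>\<in>space S. 0 \<le> R \<omega>) \<and>
        distr S borel W = distr N borel V \<and>
        distr M borel X = distr S borel (\<lambda>\<omega>. R \<omega> * W \<omega>))"

text \<open>
  \<open>C\<close> is admissible if the moment inequality holds with constant \<open>C\<close> for all sequences of
  independent \<open>V\<close>-mixtures on all probability spaces whose sample space is of type \<open>'a\<close>.
\<close>

definition admissible_const ::
    "'a itself \<Rightarrow> real \<Rightarrow> 'b measure \<Rightarrow> ('b \<Rightarrow> real) \<Rightarrow> ennreal \<Rightarrow> bool" where
  "admissible_const TYPE('a) p N V C \<longleftrightarrow>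
     (\<forall>(M :: 'a measure) (X :: nat \<Rightarrow> 'a \<Rightarrow> real) (n :: nat).
        prob_space M \<longrightarrow> prob_space.indep_vars M (\<lambda>_. borel) X {1..} \<longrightarrow>
        (\<forall>j\<ge>1. V_mixture N V M (X j)) \<longrightarrow> n \<ge> 1 \<longrightarrow>
        eLp_norm M p (\<lambda>\<omega>. \<Sum>j=1..n. X j \<omega>)
          \<le> C * max (epowr (\<Sum>j=1..n. epowr (eLp_norm M 2 (X j)) 2) (1 / 2))
                    (epowr (\<Sum>j=1..n. epowr (eLp_norm M p (X j)) p) (1 / p)))"

text \<open>
  The best constant is finite, admissible, and below every admissible constant.  HOL cannot
  quantify over all sample space types inside a formula: admissibility is stated for a type
  variable \<open>'a\<close>, to be left arbitrary, and minimality for sequences on \<open>nat \<Rightarrow> real\<close>.  That type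
  carries every joint law of a real sequence, so a constant admissible for all types is in
  particular admissible for it.
\<close>

definition best_const ::
    "'a itself \<Rightarrow> real \<Rightarrow> 'b measure \<Rightarrow> ('b \<Rightarrow> real) \<Rightarrow> ennreal \<Rightarrow> bool" where
  "best_const TYPE('a) p N V C \<longleftrightarrow>
     C < \<top> \<and> admissible_const TYPE('a) p N V C \<and>
     (\<forall>C'. admissible_const TYPE(nat \<Rightarrow> real) p N V C' \<longrightarrow> C \<le> C')"

end

theory Submission
  imports Defs
begin

text \<open>
  Write \<open>f(x) = \<bar>x\<bar>\<^sup>p\<close> and, for a law \<open>\<mu>\<close> of \<open>X\<close>, \<open>T\<^sub>\<mu> g(y) = E g(y + X)\<close>.  These operators commute, so
  inequalities for \<open>T\<^sub>\<mu> f\<close> that hold at every \<open>y\<close> may be applied to the summands one at a time.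

  For \<open>p \<le> 4\<close> each symmetric summand \<open>X\<close> is traded for a centred Gaussian of the same variance at the price
  \<open>E \<bar>X\<bar>\<^sup>p\<close>: \<open>E f(y + X) - E f(X)\<close> is controlled by a majorant that is affine in \<open>x\<^sup>2\<close>.
  The constant is approached by \<open>n\<close> small copies of \<open>V\<close> (central limit theorem) together with one rare large copy.

  For \<open>p \<ge> 4\<close> Poissonisation increases the moment: \<open>T\<^sub>\<mu> f \<le> exp (T\<^sub>\<mu> - 1) f\<close> for symmetric \<open>\<mu>\<close>, because
  \<open>f''\<close> is convex.  For a mixture \<open>R V\<close> and a fixed \<open>c > 0\<close>, the function
  \<open>r \<mapsto> (E f(y + r V) - f(y)) / r\<^sup>2\<close> is concave in \<open>r\<^sup>p\<^sup>-\<^sup>2\<close>; its tangent at \<open>r = c\<close> bounds the sum of the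
  generators \<open>T - 1\<close> of the summands by \<open>\<lambda> (T\<^sub>c\<^sub>V - 1)\<close>, and hence the moment by that of a compound
  Poisson sum of copies of \<open>c V\<close>.  Summands \<open>a V\<close> thinned with probability \<open>\<lambda> / n\<close> attain it in the limit.
\<close>

section \<open>Symmetrised powers\<close>


text \<open>The one-step inequalities hold for \<open>f\<close> alone, not for the functions that
  the other summands make of it. This is what commutation repairs: the operator to be replaced is
  moved next to \<open>f\<close>, the inequality is used there, and the remaining operators preserve
  it because they are positive. Functions take values in \<open>ennreal\<close>, so infinite moments
  need no integrability conditions. The price is that the generators \<open>T - 1\<close> cannot be
  formed; inequalities between them are stated with the subtracted multiples of the identity moved
  to the other side. The regimes meet at \<open>p = 4\<close> because the second derivative of
  \<open>f\<close> is a multiple of \<open>|x|^(p-2)\<close>: this is concave in \<open>x^2\<close>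
  for \<open>p \<le> 4\<close>, while for \<open>p \<ge> 4\<close> one further derivative has
  exponent \<open>p - 3 \<ge> 1\<close> and is still monotone in the required sense. In the Poisson
  regime the bound on each summand is linear in its second and its \<open>p\<close>-th moment, so
  only the two sums of moments matter; jump size and rate are fixed by saturating both constraints
  at once. Both lower bounds use limit theorems from below only, by Fatou or by partial sums of
  nonnegative series, so no uniform integrability arises.\<close>

lemma has_real_derivative_powr_pos_at_0:
  fixes a :: real and g :: "real \<Rightarrow> real"
  assumes "a > 1" "\<And>x. \<bar>g x\<bar> \<le> \<bar>x\<bar> powr a"
  shows "(g has_real_derivative 0) (at 0)"
proof -
  have g0: "g 0 = 0" using assms(2)[of 0] assms(1) by simp
  have l: "((\<lambda>h::real. \<bar>h\<bar> powr (a - 1)) \<longlongrightarrow> 0) (at 0)"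
    using assms(1) by (auto intro!: tendsto_eq_intros)
  have "((\<lambda>h. (g (0 + h) - g 0) / h) \<longlongrightarrow> 0) (at 0)"
  proof (rule Lim_null_comparison[OF _ l])
    show "\<forall>\<^sub>F h in at 0. norm ((g (0 + h) - g 0) / h) \<le> \<bar>h\<bar> powr (a - 1)"
    proof (rule eventually_at_topological[THEN iffD2], intro exI conjI ballI impI)
      fix h :: real assume "h \<noteq> 0"
      have "norm ((g (0 + h) - g 0) / h) = \<bar>g h\<bar> / \<bar>h\<bar>" by (simp add: g0)
      also have "\<dots> \<le> \<bar>h\<bar> powr a / \<bar>h\<bar>" by (intro divide_right_mono assms) auto
      also have "\<dots> = \<bar>h\<bar> powr (a - 1)" using \<open>h \<noteq> 0\<close> by (simp add: powr_diff)
      finally show "norm ((g (0 + h) - g 0) / h) \<le> \<bar>h\<bar> powr (a - 1)" .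
    qed (rule open_UNIV, auto)
  qed
  then show ?thesis by (simp add: DERIV_def)
qed

lemma DERIV_abs_powr:
  fixes a x :: real
  assumes "a > 1"
  shows "((\<lambda>x. \<bar>x\<bar> powr a) has_real_derivative a * (sgn x * \<bar>x\<bar> powr (a - 1))) (at x)"
proof (cases "x = 0")
  case True
  then show ?thesis using has_real_derivative_powr_pos_at_0[of a "\<lambda>x. \<bar>x\<bar> powr a"] assms by simp
next
  case False
  have "((\<lambda>x. \<bar>x\<bar>) has_real_derivative sgn x) (at x)"
    using has_derivative_norm[OF False] has_derivative_ident
    by (simp add: has_field_derivative_def mult.commute[of _ "sgn x"] inner_real_def[abs_def] real_norm_def[abs_def])
  then show ?thesis using False by (auto intro!: derivative_eq_intros simp: mult_ac)
qed

lemma DERIV_sgn_abs_powr: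
  fixes a x :: real
  assumes "a > 1"
  shows "((\<lambda>x. sgn x * \<bar>x\<bar> powr a) has_real_derivative a * \<bar>x\<bar> powr (a - 1)) (at x)"
proof (cases "x = 0")
  case True
  then show ?thesis using has_real_derivative_powr_pos_at_0[of a "\<lambda>x. sgn x * \<bar>x\<bar> powr a"] assms
    by (simp add: abs_mult sgn_if)
next
  case False
  have "((\<lambda>x. sgn x * \<bar>x\<bar> powr a) has_real_derivative a * \<bar>x\<bar> powr (a - 1)) (at x)
    \<longleftrightarrow> ((\<lambda>y. sgn x * \<bar>y\<bar> powr a) has_real_derivative a * \<bar>x\<bar> powr (a - 1)) (at x)"
  proof (rule DERIV_cong_ev[OF refl _ refl])
    have "\<forall>\<^sub>F y in nhds x. sgn y = sgn x"
    proof (cases "x > 0")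
      case True
      then have "\<forall>\<^sub>F y in nhds x. y \<in> {0<..}" by (intro eventually_nhds_in_open) auto
      then show ?thesis by eventually_elim (use True in auto)
    next
      case f: False
      then have "\<forall>\<^sub>F y in nhds x. y \<in> {..<0}" using False by (intro eventually_nhds_in_open) auto
      then show ?thesis by eventually_elim (use f False in auto)
    qed
    then show "\<forall>\<^sub>F y in nhds x. sgn y * \<bar>y\<bar> powr a = sgn x * \<bar>y\<bar> powr a"
      by eventually_elim simp
  qed
  also have "\<dots>"
    by (rule derivative_eq_intros DERIV_abs_powr[OF assms] refl)+ (use False in \<open>auto simp: sgn_if\<close>)
  finally show ?thesis .
qed

lemma nonneg_deriv_imp_nonneg:
  fixes F F' :: "real \<Rightarrow> real"
  assumes F: "\<And>x. a \<le> x \<Longrightarrow> x \<le> b \<Longrightarrow> (F has_real_derivative F' x) (at x)"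
    and "F a \<ge> 0" "\<And>x. a \<le> x \<Longrightarrow> x \<le> b \<Longrightarrow> F' x \<ge> 0" "a \<le> x" "x \<le> b"
  shows "F x \<ge> 0"
proof -
  have "F a \<le> F x"
    by (rule DERIV_nonneg_imp_nondecreasing[OF \<open>a \<le> x\<close>]) (use assms in force)
  with assms show ?thesis by simp
qed

text \<open>Two differentiations lower the exponent \<open>p\<close> to \<open>p - 2\<close>, where
  concavity, convexity or monotonicity decides. Most pointwise inequalities below are reduced in
  this way.\<close>

lemma nonneg_deriv2_imp_nonneg:
  fixes F F' F'' :: "real \<Rightarrow> real"
  assumes F: "\<And>x. a \<le> x \<Longrightarrow> x \<le> b \<Longrightarrow> (F has_real_derivative F' x) (at x)"
    and F': "\<And>x. a \<le> x \<Longrightarrow> x \<le> b \<Longrightarrow> (F' has_real_derivative F'' x) (at x)"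
    and a: "F a \<ge> 0" "F' a \<ge> 0" and F'': "\<And>x. a \<le> x \<Longrightarrow> x \<le> b \<Longrightarrow> F'' x \<ge> 0"
    and x: "a \<le> x" "x \<le> b"
  shows "F x \<ge> 0"
proof (rule nonneg_deriv_imp_nonneg[OF F])
  show "F' x \<ge> 0" if "a \<le> x" "x \<le> b" for x
    by (rule nonneg_deriv_imp_nonneg[OF F']) (use that a F'' in auto)
qed (use a x in auto)

text \<open>The mean of \<open>|y + e x|^p\<close> over a fair random sign \<open>e\<close>; this is
  the function that symmetric laws are integrated against.\<close>

definition sympow :: "real \<Rightarrow> real \<Rightarrow> real \<Rightarrow> real" where
  "sympow p y x = (\<bar>y + x\<bar> powr p + \<bar>y - x\<bar> powr p) / 2"

text \<open>Odd companion of \<open>sympow\<close>: differentiation in \<open>x\<close> exchanges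
  the two families and lowers the exponent by one.\<close>

definition asympow :: "real \<Rightarrow> real \<Rightarrow> real \<Rightarrow> real" where
  "asympow p y x = (sgn (y + x) * \<bar>y + x\<bar> powr p - sgn (y - x) * \<bar>y - x\<bar> powr p) / 2"

lemma DERIV_sympow:
  assumes "p > 1"
  shows "(sympow p y has_real_derivative p * asympow (p - 1) y x) (at x)"
proof -
  have "((\<lambda>x. \<bar>y + x\<bar> powr p) has_real_derivative p * (sgn (y + x) * \<bar>y + x\<bar> powr (p - 1)) * 1) (at x)"
    by (rule DERIV_chain2[where g = "\<lambda>x. y + x", OF DERIV_abs_powr[OF assms]]) (auto intro!: derivative_eq_intros)
  moreover have "((\<lambda>x. \<bar>y - x\<bar> powr p) has_real_derivative p * (sgn (y - x) * \<bar>y - x\<bar> powr (p - 1)) * (-1)) (at x)"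
    by (rule DERIV_chain2[where g = "\<lambda>x. y - x", OF DERIV_abs_powr[OF assms]]) (auto intro!: derivative_eq_intros)
  ultimately have "((\<lambda>x. (\<bar>y + x\<bar> powr p + \<bar>y - x\<bar> powr p) / 2) has_real_derivative
     (p * (sgn (y + x) * \<bar>y + x\<bar> powr (p - 1)) * 1 + p * (sgn (y - x) * \<bar>y - x\<bar> powr (p - 1)) * (-1)) / 2) (at x)"
    by (intro DERIV_cdivide DERIV_add)
  then show ?thesis by (simp add: sympow_def[abs_def] asympow_def algebra_simps)
qed

lemma DERIV_asympow:
  assumes "p > 1"
  shows "(asympow p y has_real_derivative p * sympow (p - 1) y x) (at x)"
proof -
  have "((\<lambda>x. sgn (y + x) * \<bar>y + x\<bar> powr p) has_real_derivative p * \<bar>y + x\<bar> powr (p - 1) * 1) (at x)"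
    by (rule DERIV_chain2[where g = "\<lambda>x. y + x", OF DERIV_sgn_abs_powr[OF assms]]) (auto intro!: derivative_eq_intros)
  moreover have "((\<lambda>x. sgn (y - x) * \<bar>y - x\<bar> powr p) has_real_derivative p * \<bar>y - x\<bar> powr (p - 1) * (-1)) (at x)"
    by (rule DERIV_chain2[where g = "\<lambda>x. y - x", OF DERIV_sgn_abs_powr[OF assms]]) (auto intro!: derivative_eq_intros)
  ultimately have "((\<lambda>x. (sgn (y + x) * \<bar>y + x\<bar> powr p - sgn (y - x) * \<bar>y - x\<bar> powr p) / 2) has_real_derivative
     (p * \<bar>y + x\<bar> powr (p - 1) * 1 - p * \<bar>y - x\<bar> powr (p - 1) * (-1)) / 2) (at x)"
    by (intro DERIV_cdivide DERIV_diff)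
  then show ?thesis by (simp add: asympow_def[abs_def] sympow_def algebra_simps)
qed

lemma sympow_simps [simp]: "sympow p y 0 = \<bar>y\<bar> powr p" "asympow p y 0 = 0"
  "sympow p 0 x = \<bar>x\<bar> powr p" "sympow p y (-x) = sympow p y x" "sympow p (-y) x = sympow p y x"
  "sympow p y \<bar>x\<bar> = sympow p y x" "sympow p \<bar>y\<bar> x = sympow p y x"
proof -
  have *: "\<bar>- y + x\<bar> = \<bar>y - x\<bar>" "\<bar>- y - x\<bar> = \<bar>y + x\<bar>" by auto
  show 4: "sympow p y (-x) = sympow p y x" and 5: "sympow p (-y) x = sympow p y x"
    unfolding sympow_def * by simp_all
  show "sympow p y \<bar>x\<bar> = sympow p y x" "sympow p \<bar>y\<bar> x = sympow p y x"
    using 4 5 by (auto simp: abs_if)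
qed (auto simp: sympow_def asympow_def)

lemma sympow_scale: "sympow p (c * y) (c * x) = \<bar>c\<bar> powr p * sympow p y x"
proof -
  have "\<bar>c * y + c * x\<bar> = \<bar>c\<bar> * \<bar>y + x\<bar>" "\<bar>c * y - c * x\<bar> = \<bar>c\<bar> * \<bar>y - x\<bar>"
    by (simp_all flip: distrib_left right_diff_distrib abs_mult)
  then show ?thesis by (simp add: sympow_def powr_mult algebra_simps)
qed

lemma sgn_powr_mono:
  fixes x y :: real
  assumes "x \<le> y" "a > 0"
  shows "sgn x * \<bar>x\<bar> powr a \<le> sgn y * \<bar>y\<bar> powr a"
proof -
  consider "0 \<le> x" | "x < 0" "0 \<le> y" | "x < 0" "y < 0" by linarith
  then show ?thesis
  proof cases
    case 1
    then show ?thesis using assms by (auto simp: sgn_if intro!: powr_mono2)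
  next
    case 2
    then show ?thesis using powr_ge_zero[of "- x" a] powr_ge_zero[of y a] by (auto simp: sgn_if simp del: powr_ge_zero)
  next
    case 3
    then show ?thesis using assms by (auto simp: sgn_if intro!: powr_mono2)
  qed
qed

lemma asympow_nonneg: "a > 0 \<Longrightarrow> x \<ge> 0 \<Longrightarrow> asympow a y x \<ge> 0"
  unfolding asympow_def using sgn_powr_mono[of "y - x" "y + x" a] by simp

lemma sympow_ge:
  assumes "p \<ge> 1"
  shows "\<bar>y\<bar> powr p \<le> sympow p y x"
\<comment> \<open>\<open>DERIV_sympow\<close> excludes exponent 1, but this exponent is needed: it
  is that of the second derivative when the original one is 3.\<close>
proof (cases "p = 1")
  case True
  then show ?thesis by (simp add: sympow_def)
next
  case False
  then have p: "p > 1" using assms by simp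
  have "0 \<le> sympow p y \<bar>x\<bar> - \<bar>y\<bar> powr p"
  proof (rule nonneg_deriv_imp_nonneg[where a = 0 and b = "\<bar>x\<bar>" and F = "\<lambda>x. sympow p y x - \<bar>y\<bar> powr p" and F' = "\<lambda>x. p * asympow (p - 1) y x - 0"])
    show "((\<lambda>x. sympow p y x - \<bar>y\<bar> powr p) has_real_derivative p * asympow (p - 1) y x - 0) (at x)" for x
      using p by (intro DERIV_diff DERIV_sympow DERIV_const)
  qed (use p in \<open>auto simp: asympow_nonneg\<close>)
  then show ?thesis by simp
qed


section \<open>Bounds for exponents between 2 and 4\<close>

text \<open>The right-hand side is the tangent at \<open>m\<close> of the concave function
  \<open>t \<mapsto> t powr s\<close>; the inequality is the weighted AM-GM inequality for
  \<open>a\<close> and \<open>m\<close>.\<close>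

lemma powr_le_tangent:
  fixes a m s :: real
  assumes "0 \<le> s" "s \<le> 1" "0 \<le> a" "0 < m"
  shows "a powr s \<le> (s * a + (1 - s) * m) * m powr (s - 1)"
proof (cases "a = 0")
  case False
  have "a powr s * m powr (1 - s) \<le> s * a + (1 - s) * m"
    using assms False by (intro Youngs_inequality_0) auto
  then have "a powr s * m powr (1 - s) * m powr (s - 1) \<le> (s * a + (1 - s) * m) * m powr (s - 1)"
    by (rule mult_right_mono) simp
  then show ?thesis using assms by (simp add: mult.assoc flip: powr_add)
qed (use assms in auto)

lemma powr_concave:
  fixes a b s t :: real
  assumes s: "0 \<le> s" "s \<le> 1" and ab: "0 \<le> a" "0 \<le> b" and t: "0 \<le> t" "t \<le> 1"
  shows "(1 - t) * a powr s + t * b powr s \<le> ((1 - t) * a + t * b) powr s"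
proof -
  define m where "m = (1 - t) * a + t * b"
  have m0: "0 \<le> (1 - t) * a" "0 \<le> t * b" using ab t by auto
  show ?thesis
  proof (cases "m = 0")
    case True
    then have "(1 - t) * a = 0" "t * b = 0" using m0 unfolding m_def by linarith+
    then show ?thesis by auto
  next
    case False
    then have m: "m > 0" using m0 unfolding m_def by linarith
    have "(1 - t) * a powr s + t * b powr s \<le>
      (1 - t) * ((s * a + (1 - s) * m) * m powr (s - 1)) + t * ((s * b + (1 - s) * m) * m powr (s - 1))"
      using t s ab m by (intro add_mono mult_left_mono powr_le_tangent) auto
    also have "\<dots> = (s * ((1 - t) * a + t * b) + (1 - s) * m) * m powr (s - 1)"
      by (simp add: algebra_simps)
    also have "\<dots> = m * m powr (s - 1)" unfolding m_def[symmetric] by (simp add: algebra_simps)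
    also have "\<dots> = m powr s" using m by (simp add: powr_diff)
    finally show ?thesis by (simp add: m_def)
  qed
qed

lemma powr_subadditive:
  fixes a b s :: real
  assumes "0 \<le> s" "s \<le> 1" "0 \<le> a" "0 \<le> b"
  shows "(a + b) powr s \<le> a powr s + b powr s"
proof (cases "a + b = 0")
  case True
  then show ?thesis using assms by simp
next
  case False
  define u where "u = a / (a + b)"
  have u: "0 \<le> u" "u \<le> 1" and ab: "a + b > 0" using assms False by (auto simp: u_def field_simps)
  have a: "a = u * (a + b)" "b = (1 - u) * (a + b)" using False by (auto simp: u_def field_simps)
  have pw: "x \<le> x powr s" if "0 \<le> x" "x \<le> 1" for x :: real
    using that assms powr_mono'[of s 1 x] by (cases "x = 0") auto
  have "(a + b) powr s = (u + (1 - u)) * (a + b) powr s" by simp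
  also have "\<dots> \<le> (u powr s + (1 - u) powr s) * (a + b) powr s"
    using u by (intro mult_right_mono add_mono pw) auto
  also have "\<dots> = (u * (a + b)) powr s + ((1 - u) * (a + b)) powr s"
    using u ab by (simp only: powr_mult distrib_right)
  finally show ?thesis using a by simp
qed

text \<open>\<open>|z|^q\<close> is a concave and subadditive function of \<open>z^2\<close> because
  \<open>q / 2 \<le> 1\<close>, and by the parallelogram law the mean of \<open>(y + x)^2\<close>
  and \<open>(y - x)^2\<close> is \<open>y^2 + x^2\<close>. Used with \<open>q = p - 2\<close>, it
  is where \<open>p \<le> 4\<close> enters the Taylor-type upper bound.\<close>

lemma sympow_le_add:
  assumes q: "0 \<le> q" "q \<le> 2"
  shows "sympow q y x \<le> \<bar>y\<bar> powr q + \<bar>x\<bar> powr q"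
proof -
  have sq: "\<bar>z\<bar> powr q = (z\<^sup>2) powr (q / 2)" for z :: real
  proof -
    have "(z\<^sup>2) powr (q / 2) = (\<bar>z\<bar> powr 2) powr (q / 2)" by simp
    then show ?thesis by (simp only: powr_powr) simp
  qed
  have "sympow q y x = (1 - 1/2) * ((y + x)\<^sup>2) powr (q / 2) + 1/2 * ((y - x)\<^sup>2) powr (q / 2)"
    by (simp add: sympow_def sq)
  also have "\<dots> \<le> ((1 - 1/2) * (y + x)\<^sup>2 + 1/2 * (y - x)\<^sup>2) powr (q / 2)"
    using q by (intro powr_concave) auto
  also have "\<dots> = (y\<^sup>2 + x\<^sup>2) powr (q / 2)" by (simp add: power2_eq_square algebra_simps)
  also have "\<dots> \<le> (y\<^sup>2) powr (q / 2) + (x\<^sup>2) powr (q / 2)" using q by (intro powr_subadditive) auto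
  finally show ?thesis by (simp add: sq)
qed

lemma sympow_diff_derivs:
  assumes p: "p > 2"
  shows "((\<lambda>x. sympow p y x - (\<bar>y\<bar> powr p + b * x\<^sup>2 + k * \<bar>x\<bar> powr p)) has_real_derivative
      p * asympow (p - 1) y x - (2 * b * x + k * (p * (sgn x * \<bar>x\<bar> powr (p - 1))))) (at x)" (is ?A)
   and "((\<lambda>x. p * asympow (p - 1) y x - (2 * b * x + k * (p * (sgn x * \<bar>x\<bar> powr (p - 1))))) has_real_derivative
      p * ((p - 1) * sympow (p - 1 - 1) y x) - (2 * b + k * (p * ((p - 1) * \<bar>x\<bar> powr (p - 1 - 1))))) (at x)" (is ?B)
proof -
  have "((\<lambda>x. \<bar>y\<bar> powr p + b * x\<^sup>2) has_real_derivative 2 * b * x) (at x)"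
    by (auto intro!: derivative_eq_intros)
  then show ?A using p by (intro DERIV_diff DERIV_add DERIV_cmult DERIV_sympow DERIV_abs_powr) auto
  have "((\<lambda>x. 2 * b * x) has_real_derivative 2 * b) (at x)"
    by (auto intro!: derivative_eq_intros)
  then show ?B using p by (intro DERIV_diff DERIV_add DERIV_cmult DERIV_asympow DERIV_sgn_abs_powr) auto
qed

text \<open>Both sides agree at \<open>x = 0\<close> together with their first derivatives, and the
  hypothesis compares the second derivatives.\<close>

lemma sympow_lower:
  assumes p: "p > 2"
    and v: "\<And>x. 0 \<le> x \<Longrightarrow> 2 * b + p * (p - 1) * k * \<bar>x\<bar> powr (p - 2) \<le> p * (p - 1) * sympow (p - 2) y x"
  shows "\<bar>y\<bar> powr p + b * x\<^sup>2 + k * \<bar>x\<bar> powr p \<le> sympow p y x"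
proof -
  have "0 \<le> sympow p y \<bar>x\<bar> - (\<bar>y\<bar> powr p + b * \<bar>x\<bar>\<^sup>2 + k * \<bar>\<bar>x\<bar>\<bar> powr p)"
  proof (rule nonneg_deriv2_imp_nonneg[where a = 0 and b = "\<bar>x\<bar>", OF sympow_diff_derivs[OF p]])
    fix z :: real assume "0 \<le> z"
    from v[OF this] show "0 \<le> p * ((p - 1) * sympow (p - 1 - 1) y z) - (2 * b + k * (p * ((p - 1) * \<bar>z\<bar> powr (p - 1 - 1))))"
      by (simp add: algebra_simps)
  qed auto
  then show ?thesis by simp
qed

text \<open>The mirror image of \<open>sympow_lower\<close>, with the range cut off at
  \<open>c\<close>: for \<open>p < 3\<close> the comparison of second derivatives used below holds
  only for \<open>x\<close> up to \<open>|y|\<close>.\<close>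

lemma sympow_upper:
  assumes p: "p > 2"
    and v: "\<And>x. 0 \<le> x \<Longrightarrow> x \<le> c \<Longrightarrow> p * (p - 1) * sympow (p - 2) y x \<le> 2 * b + p * (p - 1) * k * \<bar>x\<bar> powr (p - 2)"
    and x: "\<bar>x\<bar> \<le> c"
  shows "sympow p y x \<le> \<bar>y\<bar> powr p + b * x\<^sup>2 + k * \<bar>x\<bar> powr p"
proof -
  have "0 \<le> - (sympow p y \<bar>x\<bar> - (\<bar>y\<bar> powr p + b * \<bar>x\<bar>\<^sup>2 + k * \<bar>\<bar>x\<bar>\<bar> powr p))"
  proof (rule nonneg_deriv2_imp_nonneg[where a = 0 and b = "\<bar>x\<bar>",
        OF DERIV_minus[OF sympow_diff_derivs(1)[OF p]] DERIV_minus[OF sympow_diff_derivs(2)[OF p]]])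
    fix z :: real assume "0 \<le> z" "z \<le> \<bar>x\<bar>"
    with v[of z] x show "0 \<le> - (p * ((p - 1) * sympow (p - 1 - 1) y z) - (2 * b + k * (p * ((p - 1) * \<bar>z\<bar> powr (p - 1 - 1)))))"
      by (simp add: algebra_simps)
  qed auto
  then show ?thesis by simp
qed

lemma sympow_ge_quadratic:
  assumes p: "p \<ge> 3"
  shows "\<bar>y\<bar> powr p + p * (p - 1) / 2 * \<bar>y\<bar> powr (p - 2) * x\<^sup>2 \<le> sympow p y x"
proof -
  have "\<bar>y\<bar> powr p + p * (p - 1) / 2 * \<bar>y\<bar> powr (p - 2) * x\<^sup>2 + 0 * \<bar>x\<bar> powr p \<le> sympow p y x"
  proof (rule sympow_lower)
    show "2 * (p * (p - 1) / 2 * \<bar>y\<bar> powr (p - 2)) + p * (p - 1) * 0 * \<bar>x\<bar> powr (p - 2) \<le>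
      p * (p - 1) * sympow (p - 2) y x" for x
      using p sympow_ge[of "p - 2" y x] by (simp add: mult_left_mono mult.assoc)
  qed (use p in simp)
  then show ?thesis by simp
qed

lemma sympow_le_quadratic:
  assumes p: "p \<ge> 3" "p \<le> 4"
  shows "sympow p y x \<le> \<bar>y\<bar> powr p + p * (p - 1) / 2 * \<bar>y\<bar> powr (p - 2) * x\<^sup>2 + \<bar>x\<bar> powr p"
proof -
  have "sympow p y x \<le> \<bar>y\<bar> powr p + p * (p - 1) / 2 * \<bar>y\<bar> powr (p - 2) * x\<^sup>2 + 1 * \<bar>x\<bar> powr p"
  proof (rule sympow_upper)
    fix x
    have "p * (p - 1) * sympow (p - 2) y x \<le> p * (p - 1) * (\<bar>y\<bar> powr (p - 2) + \<bar>x\<bar> powr (p - 2))"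
      using p by (intro mult_left_mono sympow_le_add) auto
    then show "p * (p - 1) * sympow (p - 2) y x \<le>
      2 * (p * (p - 1) / 2 * \<bar>y\<bar> powr (p - 2)) + p * (p - 1) * 1 * \<bar>x\<bar> powr (p - 2)"
      by (simp add: distrib_left)
  qed (use p in auto)
  then show ?thesis by simp
qed

section \<open>Exponents \<open>p\<close> between 2 and 3, where \<open>q = p - 2\<close> lies
  between 0 and 1\<close>

context
  fixes q :: real assumes q: "0 < q" "q < 1"
begin

text \<open>The points \<open>y + x\<close> and \<open>y - x\<close> do not lie on opposite sides of
  0, so concavity on a half-line applies.\<close>

lemma sympow_le_of_le:
  assumes "\<bar>x\<bar> \<le> \<bar>y\<bar>"
  shows "sympow q y x \<le> \<bar>y\<bar> powr q"
proof -
  have "(1 - 1/2) * (\<bar>y\<bar> + \<bar>x\<bar>) powr q + 1/2 * (\<bar>y\<bar> - \<bar>x\<bar>) powr q \<le> ((1 - 1/2) * (\<bar>y\<bar> + \<bar>x\<bar>) + 1/2 * (\<bar>y\<bar> - \<bar>x\<bar>)) powr q"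
    using q assms by (intro powr_concave) auto
  also have "(1 - 1/2) * (\<bar>y\<bar> + \<bar>x\<bar>) + 1/2 * (\<bar>y\<bar> - \<bar>x\<bar>) = \<bar>y\<bar>" by (simp add: field_simps)
  also have "(1 - 1/2) * (\<bar>y\<bar> + \<bar>x\<bar>) powr q + 1/2 * (\<bar>y\<bar> - \<bar>x\<bar>) powr q = sympow q \<bar>y\<bar> \<bar>x\<bar>"
    using assms by (simp add: sympow_def)
  finally show ?thesis by simp
qed

text \<open>Subadditivity together with \<open>|1 + t| + |1 - t| \<ge> 2\<close>. The bound is the
  value at \<open>t = 1\<close>.\<close>

lemma sympow_one_ge: "2 powr (q - 1) \<le> sympow q 1 t"
proof -
  have "2 powr q \<le> (\<bar>1 + t\<bar> + \<bar>1 - t\<bar>) powr q" using q by (intro powr_mono2) auto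
  also have "\<dots> \<le> \<bar>1 + t\<bar> powr q + \<bar>1 - t\<bar> powr q" using q by (intro powr_subadditive) auto
  finally show ?thesis by (simp add: sympow_def powr_diff)
qed

text \<open>Interpolates between the value 1 at \<open>t = 0\<close> and the minimum
  \<open>2 powr (q - 1)\<close> at \<open>t = 1\<close>. On \<open>[0, 1]\<close> the chord of the
  concave \<open>(1 + t)^q\<close> and \<open>(1 - t)^q \<ge> 1 - t\<close> give the bound with
  \<open>t\<close> in place of the larger \<open>t^q\<close>; beyond 1 the minimum suffices.\<close>

lemma sympow_one_ge':
  assumes t: "t \<ge> 0"
  shows "1 - (1 - 2 powr (q - 1)) * t powr q \<le> sympow q 1 t"
proof (cases "t \<le> 1")
  case True
  have k: "2 powr (q - 1) \<le> 1" using q powr_mono[of "q - 1" 0 2] by simp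
  have pw: "x \<le> x powr q" if "0 \<le> x" "x \<le> 1" for x :: real
    using that q powr_mono'[of q 1 x] by (cases "x = 0") auto
  have "(1 - t) * 1 powr q + t * 2 powr q \<le> ((1 - t) * 1 + t * 2) powr q"
    using q t True by (intro powr_concave) auto
  also have "(1 - t) * 1 + t * 2 = 1 + t" by simp
  finally have "1 - t + t * 2 powr q + (1 - t) \<le> (1 + t) powr q + (1 - t) powr q"
    using pw[of "1 - t"] t True by simp
  then have "1 - (1 - 2 powr (q - 1)) * t \<le> sympow q 1 t"
    using t True by (simp add: sympow_def powr_diff field_simps)
  moreover have "(1 - 2 powr (q - 1)) * t \<le> (1 - 2 powr (q - 1)) * t powr q"
    using t True k by (intro mult_left_mono pw) auto
  ultimately show ?thesis by linarith
next
  case False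
  have k: "2 powr (q - 1) \<le> 1" using q powr_mono[of "q - 1" 0 2] by simp
  have "t powr q \<ge> 1" using False q by (intro ge_one_powr_ge_zero) auto
  then have "(1 - 2 powr (q - 1)) * 1 \<le> (1 - 2 powr (q - 1)) * t powr q"
    using k by (intro mult_left_mono) auto
  then show ?thesis using sympow_one_ge[of t] by simp
qed

end

context
  fixes p :: real assumes p: "2 < p" "p < 3"
begin

text \<open>Keeps the exact Taylor coefficient of \<open>x^2\<close> at the price of a negative
  multiple of \<open>|x|^p\<close>, which suits small \<open>x\<close>. The next lemma gives up the
  coefficient to avoid the negative term, which suits large \<open>x\<close>.\<close>

lemma sympow_one_lower1:
  "1 + p * (p - 1) / 2 * x\<^sup>2 - (1 - 2 powr (p - 3)) * \<bar>x\<bar> powr p \<le> sympow p 1 x"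
proof -
  have "\<bar>1\<bar> powr p + p * (p - 1) / 2 * x\<^sup>2 + (- (1 - 2 powr (p - 3))) * \<bar>x\<bar> powr p \<le> sympow p 1 x"
  proof (rule sympow_lower)
    fix x :: real assume x: "0 \<le> x"
    have "p * (p - 1) * (1 - (1 - 2 powr (p - 3)) * x powr (p - 2)) \<le> p * (p - 1) * sympow (p - 2) 1 x"
      using p sympow_one_ge'[of "p - 2" x] x by (intro mult_left_mono) auto
    then show "2 * (p * (p - 1) / 2) + p * (p - 1) * - (1 - 2 powr (p - 3)) * \<bar>x\<bar> powr (p - 2)
         \<le> p * (p - 1) * sympow (p - 2) 1 x" using x by (simp add: field_simps)
  qed (use p in auto)
  then show ?thesis by (simp add: left_diff_distrib)
qed

lemma sympow_one_lower2:
  "1 + p * (p - 1) / 2 * 2 powr (p - 3) * x\<^sup>2 \<le> sympow p 1 x"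
proof -
  have "\<bar>1\<bar> powr p + p * (p - 1) / 2 * 2 powr (p - 3) * x\<^sup>2 + 0 * \<bar>x\<bar> powr p \<le> sympow p 1 x"
  proof (rule sympow_lower)
    fix x :: real
    have "p * (p - 1) * 2 powr (p - 3) \<le> p * (p - 1) * sympow (p - 2) 1 x"
      using p sympow_one_ge[of "p - 2" x] by (intro mult_left_mono) auto
    then show "2 * (p * (p - 1) / 2 * 2 powr (p - 3)) + p * (p - 1) * 0 * \<bar>x\<bar> powr (p - 2)
         \<le> p * (p - 1) * sympow (p - 2) 1 x" by simp
  qed (use p in auto)
  then show ?thesis by simp
qed

lemma sympow_one_upper1:
  assumes "\<bar>x\<bar> \<le> 1"
  shows "sympow p 1 x \<le> 1 + p * (p - 1) / 2 * x\<^sup>2"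
proof -
  have "sympow p 1 x \<le> \<bar>1\<bar> powr p + p * (p - 1) / 2 * x\<^sup>2 + 0 * \<bar>x\<bar> powr p"
  proof (rule sympow_upper[OF _ _ assms])
    fix x :: real assume "0 \<le> x" "x \<le> 1"
    then show "p * (p - 1) * sympow (p - 2) 1 x \<le> 2 * (p * (p - 1) / 2) + p * (p - 1) * 0 * \<bar>x\<bar> powr (p - 2)"
      using p sympow_le_of_le[of "p - 2" x 1] by simp
  qed (use p in auto)
  then show ?thesis by simp
qed

text \<open>AM-GM for 2 and 1 with weights \<open>p - 2\<close> and \<open>3 - p\<close>. It
  compares first derivatives at \<open>x = 1\<close> in \<open>sympow_one_upper2\<close>.\<close>

lemma two_powr_le: "2 powr (p - 2) \<le> p - 1"
proof -
  have "(2::real) powr (p - 2) * 1 powr (3 - p) \<le> (p - 2) * 2 + (3 - p) * 1"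
    using p by (intro Youngs_inequality_0) auto
  then show ?thesis by simp
qed

text \<open>The comparison of derivatives starts at \<open>x = 1\<close> instead of 0. Beyond 1 the
  roles of 1 and \<open>x\<close> in \<open>sympow (p - 2)\<close> are exchanged, so that
  \<open>sympow_le_of_le\<close> applies; the linear term on the right makes up for the slope at
  1.\<close>

lemma sympow_one_upper2:
  assumes "1 \<le> \<bar>x\<bar>"
  shows "sympow p 1 x \<le> \<bar>x\<bar> powr p + p * (p - 1) / 2 + p * (p - 2) * (\<bar>x\<bar> - 1)"
proof -
  have "0 \<le> (\<bar>\<bar>x\<bar>\<bar> powr p + p * (p - 1) / 2 + p * (p - 2) * (\<bar>x\<bar> - 1)) - sympow p 1 \<bar>x\<bar>"
  proof (rule nonneg_deriv2_imp_nonneg[where a = 1 and b = "\<bar>x\<bar>"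
      and F = "\<lambda>x. \<bar>x\<bar> powr p + p * (p - 1) / 2 + p * (p - 2) * (x - 1) - sympow p 1 x"
      and F' = "\<lambda>x. p * (sgn x * \<bar>x\<bar> powr (p - 1)) + 0 + p * (p - 2) - p * asympow (p - 1) 1 x"
      and F'' = "\<lambda>x. p * ((p - 1) * \<bar>x\<bar> powr (p - 1 - 1)) + 0 + 0 - p * ((p - 1) * sympow (p - 1 - 1) 1 x)"])
    fix x :: real assume x: "1 \<le> x"
    have "((\<lambda>x. p * (p - 1) / 2) has_real_derivative 0) (at x)"
      "((\<lambda>x. p * (p - 2) * (x - 1)) has_real_derivative p * (p - 2)) (at x)"
      by (auto intro!: derivative_eq_intros)
    then show "((\<lambda>x. \<bar>x\<bar> powr p + p * (p - 1) / 2 + p * (p - 2) * (x - 1) - sympow p 1 x) has_real_derivative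
      p * (sgn x * \<bar>x\<bar> powr (p - 1)) + 0 + p * (p - 2) - p * asympow (p - 1) 1 x) (at x)"
      using p by (intro DERIV_diff DERIV_add DERIV_abs_powr DERIV_sympow) auto
    have "((\<lambda>x. 0) has_real_derivative 0) (at x)"
      "((\<lambda>x. p * (p - 2)) has_real_derivative 0) (at x)"
      by (auto intro!: derivative_eq_intros)
    then show "((\<lambda>x. p * (sgn x * \<bar>x\<bar> powr (p - 1)) + 0 + p * (p - 2) - p * asympow (p - 1) 1 x) has_real_derivative
       p * ((p - 1) * \<bar>x\<bar> powr (p - 1 - 1)) + 0 + 0 - p * ((p - 1) * sympow (p - 1 - 1) 1 x)) (at x)"
      using p by (intro DERIV_diff DERIV_add DERIV_cmult DERIV_sgn_abs_powr DERIV_asympow) auto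
    have "sympow (p - 2) 1 x = sympow (p - 2) x 1" by (simp add: sympow_def abs_minus_commute add.commute)
    also have "\<dots> \<le> \<bar>x\<bar> powr (p - 2)" using p x by (intro sympow_le_of_le) auto
    finally have "p * (p - 1) * sympow (p - 2) 1 x \<le> p * (p - 1) * \<bar>x\<bar> powr (p - 2)"
      using p by (intro mult_left_mono) auto
    then show "0 \<le> p * ((p - 1) * \<bar>x\<bar> powr (p - 1 - 1)) + 0 + 0 - p * ((p - 1) * sympow (p - 1 - 1) 1 x)"
      by (simp add: algebra_simps)
  next
    show "0 \<le> \<bar>1\<bar> powr p + p * (p - 1) / 2 + p * (p - 2) * (1 - 1) - sympow p 1 1"
      using sympow_one_upper1[of 1] by simp
    have "p * (2 powr (p - 2)) \<le> p * (p - 1)" using p two_powr_le by (intro mult_left_mono) auto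
    moreover have "asympow (p - 1) 1 1 = 2 powr (p - 2)"
      by (simp add: asympow_def powr_diff)
    ultimately show "0 \<le> p * (sgn 1 * \<bar>1\<bar> powr (p - 1)) + 0 + p * (p - 2) - p * asympow (p - 1) 1 1"
      by (simp add: algebra_simps)
  qed (use assms in auto)
  then show ?thesis by simp
qed

end


section \<open>Gaussian averages and majorants that are affine in \<open>x^2\<close>\<close>

lemma ennreal_integral_le_nn_integral:
  fixes g :: "'a \<Rightarrow> real"
  assumes "integrable M g"
  shows "ennreal (\<integral>x. g x \<partial>M) \<le> (\<integral>\<^sup>+x. ennreal (g x) \<partial>M)"
proof -
  \<comment> \<open>The nonnegative integral keeps only the positive part of \<open>g\<close>. The
    minorants below can be negative, since their quartic coefficient may be.\<close>
  have "(\<integral>x. g x \<partial>M) \<le> enn2real (\<integral>\<^sup>+x. ennreal (g x) \<partial>M)"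
    unfolding real_lebesgue_integral_def[OF assms] by simp
  then have "ennreal (\<integral>x. g x \<partial>M) \<le> ennreal (enn2real (\<integral>\<^sup>+x. ennreal (g x) \<partial>M))"
    by (rule ennreal_leI)
  also have "\<dots> \<le> (\<integral>\<^sup>+x. ennreal (g x) \<partial>M)"
    by (metis ennreal_enn2real_if order.refl top_greatest)
  finally show ?thesis .
qed

lemma std_normal_poly:
  fixes a b c :: real
  shows "integrable std_normal_distribution (\<lambda>z. a + b * z\<^sup>2 + c * z ^ 4)" (is ?A)
    and "(\<integral>z. a + b * z\<^sup>2 + c * z ^ 4 \<partial>std_normal_distribution) = a + b + 3 * c" (is ?B)
proof -
  have i: "integrable std_normal_distribution (\<lambda>z. z ^ k)" for k :: nat
    by (rule integrable_std_normal_distribution_moment)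
  have m: "(\<integral>z. z\<^sup>2 \<partial>std_normal_distribution) = 1" "(\<integral>z. z ^ 4 \<partial>std_normal_distribution) = 3"
    using std_normal_distribution_even_moments_abs[of 1] std_normal_distribution_even_moments_abs[of 2]
    by (simp_all add: fact_numeral)
  interpret prob_space std_normal_distribution by (rule prob_space_normal_density) simp
  show ?A by (intro Bochner_Integration.integrable_add integrable_mult_right i) simp
  have "prob UNIV = 1" using prob_space by simp
  then show ?B using i m by simp
qed

lemma std_normal_sympow_ge:
  assumes "\<And>z. a + b * z\<^sup>2 + c * z ^ 4 \<le> sympow p y (s * z)"
  shows "ennreal (a + b + 3 * c) \<le> (\<integral>\<^sup>+z. ennreal (sympow p y (s * z)) \<partial>std_normal_distribution)"
proof -
  have "ennreal (a + b + 3 * c) \<le> (\<integral>\<^sup>+z. ennreal (a + b * z\<^sup>2 + c * z ^ 4) \<partial>std_normal_distribution)"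
    using ennreal_integral_le_nn_integral[OF std_normal_poly(1)[of a b c]] unfolding std_normal_poly(2) .
  also have "\<dots> \<le> (\<integral>\<^sup>+z. ennreal (sympow p y (s * z)) \<partial>std_normal_distribution)"
    by (intro nn_integral_mono ennreal_leI assms)
  finally show ?thesis .
qed

text \<open>AM-GM for \<open>z^2\<close> and \<open>z^4\<close> with weights
  \<open>2 - p / 2\<close> and \<open>p / 2 - 1\<close>, chosen so that the exponents add up to
  \<open>p\<close>. It yields \<open>E |Z|^p \<le> p - 1\<close>, so the Gaussian moment itself
  never has to be evaluated.\<close>

lemma abs_powr_le_quartic:
  fixes z :: real
  assumes p: "2 \<le> p" "p \<le> 4"
  shows "\<bar>z\<bar> powr p \<le> (2 - p / 2) * z\<^sup>2 + (p / 2 - 1) * z ^ 4"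
proof (cases "z = 0")
  case False
  have "\<bar>z\<bar> powr p = (z\<^sup>2) powr (2 - p / 2) * (z ^ 4) powr (p / 2 - 1)"
  proof -
    have "(z\<^sup>2) powr (2 - p / 2) = (\<bar>z\<bar> powr 2) powr (2 - p / 2)" by simp
    moreover have "(z ^ 4) powr (p / 2 - 1) = (\<bar>z\<bar> powr 4) powr (p / 2 - 1)" by simp
    ultimately show ?thesis
      by (simp only: powr_powr) (simp add: powr_add[symmetric] algebra_simps)
  qed
  also have "\<dots> \<le> (2 - p / 2) * z\<^sup>2 + (p / 2 - 1) * z ^ 4"
    using p False by (intro Youngs_inequality_0) auto
  finally show ?thesis .
qed (use p in simp)

text \<open>A function affine in \<open>x^2\<close> has the same mean under every law of second
  moment \<open>s^2\<close>, so it can mediate between an arbitrary symmetric summand and the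
  Gaussian one. For \<open>p \<ge> 3\<close> the Taylor coefficients work for every
  \<open>s\<close>. For \<open>p < 3\<close> they are too large on the Gaussian side, and the spare
  term \<open>|x|^p\<close> must be used; how much of it depends on whether \<open>s\<close> exceeds
  1.\<close>

lemma quadratic_majorant_one:
  fixes p s :: real
  assumes p: "2 < p" "p \<le> 4" and s: "s \<ge> 0"
  obtains A B where "A \<ge> 0" "B \<ge> 0"
    "\<And>x. sympow p 1 x \<le> \<bar>x\<bar> powr p + A + B * x\<^sup>2"
    "ennreal (A + B * s\<^sup>2) \<le> (\<integral>\<^sup>+z. ennreal (sympow p 1 (s * z)) \<partial>std_normal_distribution)"
proof -
  consider "p \<ge> 3" | "p < 3" "s \<le> 1" | "p < 3" "s \<ge> 1" by linarith
  then show thesis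
  proof cases
    case 1
    show thesis
    proof (rule that)
      show "sympow p 1 x \<le> \<bar>x\<bar> powr p + 1 + (p * (p - 1) / 2) * x\<^sup>2" for x
        using sympow_le_quadratic[of p 1 x] 1 p by simp
      have "ennreal (1 + (p * (p - 1) / 2 * s\<^sup>2) + 3 * 0) \<le> (\<integral>\<^sup>+z. ennreal (sympow p 1 (s * z)) \<partial>std_normal_distribution)"
      proof (rule std_normal_sympow_ge)
        show "1 + p * (p - 1) / 2 * s\<^sup>2 * z\<^sup>2 + 0 * z ^ 4 \<le> sympow p 1 (s * z)" for z
          using sympow_ge_quadratic[of p 1 "s * z"] 1 by (simp add: power_mult_distrib mult.assoc)
      qed
      then show "ennreal (1 + (p * (p - 1) / 2) * s\<^sup>2) \<le> (\<integral>\<^sup>+z. ennreal (sympow p 1 (s * z)) \<partial>std_normal_distribution)"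
        by simp
    qed (use p in auto)
  next
    case 2
    \<comment> \<open>The Taylor majorant \<open>1 + p (p - 1) / 2 * x^2\<close> minus the tangent
      at \<open>x^2 = s^2\<close> of \<open>|x|^p\<close>, regarded as a function of
      \<open>x^2\<close>. Contact at \<open>x = s\<close> makes \<open>A + B * s^2\<close> smaller
      than the Taylor value by exactly \<open>s powr p\<close>.\<close>
    define A where "A = 1 + (p / 2 - 1) * s powr p"
    define B where "B = p * (p - 1) / 2 - p / 2 * s powr (p - 2)"
    have s1: "s powr (p - 2) \<le> 1" using 2 p s powr_le1 by simp
    have s2: "s powr (p - 2) * s\<^sup>2 = s powr p"
      using s by (cases "s = 0") (simp_all add: powr_diff)
    have B1: "p * (p - 2) / 2 \<le> B" using mult_left_mono[OF s1, of "p / 2"] p by (simp add: B_def field_simps)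
    have B0: "B \<ge> 0" using B1 p by (smt (verit) divide_nonneg_nonneg mult_nonneg_nonneg)
    have AB: "A + B * s\<^sup>2 = 1 + p * (p - 1) / 2 * s\<^sup>2 - s powr p"
    proof -
      have "A + B * s\<^sup>2 = 1 + (p / 2 - 1) * s powr p + p * (p - 1) / 2 * s\<^sup>2 - p / 2 * (s powr (p - 2) * s\<^sup>2)"
        by (simp add: A_def B_def algebra_simps)
      then show ?thesis unfolding s2 by (simp add: algebra_simps)
    qed
    \<comment> \<open>the graph of a power lies above its tangent at \<open>s\<^sup>2\<close>\<close>
    have tangent: "1 + p * (p - 1) / 2 * x\<^sup>2 \<le> \<bar>x\<bar> powr p + A + B * x\<^sup>2" for x
    proof (cases "x = 0 \<or> s = 0")
      case True
      then show ?thesis using s p by (auto simp: A_def B_def)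
    next
      case False
      have "(\<bar>x\<bar> powr p) powr (2 / p) * (s powr p) powr (1 - 2 / p) \<le> 2 / p * \<bar>x\<bar> powr p + (1 - 2 / p) * s powr p"
        using p False by (intro Youngs_inequality_0) (auto simp: field_simps)
      moreover have "(\<bar>x\<bar> powr p) powr (2 / p) = x\<^sup>2" using p by (simp add: powr_powr)
      moreover have "(s powr p) powr (1 - 2 / p) = s powr (p - 2)"
      proof -
        have "p * (1 - 2 / p) = p - 2" using p by (simp add: field_simps)
        then show ?thesis by (simp only: powr_powr)
      qed
      ultimately have "p / 2 * (x\<^sup>2 * s powr (p - 2)) \<le> p / 2 * (2 / p * \<bar>x\<bar> powr p + (1 - 2 / p) * s powr p)"
        using p by (intro mult_left_mono) auto
      also have "\<dots> = \<bar>x\<bar> powr p + (p / 2 - 1) * s powr p" using p by (simp add: field_simps)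
      finally show ?thesis by (simp add: A_def B_def algebra_simps)
    qed
    show thesis
    proof (rule that)
      show "A \<ge> 0" using p by (simp add: A_def)
      show "B \<ge> 0" by (rule B0)
      show "sympow p 1 x \<le> \<bar>x\<bar> powr p + A + B * x\<^sup>2" for x
      proof (cases "\<bar>x\<bar> \<le> 1")
        case True
        show ?thesis using sympow_one_upper1[OF _ _ True, of p] p 2 tangent[of x] by simp
      next
        case False
        have "p * (p - 1) / 2 \<le> 1 + A + B" using tangent[of 1] by simp
        \<comment> \<open>The tangent inequality at \<open>x = 1\<close>. Together with
          \<open>2 * B \<ge> p * (p - 2)\<close> it lets \<open>A + B * x^2\<close> absorb the
          linear bound valid for \<open>|x| > 1\<close>.\<close>
        have A1: "p * (p - 1) / 2 \<le> A + B"
        proof -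
          have "p / 2 * s powr (p - 2) \<le> 1 + (p / 2 - 1) * s powr p"
            using tangent[of 1] by (simp add: A_def B_def)
          then show ?thesis by (simp add: A_def B_def)
        qed
        have "p * (p - 2) * (\<bar>x\<bar> - 1) \<le> 2 * B * (\<bar>x\<bar> - 1)"
          using False B1 by (intro mult_right_mono) auto
        also have "\<dots> \<le> B * (x\<^sup>2 - 1)"
        proof -
          have "B * (2 * (\<bar>x\<bar> - 1)) \<le> B * (x\<^sup>2 - 1)"
          proof (rule mult_left_mono[OF _ B0])
            have "0 \<le> (\<bar>x\<bar> - 1)\<^sup>2" by simp
            then show "2 * (\<bar>x\<bar> - 1) \<le> x\<^sup>2 - 1" by (simp add: power2_eq_square algebra_simps)
          qed
          then show ?thesis by (simp add: algebra_simps)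
        qed
        also have "\<dots> = B * x\<^sup>2 - B" by (simp add: algebra_simps)
        finally have "p * (p - 2) * (\<bar>x\<bar> - 1) \<le> B * x\<^sup>2 - B" .
        moreover have "sympow p 1 x \<le> \<bar>x\<bar> powr p + p * (p - 1) / 2 + p * (p - 2) * (\<bar>x\<bar> - 1)"
          using False p 2 by (intro sympow_one_upper2) auto
        ultimately show ?thesis using A1 by linarith
      qed
      define k where "k = 1 - 2 powr (p - 3)"
      have k: "0 \<le> k" "k \<le> 1 / 2"
        using p 2 powr_mono[of "p - 3" 0 2] powr_mono[of "- 1" "p - 3" 2] by (auto simp: k_def powr_minus)
      have "A + B * s\<^sup>2 \<le> 1 + (p * (p - 1) / 2 * s\<^sup>2 - k * s powr p * (2 - p / 2)) + 3 * (- (k * s powr p * (p / 2 - 1)))"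
      proof -
        \<comment> \<open>The Gaussian minorant loses at most \<open>k * (p - 1) * s powr p\<close>
          through its negative term, while the tangent construction has gained
          \<open>s powr p\<close>; hence \<open>k * (p - 1) \<le> 1\<close> is what is
          needed.\<close>
        have "k * (p - 1) \<le> 1 / 2 * 2" using k p 2 by (intro mult_mono) auto
        then have "k * (p - 1) * s powr p \<le> 1 * s powr p" by (intro mult_right_mono) auto
        then show ?thesis unfolding AB by (simp add: algebra_simps)
      qed
      then have "ennreal (A + B * s\<^sup>2) \<le> ennreal (1 + (p * (p - 1) / 2 * s\<^sup>2 - k * s powr p * (2 - p / 2)) + 3 * (- (k * s powr p * (p / 2 - 1))))"
        by (rule ennreal_leI)
      also have "\<dots> \<le> (\<integral>\<^sup>+z. ennreal (sympow p 1 (s * z)) \<partial>std_normal_distribution)"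
      proof (rule std_normal_sympow_ge)
        fix z
        have "k * (s powr p * \<bar>z\<bar> powr p) \<le> k * (s powr p * ((2 - p / 2) * z\<^sup>2 + (p / 2 - 1) * z ^ 4))"
          using k p by (intro mult_left_mono abs_powr_le_quartic) auto
        moreover have "\<bar>s * z\<bar> powr p = s powr p * \<bar>z\<bar> powr p" using s by (simp add: abs_mult powr_mult)
        ultimately show "1 + (p * (p - 1) / 2 * s\<^sup>2 - k * s powr p * (2 - p / 2)) * z\<^sup>2 + - (k * s powr p * (p / 2 - 1)) * z ^ 4 \<le> sympow p 1 (s * z)"
          using sympow_one_lower1[of p "s * z"] p 2 by (simp add: k_def[symmetric] power_mult_distrib algebra_simps)
      qed
      finally show "ennreal (A + B * s\<^sup>2) \<le> (\<integral>\<^sup>+z. ennreal (sympow p 1 (s * z)) \<partial>std_normal_distribution)" .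
    qed
  next
    case 3
    \<comment> \<open>The witnesses \<open>p / 2\<close> and \<open>p * (p - 2) / 2\<close> are the
      \<open>A\<close> and \<open>B\<close> of the previous case at \<open>s = 1\<close>; it then
      suffices to compare with the Gaussian side at \<open>s = 1\<close>.\<close>
    show thesis
    proof (rule that)
      show "sympow p 1 x \<le> \<bar>x\<bar> powr p + p / 2 + p * (p - 2) / 2 * x\<^sup>2" for x
      proof (cases "\<bar>x\<bar> \<le> 1")
        case True
        show ?thesis
        proof (cases "x = 0")
          case False
          have "(\<bar>x\<bar> powr p) powr (2 / p) * 1 powr (1 - 2 / p) \<le> 2 / p * \<bar>x\<bar> powr p + (1 - 2 / p) * 1"
            using p False by (intro Youngs_inequality_0) (auto simp: field_simps)
          moreover have "(\<bar>x\<bar> powr p) powr (2 / p) = x\<^sup>2" using p by (simp add: powr_powr)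
          ultimately have "p / 2 * x\<^sup>2 \<le> p / 2 * (2 / p * \<bar>x\<bar> powr p + (1 - 2 / p))"
            using p by (intro mult_left_mono) auto
          also have "\<dots> = \<bar>x\<bar> powr p + (p / 2 - 1)" using p by (simp add: field_simps)
          finally have "1 + p * (p - 1) / 2 * x\<^sup>2 \<le> \<bar>x\<bar> powr p + p / 2 + p * (p - 2) / 2 * x\<^sup>2"
            by (simp add: field_simps)
          then show ?thesis using sympow_one_upper1[OF _ _ True, of p] p 3 by simp
        qed (use p in simp)
      next
        case False
        have "p * (p - 2) * (2 * (\<bar>x\<bar> - 1)) \<le> p * (p - 2) * (x\<^sup>2 - 1)"
        proof (rule mult_left_mono)
          have "0 \<le> (\<bar>x\<bar> - 1)\<^sup>2" by simp
          then show "2 * (\<bar>x\<bar> - 1) \<le> x\<^sup>2 - 1" by (simp add: power2_eq_square algebra_simps)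
        qed (use p in auto)
        then show ?thesis using sympow_one_upper2[of p x] p 3 False by (simp add: field_simps)
      qed
      have "p / 2 + p * (p - 2) / 2 * s\<^sup>2 \<le> 1 + p * (p - 1) / 2 * 2 powr (p - 3) * s\<^sup>2 + 3 * 0"
      proof -
        define q where "q = p - 2"
        have q: "0 < q" "q < 1" "p = q + 2" using p 3 by (auto simp: q_def)
        \<comment> \<open>A linear lower bound for \<open>2 powr (q - 1)\<close>:
          \<open>q - 1\<close> is negative, so an upper bound 7/10 for \<open>ln 2\<close> is what
          is required. The claim then becomes a cubic inequality in \<open>q\<close>, settled by a
          decomposition into terms that are nonnegative for \<open>q > 0\<close>.\<close>
        have "1 + (q - 1) * ln 2 \<le> exp ((q - 1) * ln 2)" by (rule exp_ge_add_one_self)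
        also have "\<dots> = 2 powr (p - 3)" using q by (simp add: powr_def)
        finally have "1 + (q - 1) * ln 2 \<le> 2 powr (p - 3)" .
        moreover have "(q - 1) * (7 / 10) \<le> (q - 1) * ln 2"
          using q ln2_le_25_over_36 by (intro mult_left_mono_neg) auto
        ultimately have w: "3 / 10 + 7 / 10 * q \<le> 2 powr (p - 3)" by simp
        have "q * (q + 3) \<le> (q + 2) * (q + 1) * (3 / 10 + 7 / 10 * q)"
        proof -
          have "(q + 2) * (q + 1) * (3 / 10 + 7 / 10 * q) - q * (q + 3) = 7 / 10 * q ^ 3 + 7 / 5 * (q - 1 / 4)\<^sup>2 + 41 / 80"
            by (simp add: power2_eq_square power3_eq_cube field_simps)
          also have "\<dots> \<ge> 0" using q by simp
          finally show ?thesis by simp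
        qed
        also have "\<dots> \<le> (q + 2) * (q + 1) * 2 powr (p - 3)" using q w by (intro mult_left_mono) auto
        finally have 1: "p / 2 - 1 \<le> p * (p - 1) / 2 * 2 powr (p - 3) - p * (p - 2) / 2"
          by (simp add: q field_simps)
        have "(p / 2 - 1) * 1 \<le> (p * (p - 1) / 2 * 2 powr (p - 3) - p * (p - 2) / 2) * s\<^sup>2"
        proof (rule mult_mono[OF 1])
          show "1 \<le> s\<^sup>2" using 3(2) by simp
          show "0 \<le> p * (p - 1) / 2 * 2 powr (p - 3) - p * (p - 2) / 2" using 1 p by linarith
        qed simp
        then show ?thesis by (simp add: field_simps)
      qed
      then have "ennreal (p / 2 + p * (p - 2) / 2 * s\<^sup>2) \<le> ennreal (1 + p * (p - 1) / 2 * 2 powr (p - 3) * s\<^sup>2 + 3 * 0)"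
        by (rule ennreal_leI)
      also have "\<dots> \<le> (\<integral>\<^sup>+z. ennreal (sympow p 1 (s * z)) \<partial>std_normal_distribution)"
      proof (rule std_normal_sympow_ge)
        show "1 + p * (p - 1) / 2 * 2 powr (p - 3) * s\<^sup>2 * z\<^sup>2 + 0 * z ^ 4 \<le> sympow p 1 (s * z)" for z
          using sympow_one_lower2[of p "s * z"] p 3 by (simp add: power_mult_distrib mult.assoc)
      qed
      finally show "ennreal (p / 2 + p * (p - 2) / 2 * s\<^sup>2) \<le> (\<integral>\<^sup>+z. ennreal (sympow p 1 (s * z)) \<partial>std_normal_distribution)" .
    qed (use p in auto)
  qed
qed

text \<open>Homogeneity: dividing by \<open>|y|\<close> leads to \<open>y = 1\<close> with
  \<open>s / |y|\<close> in place of \<open>s\<close>. At \<open>y = 0\<close> the majorant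
  \<open>|x|^p\<close> is exact and \<open>A = B = 0\<close>.\<close>

lemma quadratic_majorant:
  fixes p s y :: real
  assumes p: "2 < p" "p \<le> 4" and s: "s \<ge> 0"
  obtains A B where "A \<ge> 0" "B \<ge> 0"
    "\<And>x. sympow p y x \<le> \<bar>x\<bar> powr p + A + B * x\<^sup>2"
    "ennreal (A + B * s\<^sup>2) \<le> (\<integral>\<^sup>+z. ennreal (sympow p y (s * z)) \<partial>std_normal_distribution)"
proof (cases "y = 0")
  case True
  then show thesis using that[of 0 0] by simp
next
  case False
  obtain A B where AB: "A \<ge> 0" "B \<ge> 0"
    "\<And>x. sympow p 1 x \<le> \<bar>x\<bar> powr p + A + B * x\<^sup>2"
    "ennreal (A + B * (s / \<bar>y\<bar>)\<^sup>2) \<le> (\<integral>\<^sup>+z. ennreal (sympow p 1 (s / \<bar>y\<bar> * z)) \<partial>std_normal_distribution)"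
    using quadratic_majorant_one[OF p, of "s / \<bar>y\<bar>"] s by auto
  have sc: "sympow p y x = \<bar>y\<bar> powr p * sympow p 1 (x / \<bar>y\<bar>)" for x
    using sympow_scale[of p "\<bar>y\<bar>" 1 "x / \<bar>y\<bar>"] False by simp
  show thesis
  proof (rule that)
    show "\<bar>y\<bar> powr p * A \<ge> 0" "\<bar>y\<bar> powr p * (B / y\<^sup>2) \<ge> 0" using AB by auto
    fix x
    have "sympow p y x \<le> \<bar>y\<bar> powr p * (\<bar>x / \<bar>y\<bar>\<bar> powr p + A + B * (x / \<bar>y\<bar>)\<^sup>2)"
      unfolding sc by (intro mult_left_mono AB) auto
    also have "\<dots> = \<bar>x\<bar> powr p + \<bar>y\<bar> powr p * A + \<bar>y\<bar> powr p * (B / y\<^sup>2) * x\<^sup>2"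
      using False by (simp add: powr_divide field_simps)
    finally show "sympow p y x \<le> \<bar>x\<bar> powr p + \<bar>y\<bar> powr p * A + \<bar>y\<bar> powr p * (B / y\<^sup>2) * x\<^sup>2" .
  next
    have "ennreal (\<bar>y\<bar> powr p * A + \<bar>y\<bar> powr p * (B / y\<^sup>2) * s\<^sup>2) = ennreal (\<bar>y\<bar> powr p) * ennreal (A + B * (s / \<bar>y\<bar>)\<^sup>2)"
      by (subst ennreal_mult'[symmetric]) (use AB in \<open>auto simp: field_simps\<close>)
    also have "\<dots> \<le> ennreal (\<bar>y\<bar> powr p) * (\<integral>\<^sup>+z. ennreal (sympow p 1 (s / \<bar>y\<bar> * z)) \<partial>std_normal_distribution)"
      by (intro mult_left_mono AB) auto
    also have "\<dots> = (\<integral>\<^sup>+z. ennreal (sympow p y (s * z)) \<partial>std_normal_distribution)"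
    proof (subst nn_integral_cmult[symmetric])
      show "(\<integral>\<^sup>+z. ennreal (\<bar>y\<bar> powr p) * ennreal (sympow p 1 (s / \<bar>y\<bar> * z)) \<partial>std_normal_distribution) =
         (\<integral>\<^sup>+z. ennreal (sympow p y (s * z)) \<partial>std_normal_distribution)"
        by (simp add: sc[of "s * _"] ennreal_mult')
    qed (simp add: sympow_def)
    finally show "ennreal (\<bar>y\<bar> powr p * A + \<bar>y\<bar> powr p * (B / y\<^sup>2) * s\<^sup>2) \<le> (\<integral>\<^sup>+z. ennreal (sympow p y (s * z)) \<partial>std_normal_distribution)" .
  qed
qed


section \<open>Bounds for exponents above 3\<close>

text \<open>This is \<open>(A - 1) (B - 1) f \<ge> 0\<close> for the averages \<open>A\<close>,
  \<open>B\<close> over the shifts by \<open>x\<close>, \<open>-x\<close> and by \<open>t\<close>,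
  \<open>-t\<close>. Two derivatives in \<open>t\<close> replace \<open>f\<close> by a multiple of
  \<open>|z|^(p-2)\<close>; exchanging the order of the two averages leaves the convexity of that
  power, that is \<open>sympow_ge\<close>, which needs \<open>p \<ge> 3\<close>.\<close>

lemma sympow_four_point:
  assumes p: "p \<ge> 3"
  shows "sympow p y x + sympow p y t \<le> \<bar>y\<bar> powr p + (sympow p (y + x) t + sympow p (y - x) t) / 2"
proof -
  let ?q = "p - 1 - 1"
  let ?F = "\<lambda>t. (sympow p (y + x) t + sympow p (y - x) t) / 2 - sympow p y t"
  let ?F' = "\<lambda>t. (p * asympow (p - 1) (y + x) t + p * asympow (p - 1) (y - x) t) / 2 - p * asympow (p - 1) y t"
  let ?F'' = "\<lambda>t. (p * ((p - 1) * sympow ?q (y + x) t) + p * ((p - 1) * sympow ?q (y - x) t)) / 2 - p * ((p - 1) * sympow ?q y t)"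
  have "0 \<le> ?F \<bar>t\<bar> - (sympow p y x - \<bar>y\<bar> powr p)"
  proof (rule nonneg_deriv2_imp_nonneg[where a = 0 and b = "\<bar>t\<bar>" and
        F = "\<lambda>t. ?F t - (sympow p y x - \<bar>y\<bar> powr p)" and F' = "\<lambda>t. ?F' t - 0" and F'' = "\<lambda>t. ?F'' t - 0"])
    fix t :: real
    show "((\<lambda>t. ?F t - (sympow p y x - \<bar>y\<bar> powr p)) has_real_derivative ?F' t - 0) (at t)"
      using p by (intro DERIV_diff DERIV_add DERIV_cdivide DERIV_sympow DERIV_const) auto
    show "((\<lambda>t. ?F' t - 0) has_real_derivative ?F'' t - 0) (at t)"
      using p by (intro DERIV_diff DERIV_add DERIV_cdivide DERIV_cmult DERIV_asympow DERIV_const) auto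
    have "sympow ?q (y + x) t + sympow ?q (y - x) t = sympow ?q (y + t) x + sympow ?q (y - t) x"
      by (simp add: sympow_def algebra_simps add_divide_distrib)
    moreover have "\<bar>y + t\<bar> powr ?q \<le> sympow ?q (y + t) x" "\<bar>y - t\<bar> powr ?q \<le> sympow ?q (y - t) x"
      using p by (auto intro!: sympow_ge)
    moreover have "2 * sympow ?q y t = \<bar>y + t\<bar> powr ?q + \<bar>y - t\<bar> powr ?q" by (simp add: sympow_def)
    moreover have "s \<le> (a + b) / 2" if "a + b = c + d" "e \<le> c" "f \<le> d" "2 * s = e + f" for a b c d e f s :: real
      using that by (simp add: field_simps)
    ultimately have "sympow ?q y t \<le> (sympow ?q (y + x) t + sympow ?q (y - x) t) / 2" by blast
    then have "p * (p - 1) * sympow ?q y t \<le> p * (p - 1) * ((sympow ?q (y + x) t + sympow ?q (y - x) t) / 2)"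
      using p by (intro mult_left_mono) auto
    then show "0 \<le> ?F'' t - 0" by (simp add: algebra_simps add_divide_distrib diff_divide_distrib)
  next
    show "0 \<le> ?F 0 - (sympow p y x - \<bar>y\<bar> powr p)" by simp (simp add: sympow_def)
  qed auto
  then show ?thesis by simp
qed

lemma asympow_scale: "c \<ge> 0 \<Longrightarrow> c powr a * asympow a y x = asympow a (c * y) (c * x)"
  by (cases "c = 0")
     (simp_all add: asympow_def abs_mult powr_mult sgn_mult flip: distrib_left right_diff_distrib, simp add: algebra_simps)

text \<open>Here the derivative is taken in the first argument \<open>u\<close>, and its sign is
  that of \<open>|u + s| - |u - s|\<close>. Exponent 1, where the function is constant in
  \<open>u\<close>, occurs for \<open>p = 4\<close>.\<close>

lemma asympow_mono:
  assumes a: "a \<ge> 1" and y: "0 \<le> z" "z \<le> y" and s: "0 \<le> s"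
  shows "asympow a z s \<le> asympow a y s"
proof (cases "a = 1")
  case True
  have "sgn x * \<bar>x\<bar> = x" for x :: real by (simp add: sgn_if)
  then have "asympow a u s = s" for u by (simp add: asympow_def True)
  then show ?thesis by simp
next
  case False
  with a have a: "a > 1" by simp
  show ?thesis
  proof (rule DERIV_nonneg_imp_nondecreasing[OF y(2)])
    fix u assume u: "z \<le> u" "u \<le> y"
    have "((\<lambda>u. sgn (u + s) * \<bar>u + s\<bar> powr a) has_real_derivative a * \<bar>u + s\<bar> powr (a - 1) * 1) (at u)"
      by (rule DERIV_chain2[where g = "\<lambda>u. u + s", OF DERIV_sgn_abs_powr[OF a]]) (auto intro!: derivative_eq_intros)
    moreover have "((\<lambda>u. sgn (u - s) * \<bar>u - s\<bar> powr a) has_real_derivative a * \<bar>u - s\<bar> powr (a - 1) * 1) (at u)"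
      by (rule DERIV_chain2[where g = "\<lambda>u. u - s", OF DERIV_sgn_abs_powr[OF a]]) (auto intro!: derivative_eq_intros)
    ultimately have "((\<lambda>u. asympow a u s) has_real_derivative
        (a * \<bar>u + s\<bar> powr (a - 1) * 1 - a * \<bar>u - s\<bar> powr (a - 1) * 1) / 2) (at u)"
      unfolding asympow_def by (intro DERIV_cdivide DERIV_diff)
    moreover have "\<bar>u - s\<bar> powr (a - 1) \<le> \<bar>u + s\<bar> powr (a - 1)"
      using a u y s by (intro powr_mono2) auto
    ultimately show "\<exists>d. ((\<lambda>u. asympow a u s) has_real_derivative d) (at u) \<and> 0 \<le> d"
      using a by (intro exI[of _ "(a * \<bar>u + s\<bar> powr (a - 1) * 1 - a * \<bar>u - s\<bar> powr (a - 1) * 1) / 2"]) (simp add: mult_left_mono)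
  qed
qed

section \<open>Scaling of a jump for \<open>p\<close> at least 4\<close>

context
  fixes p y :: real
  assumes p: "p \<ge> 4" and y: "y \<ge> 0"
begin

text \<open>
  The defect is \<open>r\<^sup>3\<close> times the derivative of \<open>(sympow p y r - y\<^sup>p) / r\<^sup>2\<close>.  This quotient is concave in
  \<open>r\<^sup>p\<^sup>-\<^sup>2\<close> because \<open>defect r / r\<^sup>p\<close> is decreasing, which is what \<open>defect_scale\<close> says.
\<close>

definition defect :: "real \<Rightarrow> real" where
  "defect r = r * (p * asympow (p - 1) y r) - 2 * (sympow p y r - y powr p)"

definition defect' :: "real \<Rightarrow> real" where
  "defect' r = r * (p * ((p - 1) * sympow (p - 2) y r)) - p * asympow (p - 1) y r"

definition defect'' :: "real \<Rightarrow> real" where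
  "defect'' r = r * (p * ((p - 1) * ((p - 2) * asympow (p - 3) y r)))"

lemma DERIV_defect: "(defect has_real_derivative defect' r) (at r)"
proof -
  have "(asympow (p - 1) y has_real_derivative (p - 1) * sympow (p - 2) y r) (at r)"
    using DERIV_asympow[of "p - 1" y r] p by simp
  then show ?thesis unfolding defect_def[abs_def] defect'_def using p DERIV_sympow[of p y r]
    by (auto intro!: derivative_eq_intros simp: algebra_simps)
qed

lemma DERIV_defect': "(defect' has_real_derivative defect'' r) (at r)"
proof -
  have "(asympow (p - 1) y has_real_derivative (p - 1) * sympow (p - 2) y r) (at r)"
    "(sympow (p - 2) y has_real_derivative (p - 2) * asympow (p - 3) y r) (at r)"
    using DERIV_asympow[of "p - 1" y r] DERIV_sympow[of "p - 2" y r] p by simp_all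
  then show ?thesis unfolding defect'_def[abs_def] defect''_def
    by (auto intro!: derivative_eq_intros simp: algebra_simps)
qed

lemma defect_0 [simp]: "defect 0 = 0" "defect' 0 = 0"
  using y by (simp_all add: defect_def defect'_def)

lemma defect_nonneg: "r \<ge> 0 \<Longrightarrow> defect r \<ge> 0"
proof (rule nonneg_deriv2_imp_nonneg[where a = 0 and b = r, OF DERIV_defect DERIV_defect'])
  show "0 \<le> defect'' x" if "0 \<le> x" for x
    using that p asympow_nonneg[of "p - 3" x y] by (simp add: defect''_def)
qed auto

text \<open>After two derivatives in \<open>r\<close> both sides carry the same factor of order
  \<open>\<theta>^3 r\<close>, and what remains to be compared is \<open>asympow (p - 3)\<close> at
  \<open>(\<theta> y, \<theta> r)\<close> and at \<open>(y, \<theta> r)\<close>. Monotonicity in the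
  first argument decides; it requires \<open>p - 3 \<ge> 1\<close>.\<close>

lemma defect_scale:
  assumes \<theta>: "0 \<le> \<theta>" "\<theta> \<le> 1" and r: "r \<ge> 0"
  shows "\<theta> powr p * defect r \<le> defect (\<theta> * r)"
proof (cases "\<theta> = 0")
  case False
  have "0 \<le> defect (\<theta> * r) - \<theta> powr p * defect r"
  proof (rule nonneg_deriv2_imp_nonneg[where a = 0 and b = r and F = "\<lambda>r. defect (\<theta> * r) - \<theta> powr p * defect r"
      and F' = "\<lambda>r. \<theta> * defect' (\<theta> * r) - \<theta> powr p * defect' r"
      and F'' = "\<lambda>r. \<theta> * (\<theta> * defect'' (\<theta> * r)) - \<theta> powr p * defect'' r"])
    fix r :: real assume r: "0 \<le> r"
    have sc: "((\<lambda>r. g (\<theta> * r)) has_real_derivative \<theta> * g' (\<theta> * r)) (at r)"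
      if "\<And>x. (g has_real_derivative g' x) (at x)" for g g'
    proof -
      have "((\<lambda>r. \<theta> * r) has_real_derivative \<theta>) (at r)" by (auto intro!: derivative_eq_intros)
      from DERIV_chain2[OF that this] show ?thesis by (simp only: mult.commute[of _ \<theta>])
    qed
    show "((\<lambda>r. defect (\<theta> * r) - \<theta> powr p * defect r) has_real_derivative
        \<theta> * defect' (\<theta> * r) - \<theta> powr p * defect' r) (at r)"
      by (intro DERIV_diff DERIV_cmult sc DERIV_defect)
    show "((\<lambda>r. \<theta> * defect' (\<theta> * r) - \<theta> powr p * defect' r) has_real_derivative
        \<theta> * (\<theta> * defect'' (\<theta> * r)) - \<theta> powr p * defect'' r) (at r)"
      by (intro DERIV_diff DERIV_cmult sc DERIV_defect')
    have "\<theta> powr (p - 3) * asympow (p - 3) y r \<le> asympow (p - 3) y (\<theta> * r)"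
      using p y \<theta> r by (simp add: asympow_scale) (intro asympow_mono mult_left_le_one_le, auto)
    then have "\<theta> ^ 3 * r * p * (p - 1) * (p - 2) * (\<theta> powr (p - 3) * asympow (p - 3) y r) \<le>
        \<theta> ^ 3 * r * p * (p - 1) * (p - 2) * asympow (p - 3) y (\<theta> * r)"
      using p \<theta> r by (intro mult_left_mono) auto
    moreover have "\<theta> powr p = \<theta> ^ 3 * \<theta> powr (p - 3)" using \<theta> False by (simp add: powr_diff)
    then have "\<theta> powr p * defect'' r = \<theta> ^ 3 * r * p * (p - 1) * (p - 2) * (\<theta> powr (p - 3) * asympow (p - 3) y r)"
      by (simp only: defect''_def mult_ac)
    moreover have "\<theta> * (\<theta> * defect'' (\<theta> * r)) = \<theta> ^ 3 * r * p * (p - 1) * (p - 2) * asympow (p - 3) y (\<theta> * r)"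
      by (simp add: defect''_def power3_eq_cube)
    ultimately show "0 \<le> \<theta> * (\<theta> * defect'' (\<theta> * r)) - \<theta> powr p * defect'' r"
      by simp
  qed (use assms in auto)
  then show ?thesis by simp
qed simp

lemma sympow_scale_le_nonneg:
  assumes x: "x \<ge> 0" and \<rho>: "\<rho> > 0"
  shows "sympow p y (\<rho> * x) \<le> y powr p + \<rho>\<^sup>2 * (sympow p y x - y powr p - defect x / (p - 2)) + \<rho> powr p * (defect x / (p - 2))"
proof -
  \<comment> \<open>The difference quotient minus its linear part in
    \<open>\<rho> powr (p - 2)\<close>, with the slope chosen so that the derivative vanishes at
    \<open>\<rho> = 1\<close>. By \<open>defect_scale\<close> the derivative changes from
    nonnegative to nonpositive there, so \<open>G\<close> is largest at 1.\<close>
  define G where "G = (\<lambda>\<rho>. (sympow p y (\<rho> * x) - y powr p) / \<rho>\<^sup>2 - defect x / (p - 2) * \<rho> powr (p - 2))"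
  have dG: "(G has_real_derivative (defect (\<rho> * x) - \<rho> powr p * defect x) / \<rho> ^ 3) (at \<rho>)" if "\<rho> > 0" for \<rho>
  proof -
    have "((\<lambda>\<rho>. sympow p y (\<rho> * x)) has_real_derivative p * asympow (p - 1) y (\<rho> * x) * x) (at \<rho>)"
      using p by (intro DERIV_chain2[where g = "\<lambda>\<rho>. \<rho> * x", OF DERIV_sympow]) (auto intro!: derivative_eq_intros)
    then have "((\<lambda>\<rho>. (sympow p y (\<rho> * x) - y powr p) / \<rho>\<^sup>2) has_real_derivative
      (p * asympow (p - 1) y (\<rho> * x) * x * \<rho>\<^sup>2 - (sympow p y (\<rho> * x) - y powr p) * (2 * \<rho>)) / (\<rho>\<^sup>2 * \<rho>\<^sup>2)) (at \<rho>)"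
      using that by (auto intro!: derivative_eq_intros)
    moreover have "((\<lambda>\<rho>. defect x / (p - 2) * \<rho> powr (p - 2)) has_real_derivative
      defect x / (p - 2) * ((p - 2) * \<rho> powr (p - 2 - 1))) (at \<rho>)"
      using that by (intro DERIV_cmult has_real_derivative_powr)
    ultimately have "(G has_real_derivative (p * asympow (p - 1) y (\<rho> * x) * x * \<rho>\<^sup>2 - (sympow p y (\<rho> * x) - y powr p) * (2 * \<rho>)) / (\<rho>\<^sup>2 * \<rho>\<^sup>2)
      - defect x / (p - 2) * ((p - 2) * \<rho> powr (p - 2 - 1))) (at \<rho>)"
      unfolding G_def by (rule DERIV_diff)
    moreover have "\<rho> powr (p - 2 - 1) = \<rho> powr p / \<rho> ^ 3"
    proof -
      have "\<rho> powr (p - 3) = \<rho> powr p / \<rho> powr 3" by (rule powr_diff)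
      then show ?thesis using that by simp
    qed
    moreover have "defect x / (p - 2) * ((p - 2) * z) = defect x * z" for z
      using p by simp
    moreover have "(p * asympow (p - 1) y (\<rho> * x) * x * \<rho>\<^sup>2 - (sympow p y (\<rho> * x) - y powr p) * (2 * \<rho>)) / (\<rho>\<^sup>2 * \<rho>\<^sup>2) =
       defect (\<rho> * x) / \<rho> ^ 3"
      using that by (simp add: defect_def power2_eq_square power3_eq_cube field_simps)
    ultimately show ?thesis
      by (simp add: diff_divide_distrib mult.commute)
  qed
  have "G \<rho> \<le> G 1"
  proof (cases "\<rho> \<le> 1")
    case True
    show ?thesis
    proof (rule DERIV_nonneg_imp_nondecreasing[OF True])
      fix t assume t: "\<rho> \<le> t" "t \<le> 1"
      have "0 \<le> (defect (t * x) - t powr p * defect x) / t ^ 3"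
        using defect_scale[of t x] t \<rho> x by simp
      then show "\<exists>d. (G has_real_derivative d) (at t) \<and> 0 \<le> d"
        using dG[of t] t \<rho> by auto
    qed
  next
    case False
    show ?thesis
    proof (rule DERIV_nonpos_imp_nonincreasing[of 1 \<rho> G])
      show "1 \<le> \<rho>" using False by simp
      fix t assume t: "1 \<le> t" "t \<le> \<rho>"
      \<comment> \<open>For \<open>t \<ge> 1\<close> the scaling inequality is read backwards, from
        the point \<open>t * x\<close> with the factor \<open>1 / t\<close>.\<close>
      have "(1 / t) powr p * defect (t * x) \<le> defect (1 / t * (t * x))"
        using t x by (intro defect_scale) auto
      then have "defect (t * x) \<le> t powr p * defect x"
        using t by (simp add: powr_divide field_simps)
      then have "(defect (t * x) - t powr p * defect x) / t ^ 3 \<le> 0"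
        using t by (simp add: divide_nonpos_pos)
      then show "\<exists>d. (G has_real_derivative d) (at t) \<and> d \<le> 0"
        using dG[of t] t by auto
    qed
  qed
  then have "\<rho>\<^sup>2 * G \<rho> \<le> \<rho>\<^sup>2 * G 1" by (intro mult_left_mono) auto
  moreover have "\<rho>\<^sup>2 * \<rho> powr (p - 2) = \<rho> powr p"
  proof -
    have "\<rho> powr (p - 2) = \<rho> powr p / \<rho> powr 2" by (rule powr_diff)
    then show ?thesis using \<rho> by simp
  qed
  moreover have "\<rho>\<^sup>2 * G \<rho> = sympow p y (\<rho> * x) - y powr p - defect x / (p - 2) * (\<rho>\<^sup>2 * \<rho> powr (p - 2))"
  proof -
    have "\<rho>\<^sup>2 * (a / \<rho>\<^sup>2 - b * c) = a - b * (\<rho>\<^sup>2 * c)" for a b c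
      using \<rho> by (simp add: right_diff_distrib)
    then show ?thesis unfolding G_def .
  qed
  moreover have "G 1 = sympow p y x - y powr p - defect x / (p - 2)" by (simp add: G_def)
  ultimately show ?thesis by (simp add: algebra_simps)
qed

end

lemma asympow_sgn: "x * asympow a y x = \<bar>x\<bar> * asympow a \<bar>y\<bar> \<bar>x\<bar>"
proof -
  have 1: "asympow a y (-x) = - asympow a y x" for x y
  proof -
    have "(a - b) / 2 = - ((b - a) / 2)" for a b :: real by (simp add: field_simps)
    then show ?thesis unfolding asympow_def diff_minus_eq_add add_uminus_conv_diff .
  qed
  have 2: "asympow a (-y) x = asympow a y x" for x y
  proof -
    have *: "- y + x = - (y - x)" "- y - x = - (y + x)" by auto
    have "(- a * b - - c * d) / 2 = (c * d - a * b) / 2" for a b c d :: real by (simp add: field_simps)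
    then show ?thesis unfolding asympow_def * sgn_minus abs_minus_cancel .
  qed
  show ?thesis by (auto simp: abs_if 1 2)
qed

text \<open>
  The slope at \<open>\<rho> = 1\<close>, with respect to \<open>\<rho>\<^sup>p\<^sup>-\<^sup>2\<close>, of \<open>(sympow p y (\<rho> x) - \<bar>y\<bar>\<^sup>p) / \<rho>\<^sup>2\<close>.
\<close>

definition pcoef :: "real \<Rightarrow> real \<Rightarrow> real \<Rightarrow> real" where
  "pcoef p y x = (x * (p * asympow (p - 1) y x) - 2 * (sympow p y x - \<bar>y\<bar> powr p)) / (p - 2)"

lemma sympow_scale_le:
  assumes p: "p \<ge> 4" and \<rho>: "\<rho> \<ge> 0"
  shows "sympow p y (\<rho> * x) \<le> \<bar>y\<bar> powr p + \<rho>\<^sup>2 * (sympow p y x - \<bar>y\<bar> powr p - pcoef p y x) + \<rho> powr p * pcoef p y x"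
proof (cases "\<rho> = 0")
  case False
  have "x * (p * asympow (p - 1) y x) = \<bar>x\<bar> * (p * asympow (p - 1) \<bar>y\<bar> \<bar>x\<bar>)"
    using asympow_sgn[of x "p - 1" y] by (simp add: mult.left_commute)
  then have "pcoef p y x = defect p \<bar>y\<bar> \<bar>x\<bar> / (p - 2)" using p by (simp add: pcoef_def defect_def)
  moreover have "sympow p \<bar>y\<bar> (\<rho> * \<bar>x\<bar>) = sympow p y (\<rho> * x)"
    using \<rho> sympow_simps(6)[of p y "\<rho> * x"] by (simp add: abs_mult)
  ultimately show ?thesis using sympow_scale_le_nonneg[of p "\<bar>y\<bar>" "\<bar>x\<bar>" \<rho>] p \<rho> False by simp
qed (use p in simp)

lemma pcoef_nonneg: "p \<ge> 4 \<Longrightarrow> pcoef p y x \<ge> 0"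
proof -
  assume p: "p \<ge> 4"
  have "x * (p * asympow (p - 1) y x) = \<bar>x\<bar> * (p * asympow (p - 1) \<bar>y\<bar> \<bar>x\<bar>)"
    using asympow_sgn[of x "p - 1" y] by (simp add: mult.left_commute)
  then have "pcoef p y x = defect p \<bar>y\<bar> \<bar>x\<bar> / (p - 2)" using p by (simp add: pcoef_def defect_def)
  then show ?thesis using defect_nonneg[of p "\<bar>y\<bar>" "\<bar>x\<bar>"] p by simp
qed

text \<open>The intercept of the tangent bound is nonnegative: divide that bound by
  \<open>\<rho>^2\<close>, use \<open>sympow_ge\<close>, and let \<open>\<rho>\<close> tend to 0.
  With \<open>pcoef_nonneg\<close> both coefficients are nonnegative, so they can be integrated in
  \<open>ennreal\<close>.\<close>

lemma pcoef_le:
  assumes p: "p \<ge> 4"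
  shows "pcoef p y x \<le> sympow p y x - \<bar>y\<bar> powr p"
proof -
  define B where "B = sympow p y x - \<bar>y\<bar> powr p - pcoef p y x"
  have "0 \<le> B"
  proof (rule tendsto_lowerbound)
    have "\<forall>\<^sub>F \<rho> in at_right (0::real). 0 \<le> \<rho>"
      by (rule eventually_mono[OF eventually_at_right_less]) auto
    then have "((\<lambda>\<rho>. B + \<rho> powr (p - 2) * pcoef p y x) \<longlongrightarrow> B + 0 * pcoef p y x) (at_right 0)"
      using p by (intro tendsto_intros tendsto_zero_powrI[OF tendsto_ident_at tendsto_const]) auto
    then show "((\<lambda>\<rho>. B + \<rho> powr (p - 2) * pcoef p y x) \<longlongrightarrow> B) (at_right 0)" by simp
    show "\<forall>\<^sub>F \<rho> in at_right 0. 0 \<le> B + \<rho> powr (p - 2) * pcoef p y x"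
    proof (rule eventually_at_right_less[THEN eventually_mono])
      fix \<rho> :: real assume \<rho>: "0 < \<rho>"
      have "\<bar>y\<bar> powr p \<le> sympow p y (\<rho> * x)" using p by (intro sympow_ge) auto
      also have "\<dots> \<le> \<bar>y\<bar> powr p + \<rho>\<^sup>2 * B + \<rho> powr p * pcoef p y x"
        unfolding B_def using p \<rho> by (intro sympow_scale_le) auto
      also have "\<rho> powr p = \<rho>\<^sup>2 * \<rho> powr (p - 2)"
      proof -
        have "\<rho> powr (p - 2) = \<rho> powr p / \<rho> powr 2" by (rule powr_diff)
        then show ?thesis using \<rho> by simp
      qed
      finally have "0 \<le> \<rho>\<^sup>2 * (B + \<rho> powr (p - 2) * pcoef p y x)" by (simp add: algebra_simps)
      then show "0 \<le> B + \<rho> powr (p - 2) * pcoef p y x" using \<rho> by (simp add: zero_le_mult_iff)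
    qed
  qed simp
  then show ?thesis by (simp add: B_def)
qed


section \<open>Exponentials of positive operators\<close>

type_synonym op = "(real \<Rightarrow> ennreal) \<Rightarrow> real \<Rightarrow> ennreal"

text \<open>Countable additivity is what lets an operator pass through the exponential series of
  another one. Everything is required on measurable functions only, because the operators will be
  integrals.\<close>

definition pos_op :: "op \<Rightarrow> bool" where
  "pos_op A \<longleftrightarrow>
     (\<forall>f\<in>borel_measurable borel. A f \<in> borel_measurable borel) \<and>
     (\<forall>f\<in>borel_measurable borel. \<forall>g\<in>borel_measurable borel. \<forall>y. A (\<lambda>y. f y + g y) y = A f y + A g y) \<and>
     (\<forall>f\<in>borel_measurable borel. \<forall>c y. A (\<lambda>y. c * f y) y = c * A f y) \<and>
     (\<forall>f::nat \<Rightarrow> real \<Rightarrow> ennreal. (\<forall>i. f i \<in> borel_measurable borel) \<longrightarrow> (\<forall>y. A (\<lambda>y. \<Sum>i. f i y) y = (\<Sum>i. A (f i) y))) \<and>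
     (\<forall>f\<in>borel_measurable borel. \<forall>g\<in>borel_measurable borel. (\<forall>y. f y \<le> g y) \<longrightarrow> (\<forall>y. A f y \<le> A g y))"

definition commute_op :: "op \<Rightarrow> op \<Rightarrow> bool" where
  "commute_op A B \<longleftrightarrow> (\<forall>f\<in>borel_measurable borel. A (B f) = B (A f))"

abbreviation add_op :: "op \<Rightarrow> op \<Rightarrow> op" where
  "add_op A B \<equiv> \<lambda>f y. A f y + B f y"

abbreviation scale_op :: "ennreal \<Rightarrow> op" where
  "scale_op c \<equiv> \<lambda>f y. c * f y"

definition exp_op :: "op \<Rightarrow> op" where
  "exp_op A f y = (\<Sum>k. ennreal (1 / fact k) * (A ^^ k) f y)"

lemma pos_opD:
  assumes "pos_op A"
  shows pos_op_measurable: "f \<in> borel_measurable borel \<Longrightarrow> A f \<in> borel_measurable borel"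
    and pos_op_add: "f \<in> borel_measurable borel \<Longrightarrow> g \<in> borel_measurable borel \<Longrightarrow> A (\<lambda>y. f y + g y) y = A f y + A g y"
    and pos_op_cmult: "f \<in> borel_measurable borel \<Longrightarrow> A (\<lambda>y. c * f y) y = c * A f y"
    and pos_op_suminf: "(\<And>i::nat. h i \<in> borel_measurable borel) \<Longrightarrow> A (\<lambda>y. \<Sum>i. h i y) y = (\<Sum>i. A (h i) y)"
    and pos_op_mono: "f \<in> borel_measurable borel \<Longrightarrow> g \<in> borel_measurable borel \<Longrightarrow> (\<And>y. f y \<le> g y) \<Longrightarrow> A f y \<le> A g y"
  using assms unfolding pos_op_def by blast+

lemma pos_op_zero: "pos_op A \<Longrightarrow> A (\<lambda>y. 0) y = 0"
  using pos_op_cmult[of A "\<lambda>_. 0" 0 y] by simp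

lemma pos_op_sum:
  assumes A: "pos_op A" and I: "finite I" and h: "\<And>i. i \<in> I \<Longrightarrow> h i \<in> borel_measurable borel"
  shows "A (\<lambda>y. \<Sum>i\<in>I. h i y) y = (\<Sum>i\<in>I. A (h i) y)"
  using I h by (induction I) (auto simp: pos_op_zero[OF A] pos_op_add[OF A])

lemma pos_op_scale: "pos_op (scale_op c)"
  unfolding pos_op_def by (auto simp: distrib_left mult.left_commute mult_left_mono)

lemma pos_op_add_op:
  assumes A: "pos_op A" and B: "pos_op B"
  shows "pos_op (add_op A B)"
  unfolding pos_op_def
proof (intro conjI ballI allI impI)
  fix f g :: "real \<Rightarrow> ennreal" and c y assume [measurable]: "f \<in> borel_measurable borel"
  note [measurable] = pos_op_measurable[OF A] pos_op_measurable[OF B]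
  show "(\<lambda>y. A f y + B f y) \<in> borel_measurable borel" by measurable
  show "A (\<lambda>y. c * f y) y + B (\<lambda>y. c * f y) y = c * (A f y + B f y)"
    by (simp add: pos_op_cmult[OF A] pos_op_cmult[OF B] distrib_left)
  assume [measurable]: "g \<in> borel_measurable borel"
  show "A (\<lambda>y. f y + g y) y + B (\<lambda>y. f y + g y) y = A f y + B f y + (A g y + B g y)"
    by (simp add: pos_op_add[OF A] pos_op_add[OF B] ac_simps)
  assume "\<forall>y. f y \<le> g y"
  then show "A f y + B f y \<le> A g y + B g y"
    by (intro add_mono pos_op_mono[OF A] pos_op_mono[OF B]) auto
next
  fix f :: "nat \<Rightarrow> real \<Rightarrow> ennreal" and y assume f: "\<forall>i. f i \<in> borel_measurable borel"
  then show "A (\<lambda>y. \<Sum>i. f i y) y + B (\<lambda>y. \<Sum>i. f i y) y = (\<Sum>i. A (f i) y + B (f i) y)"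
    by (simp add: pos_op_suminf[OF A] pos_op_suminf[OF B] suminf_add)
qed

lemma pos_op_comp:
  assumes A: "pos_op A" and B: "pos_op B"
  shows "pos_op (\<lambda>f. A (B f))"
  unfolding pos_op_def
proof (intro conjI ballI allI impI)
  fix f g :: "real \<Rightarrow> ennreal" and c y assume f: "f \<in> borel_measurable borel"
  note m = pos_op_measurable[OF A] pos_op_measurable[OF B]
  show "A (B f) \<in> borel_measurable borel" by (intro m f)
  have "B (\<lambda>y. c * f y) = (\<lambda>y. c * B f y)" by (intro ext pos_op_cmult[OF B] f)
  then show "A (B (\<lambda>y. c * f y)) y = c * A (B f) y"
    by (simp add: pos_op_cmult[OF A] f m)
  assume g: "g \<in> borel_measurable borel"
  have "B (\<lambda>y. f y + g y) = (\<lambda>y. B f y + B g y)" by (intro ext pos_op_add[OF B] f g)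
  then show "A (B (\<lambda>y. f y + g y)) y = A (B f) y + A (B g) y"
    by (simp add: pos_op_add[OF A] f g m)
  assume "\<forall>y. f y \<le> g y"
  then show "A (B f) y \<le> A (B g) y"
    by (intro pos_op_mono[OF A] pos_op_mono[OF B] f g m) auto
next
  fix f :: "nat \<Rightarrow> real \<Rightarrow> ennreal" and y assume f: "\<forall>i. f i \<in> borel_measurable borel"
  have "B (\<lambda>y. \<Sum>i. f i y) = (\<lambda>y. \<Sum>i. B (f i) y)" using f by (intro ext pos_op_suminf[OF B]) auto
  then show "A (B (\<lambda>y. \<Sum>i. f i y)) y = (\<Sum>i. A (B (f i)) y)"
    using f by (simp add: pos_op_suminf[OF A] pos_op_measurable[OF B])
qed

lemma pos_op_funpow:
  assumes "pos_op A"
  shows "pos_op (A ^^ k)"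
proof (induction k)
  case 0
  then show ?case by (simp add: pos_op_def id_def)
next
  case (Suc k)
  show ?case using pos_op_comp[OF assms Suc] by (simp add: comp_def)
qed

lemma measurable_exp_op:
  "pos_op A \<Longrightarrow> f \<in> borel_measurable borel \<Longrightarrow> exp_op A f \<in> borel_measurable borel"
  unfolding exp_op_def[abs_def] using pos_op_measurable[OF pos_op_funpow] by measurable

text \<open>Tonelli for counting measure, applied to the array padded by zeros below the diagonal;
  hence no summability is assumed.\<close>

lemma suminf_Cauchy_ennreal:
  fixes g :: "nat \<Rightarrow> nat \<Rightarrow> ennreal"
  shows "(\<Sum>k. \<Sum>i\<le>k. g i (k - i)) = (\<Sum>i. \<Sum>j. g i j)"
proof -
  define h where "h i k = (if i \<le> k then g i (k - i) else 0)" for i k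
  have "(\<Sum>i\<le>k. g i (k - i)) = (\<Sum>i. h i k)" for k
    by (subst suminf_finite[of "{..k}"]) (auto simp: h_def)
  then have "(\<Sum>k. \<Sum>i\<le>k. g i (k - i)) = (\<integral>\<^sup>+k. (\<Sum>i. h i k) \<partial>count_space UNIV)"
    by (simp add: nn_integral_count_space_nat)
  also have "\<dots> = (\<Sum>i. \<Sum>k. h i k)"
    by (subst nn_integral_suminf) (auto simp: nn_integral_count_space_nat)
  finally have 1: "(\<Sum>k. \<Sum>i\<le>k. g i (k - i)) = (\<Sum>i. \<Sum>k. h i k)" .
  have "(\<Sum>k. h i k) = (\<Sum>j. g i j)" for i
  proof (rule LIMSEQ_unique)
    have "(\<lambda>n. \<Sum>k<n + i. h i k) \<longlonglongrightarrow> (\<Sum>k. h i k)"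
      by (rule LIMSEQ_ignore_initial_segment[OF summable_LIMSEQ]) simp
    then show "(\<lambda>n. \<Sum>j<n. g i j) \<longlonglongrightarrow> (\<Sum>k. h i k)"
    proof (rule Lim_transform_eventually, intro always_eventually allI)
      fix n
      have "(\<Sum>k<n + i. h i k) = (\<Sum>k\<in>{i..<n + i}. h i k)"
        by (rule sum.mono_neutral_right) (auto simp: h_def)
      also have "\<dots> = (\<Sum>j<n. g i j)"
        by (rule sum.reindex_bij_witness[of _ "\<lambda>j. j + i" "\<lambda>k. k - i"]) (auto simp: h_def)
      finally show "(\<Sum>k<n + i. h i k) = (\<Sum>j<n. g i j)" .
    qed
    show "(\<lambda>n. \<Sum>j<n. g i j) \<longlonglongrightarrow> (\<Sum>j. g i j)" by (rule summable_LIMSEQ) simp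
  qed
  with 1 show ?thesis by simp
qed

text \<open>Pascal's rule with an abstract array in place of products of powers, since
  \<open>(A ^^ i) ((B ^^ j) f) y\<close> is not a product in a ring.\<close>

lemma sum_binomial_Suc:
  fixes g :: "nat \<Rightarrow> nat \<Rightarrow> 'a::comm_semiring_1"
  shows "(\<Sum>i\<le>Suc k. of_nat (Suc k choose i) * g i (Suc k - i)) =
    (\<Sum>i\<le>k. of_nat (k choose i) * g (Suc i) (k - i)) + (\<Sum>i\<le>k. of_nat (k choose i) * g i (Suc (k - i)))"
proof -
  have "(\<Sum>i\<le>Suc k. of_nat (Suc k choose i) * g i (Suc k - i)) =
      g 0 (Suc k) + (\<Sum>i\<le>k. of_nat (Suc k choose Suc i) * g (Suc i) (k - i))"
    by (subst sum.atMost_Suc_shift) simp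
  also have "\<dots> = (\<Sum>i\<le>k. of_nat (k choose i) * g (Suc i) (k - i)) +
      (g 0 (Suc k) + (\<Sum>i\<le>k. of_nat (k choose Suc i) * g (Suc i) (k - i)))"
    by (simp add: distrib_right distrib_left sum.distrib ac_simps)
  also have "g 0 (Suc k) + (\<Sum>i\<le>k. of_nat (k choose Suc i) * g (Suc i) (k - i)) =
      (\<Sum>i\<le>Suc k. of_nat (k choose i) * g i (Suc k - i))"
    by (subst sum.atMost_Suc_shift) simp
  also have "\<dots> = (\<Sum>i\<le>k. of_nat (k choose i) * g i (Suc (k - i)))"
    by (simp add: binomial_eq_0) (auto simp: Suc_diff_le intro!: sum.cong)
  finally show ?thesis .
qed

lemma commute_opD: "commute_op A B \<Longrightarrow> f \<in> borel_measurable borel \<Longrightarrow> A (B f) = B (A f)"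
  by (simp add: commute_op_def)

lemma commute_op_sym: "commute_op A B \<Longrightarrow> commute_op B A"
  by (simp add: commute_op_def)

lemma commute_op_funpow:
  assumes A: "pos_op A" and AB: "commute_op A B"
  shows "commute_op (A ^^ k) B"
proof (induction k)
  case 0
  then show ?case by (simp add: commute_op_def)
next
  case (Suc k)
  show ?case unfolding commute_op_def
    using commute_opD[OF Suc] commute_opD[OF AB] pos_op_measurable[OF pos_op_funpow[OF A]] by simp
qed

lemma commute_op_exp:
  assumes A: "pos_op A" and B: "pos_op B" and AB: "commute_op A B"
  shows "commute_op (exp_op A) B"
  unfolding commute_op_def
proof (intro ballI ext)
  fix f :: "real \<Rightarrow> ennreal" and y assume f: "f \<in> borel_measurable borel"
  note m = pos_op_measurable[OF pos_op_funpow[OF A] f]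
  have "B (exp_op A f) y = (\<Sum>k. B (\<lambda>y. ennreal (1 / fact k) * (A ^^ k) f y) y)"
    unfolding exp_op_def[abs_def] using m by (intro pos_op_suminf[OF B]) measurable
  also have "\<dots> = exp_op A (B f) y"
    using m f by (simp add: exp_op_def pos_op_cmult[OF B] commute_opD[OF commute_op_funpow[OF A AB]])
  finally show "exp_op A (B f) y = B (exp_op A f) y" by simp
qed

lemma commute_op_add:
  assumes B: "pos_op B" and C: "pos_op C" and "commute_op A C" "commute_op B C" and A: "pos_op A"
  shows "commute_op (add_op A B) C"
  unfolding commute_op_def
proof (intro ballI ext)
  fix f :: "real \<Rightarrow> ennreal" and y assume f: "f \<in> borel_measurable borel"
  show "A (C f) y + B (C f) y = C (\<lambda>y. A f y + B f y) y"
    using f by (simp add: pos_op_add[OF C] pos_op_measurable[OF A] pos_op_measurable[OF B]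
        commute_opD[OF assms(3)] commute_opD[OF assms(4)])
qed

lemma commute_op_scale: "pos_op A \<Longrightarrow> commute_op (scale_op c) A"
  unfolding commute_op_def by (auto simp: pos_op_cmult fun_eq_iff)

lemma commute_op_comp:
  assumes B: "pos_op B" and "commute_op A C" "commute_op B C"
  shows "commute_op (\<lambda>f. A (B f)) C"
  unfolding commute_op_def
  by (simp add: commute_opD[OF assms(2)] commute_opD[OF assms(3)] pos_op_measurable[OF B])

lemma funpow_add_op:
  assumes A: "pos_op A" and B: "pos_op B" and AB: "commute_op A B" and f: "f \<in> borel_measurable borel"
  shows "(add_op A B ^^ k) f y = (\<Sum>i\<le>k. of_nat (k choose i) * (A ^^ i) ((B ^^ (k - i)) f) y)"
proof (induction k arbitrary: y)
  case (Suc k)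
  note m = pos_op_measurable[OF A] pos_op_measurable[OF B] pos_op_measurable[OF pos_op_funpow[OF A]]
     pos_op_measurable[OF pos_op_funpow[OF B]]
  let ?P = "\<lambda>i. \<lambda>y. of_nat (k choose i) * (A ^^ i) ((B ^^ (k - i)) f) y"
  have [measurable]: "?P i \<in> borel_measurable borel" for i
    by (intro borel_measurable_times_ennreal borel_measurable_const m f)
  have "(add_op A B ^^ k) f = (\<lambda>y. \<Sum>i\<le>k. ?P i y)" using Suc by auto
  then have "(add_op A B ^^ Suc k) f y = A (\<lambda>y. \<Sum>i\<le>k. ?P i y) y + B (\<lambda>y. \<Sum>i\<le>k. ?P i y) y"
    by simp
  also have "\<dots> = (\<Sum>i\<le>k. A (?P i) y) + (\<Sum>i\<le>k. B (?P i) y)"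
    by (subst pos_op_sum[OF A], simp, simp, subst pos_op_sum[OF B]) simp_all
  also have "(\<Sum>i\<le>k. A (?P i) y) = (\<Sum>i\<le>k. of_nat (k choose i) * (A ^^ Suc i) ((B ^^ (k - i)) f) y)"
    by (simp add: pos_op_cmult[OF A] m f)
  also have "(\<Sum>i\<le>k. B (?P i) y) = (\<Sum>i\<le>k. of_nat (k choose i) * (A ^^ i) ((B ^^ Suc (k - i)) f) y)"
    by (simp add: pos_op_cmult[OF B] m f commute_opD[OF commute_op_funpow[OF A AB]])
  finally show ?case unfolding sum_binomial_Suc[of k "\<lambda>i j. (A ^^ i) ((B ^^ j) f) y"] .
qed simp

lemma exp_op_add:
  assumes A: "pos_op A" and B: "pos_op B" and AB: "commute_op A B" and f: "f \<in> borel_measurable borel"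
  shows "exp_op (add_op A B) f y = exp_op A (exp_op B f) y"
proof -
  note mB = pos_op_measurable[OF pos_op_funpow[OF B] f]
  have "ennreal (1 / fact k) * (add_op A B ^^ k) f y =
     (\<Sum>i\<le>k. ennreal (1 / fact i) * (ennreal (1 / fact (k - i)) * (A ^^ i) ((B ^^ (k - i)) f) y))" for k
    unfolding funpow_add_op[OF A B AB f] sum_distrib_left
  proof (rule sum.cong[OF refl])
    fix i assume "i \<in> {..k}"
    then have "ennreal (1 / fact k) * of_nat (k choose i) = ennreal (1 / fact i) * ennreal (1 / fact (k - i))"
      by (simp add: binomial_fact ennreal_of_nat_eq_real_of_nat flip: ennreal_mult')
    then show "ennreal (1 / fact k) * (of_nat (k choose i) * (A ^^ i) ((B ^^ (k - i)) f) y) =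
      ennreal (1 / fact i) * (ennreal (1 / fact (k - i)) * (A ^^ i) ((B ^^ (k - i)) f) y)"
      by (simp only: mult.assoc[symmetric])
  qed
  then have "exp_op (add_op A B) f y =
     (\<Sum>i. \<Sum>j. ennreal (1 / fact i) * (ennreal (1 / fact j) * (A ^^ i) ((B ^^ j) f) y))"
    unfolding exp_op_def suminf_Cauchy_ennreal[symmetric] by simp
  also have "\<dots> = (\<Sum>i. ennreal (1 / fact i) * (\<Sum>j. ennreal (1 / fact j) * (A ^^ i) ((B ^^ j) f) y))"
    by (simp add: ennreal_suminf_cmult)
  also have "(\<lambda>i. \<Sum>j. ennreal (1 / fact j) * (A ^^ i) ((B ^^ j) f) y) = (\<lambda>i. (A ^^ i) (exp_op B f) y)"
  proof
    fix i
    have "(A ^^ i) (exp_op B f) y = (\<Sum>j. (A ^^ i) (\<lambda>y. ennreal (1 / fact j) * (B ^^ j) f y) y)"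
      unfolding exp_op_def[abs_def] by (intro pos_op_suminf[OF pos_op_funpow[OF A]] borel_measurable_times_ennreal borel_measurable_const mB)
    then show "(\<Sum>j. ennreal (1 / fact j) * (A ^^ i) ((B ^^ j) f) y) = (A ^^ i) (exp_op B f) y"
      by (simp add: pos_op_cmult[OF pos_op_funpow[OF A] mB])
  qed
  finally show ?thesis by (simp add: exp_op_def)
qed

lemma suminf_exp_ennreal:
  assumes "c \<ge> 0"
  shows "(\<Sum>k. ennreal (1 / fact k) * ennreal c ^ k) = ennreal (exp c)"
proof -
  have s: "(\<lambda>k. c ^ k / fact k) sums exp c"
    using exp_converges[of c] by (simp add: divide_inverse mult.commute)
  have "(\<Sum>k. ennreal (1 / fact k) * ennreal c ^ k) = (\<Sum>k. ennreal (c ^ k / fact k))"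
    using assms by (simp add: ennreal_power flip: ennreal_mult')
  also have "\<dots> = ennreal (\<Sum>k. c ^ k / fact k)"
    using assms s by (intro suminf_ennreal_eq) (auto simp: sums_iff)
  finally show ?thesis using s by (simp add: sums_iff)
qed

lemma funpow_scale_op: "(scale_op c ^^ k) f y = c ^ k * f y"
  by (induction k arbitrary: y) (auto simp: mult.assoc)

lemma exp_op_scale: "c \<ge> 0 \<Longrightarrow> exp_op (scale_op (ennreal c)) f y = ennreal (exp c) * f y"
  by (simp add: exp_op_def funpow_scale_op suminf_exp_ennreal mult.assoc[symmetric])

text \<open>The device for handling generators without subtraction: adding a multiple of the
  identity costs only an explicit exponential factor, which is cancelled at the end.\<close>

lemma exp_op_add_scale:
  assumes A: "pos_op A" and c: "c \<ge> 0" and f: "f \<in> borel_measurable borel"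
  shows "exp_op (add_op A (scale_op (ennreal c))) f y = ennreal (exp c) * exp_op A f y"
proof -
  have "exp_op (add_op (scale_op (ennreal c)) A) f y = exp_op (scale_op (ennreal c)) (exp_op A f) y"
    by (intro exp_op_add pos_op_scale A f commute_op_scale)
  then show ?thesis using c by (simp add: exp_op_scale add.commute)
qed

text \<open>The hypothesis speaks of \<open>f\<close> only and not of its iterates. So
  \<open>A\<close> is applied to \<open>f\<close> first and replaced by \<open>B\<close>, then
  \<open>B\<close> is moved to the outside by commutation and the induction hypothesis is used
  beneath it.\<close>

lemma funpow_op_mono:
  assumes A: "pos_op A" and B: "pos_op B" and AB: "commute_op A B" and f: "f \<in> borel_measurable borel"
    and le: "\<And>y. A f y \<le> B f y"
  shows "(A ^^ k) f y \<le> (B ^^ k) f y"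
proof (induction k arbitrary: y)
  case (Suc k)
  note m = pos_op_measurable[OF A] pos_op_measurable[OF B] pos_op_measurable[OF pos_op_funpow[OF A]]
     pos_op_measurable[OF pos_op_funpow[OF B]]
  have "(A ^^ Suc k) f y = (A ^^ k) (A f) y" by (simp add: funpow_swap1)
  also have "\<dots> \<le> (A ^^ k) (B f) y" using le by (intro pos_op_mono[OF pos_op_funpow[OF A]] m f) auto
  also have "\<dots> = B ((A ^^ k) f) y" by (simp add: commute_opD[OF commute_op_funpow[OF A AB] f])
  also have "\<dots> \<le> B ((B ^^ k) f) y" using Suc by (intro pos_op_mono[OF B] m f) auto
  finally show ?case by simp
qed simp

lemma exp_op_le_exp_op:
  assumes "pos_op A" "pos_op B" "commute_op A B" "f \<in> borel_measurable borel" "\<And>y. A f y \<le> B f y"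
  shows "exp_op A f y \<le> exp_op B f y"
  unfolding exp_op_def using funpow_op_mono[OF assms] by (intro suminf_le mult_left_mono) auto

lemma exp_op_mono:
  assumes A: "pos_op A" and "f \<in> borel_measurable borel" "g \<in> borel_measurable borel" "\<And>y. f y \<le> g y"
  shows "exp_op A f y \<le> exp_op A g y"
  unfolding exp_op_def using assms by (intro suminf_le mult_left_mono pos_op_mono[OF pos_op_funpow[OF A]]) auto

lemma exp_op_cmult:
  assumes A: "pos_op A" and "f \<in> borel_measurable borel"
  shows "exp_op A (\<lambda>y. c * f y) y = c * exp_op A f y"
  unfolding exp_op_def using assms
  by (simp add: pos_op_cmult[OF pos_op_funpow[OF A]] mult.left_commute ennreal_suminf_cmult)

text \<open>The induction step of the secant bound, with \<open>a = f y\<close>,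
  \<open>b = A f y\<close>, \<open>c = A (A f) y\<close> and \<open>d = (A ^^ Suc k) f y\<close>.
  The values \<open>c\<close> and \<open>d\<close> may be infinite; an infinite \<open>c\<close>
  with finite \<open>d\<close> forces \<open>k = 0\<close>.\<close>

lemma secant_step:
  fixes a b c d :: ennreal
  assumes b: "b < \<top>" and a: "a < \<top>"
    and 1: "of_nat k * c + b \<le> d + of_nat k * b" and 2: "2 * b \<le> c + a"
  shows "of_nat (Suc k) * b + a \<le> d + of_nat (Suc k) * a"
proof (cases d)
  case top
  then show ?thesis by simp
next
  case (real d')
  obtain a' b' where ab: "a = ennreal a'" "b = ennreal b'" "0 \<le> a'" "0 \<le> b'"
    using a b by (cases a; cases b) auto
  show ?thesis
  proof (cases c)
    case top
    have "k = 0"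
    proof (rule ccontr)
      assume "k \<noteq> 0"
      then have "of_nat k * c + b = \<top>" by (simp add: top ennreal_mult_top)
      moreover have "d + of_nat k * b < \<top>"
        using b real by (simp add: ennreal_mult_less_top of_nat_less_top)
      ultimately show False using order.strict_trans1[OF 1] by (metis less_irrefl)
    qed
    then show ?thesis using 1 by (simp add: add_mono)
  next
    case c: (real c')
    have 1: "real k * c' + b' \<le> d' + real k * b'"
      using 1 real c ab by (simp add: ennreal_of_nat_eq_real_of_nat ennreal_le_iff flip: ennreal_mult' ennreal_plus)
    have "2 * b' \<le> c' + a'"
      using 2 c ab by (simp add: ennreal_le_iff flip: ennreal_mult' ennreal_plus ennreal_numeral)
    then have "real k * (2 * b') \<le> real k * (c' + a')" by (intro mult_left_mono) auto
    with 1 have "real (Suc k) * b' + a' \<le> d' + real (Suc k) * a'" by (simp add: algebra_simps)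
    then show ?thesis using real ab
      by (simp add: ennreal_of_nat_eq_real_of_nat ennreal_le_iff flip: ennreal_mult' ennreal_plus)
  qed
qed

text \<open>Poissonisation increases \<open>A f\<close> if \<open>k \<mapsto> A\<^sup>k f\<close> is convex, since then it lies above its secant through 0 and 1.\<close>

lemma op_le_exp_op:
  assumes A: "pos_op A" and f: "f \<in> borel_measurable borel"
    and fin: "\<And>y. f y < \<top>" "\<And>y. A f y < \<top>"
    and convex: "\<And>y. 2 * A f y \<le> A (A f) y + f y"
  shows "ennreal (exp 1) * A f y \<le> exp_op A f y"
proof -
  note m = f pos_op_measurable[OF A f] pos_op_measurable[OF pos_op_funpow[OF A] f]
  have secant: "of_nat k * A f y + f y \<le> (A ^^ k) f y + of_nat k * f y" for k y
  proof (induction k arbitrary: y)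
    case (Suc k)
    have "A (\<lambda>y. of_nat k * A f y + f y) y \<le> A (\<lambda>y. (A ^^ k) f y + of_nat k * f y) y"
      using Suc by (intro pos_op_mono[OF A] borel_measurable_times_ennreal borel_measurable_add borel_measurable_const m) auto
    then have step: "of_nat k * A (A f) y + A f y \<le> (A ^^ Suc k) f y + of_nat k * A f y"
      by (simp add: pos_op_add[OF A] pos_op_cmult[OF A] m borel_measurable_times_ennreal)
    show ?case
    proof (rule secant_step)
      show "A f y < \<top>" by (rule fin(2))
      show "f y < \<top>" by (rule fin(1))
      show "of_nat k * A (A f) y + A f y \<le> (A ^^ Suc k) f y + of_nat k * A f y" by (rule step)
      show "2 * A f y \<le> A (A f) y + f y" by (rule convex)
    qed
  qed simp
  have e1: "(\<Sum>k. ennreal (1 / fact k)) = ennreal (exp 1)"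
    using suminf_exp_ennreal[OF zero_le_one] by (simp only: ennreal_1 power_one mult_1_right)
  \<comment> \<open>The Poisson law with parameter 1 has mean 1, by an index shift in the
    exponential series. Hence averaging the secant over \<open>k\<close> returns its value at
    \<open>k = 1\<close>.\<close>
  have e2: "(\<Sum>k. ennreal (1 / fact k) * of_nat k) = ennreal (exp 1)"
  proof -
    have "(\<lambda>k. 1 / fact k :: real) sums exp 1" using exp_converges[of "1::real"] by (simp add: divide_inverse)
    then have "(\<lambda>k. 1 / fact (Suc k) * real (Suc k)) sums exp 1" by (simp add: field_simps del: of_nat_Suc)
    then have s: "(\<lambda>k. 1 / fact k * real k) sums exp 1" by (subst (asm) sums_Suc_iff) simp
    have "(\<Sum>k. ennreal (1 / fact k) * of_nat k) = (\<Sum>k. ennreal (1 / fact k * real k))"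
      by (simp add: ennreal_of_nat_eq_real_of_nat flip: ennreal_mult')
    also have "\<dots> = ennreal (\<Sum>k. 1 / fact k * real k)"
      using s by (intro suminf_ennreal_eq) (auto simp: sums_iff)
    finally show ?thesis using s by (simp add: sums_iff)
  qed
  \<comment> \<open>The secant bound is summed against the weights \<open>1 / fact k\<close>; the
    term in \<open>f y\<close> is carried on both sides and cancelled at the end, which is
    legitimate because \<open>f y\<close> is finite.\<close>
  have "ennreal (exp 1) * A f y + ennreal (exp 1) * f y =
      (\<Sum>k. ennreal (1 / fact k) * of_nat k * A f y) + (\<Sum>k. ennreal (1 / fact k) * f y)"
    by (simp add: e1 e2)
  also have "\<dots> = (\<Sum>k. ennreal (1 / fact k) * (of_nat k * A f y + f y))"
    by (subst suminf_add) (auto simp: distrib_left mult.assoc)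
  also have "\<dots> \<le> (\<Sum>k. ennreal (1 / fact k) * ((A ^^ k) f y + of_nat k * f y))"
    by (intro suminf_le mult_left_mono secant) auto
  also have "\<dots> = (\<Sum>k. ennreal (1 / fact k) * (A ^^ k) f y) + (\<Sum>k. ennreal (1 / fact k) * of_nat k * f y)"
    by (subst suminf_add) (auto simp: distrib_left mult.assoc)
  also have "\<dots> = exp_op A f y + ennreal (exp 1) * f y"
    by (simp add: e2 exp_op_def)
  finally have "ennreal (exp 1) * f y + ennreal (exp 1) * A f y \<le> ennreal (exp 1) * f y + exp_op A f y"
    by (simp only: add.commute)
  moreover have "ennreal (exp 1) * f y \<noteq> \<infinity>"
    using fin(1)[of y] by (simp add: ennreal_mult_eq_top_iff)
  ultimately show ?thesis unfolding ennreal_add_left_cancel_le by simp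
qed


section \<open>Averaging over independent shifts\<close>

definition shift_op :: "real measure \<Rightarrow> op" where
  "shift_op \<mu> f y = (\<integral>\<^sup>+x. f (y + x) \<partial>\<mu>)"

abbreviation law :: "real measure \<Rightarrow> bool" where
  "law \<mu> \<equiv> prob_space \<mu> \<and> sets \<mu> = sets borel"

lemma measurable_shift:
  assumes "law \<mu>" "f \<in> borel_measurable borel"
  shows "(\<lambda>x. f (y + x)) \<in> borel_measurable \<mu>"
proof -
  have [measurable]: "f \<in> borel_measurable borel" by fact
  have "(\<lambda>x. f (y + x)) \<in> borel_measurable borel" by measurable
  then show ?thesis by (subst measurable_cong_sets[of \<mu> borel borel borel]) (use assms in auto)
qed

lemma measurable_shift2:
  assumes \<mu>: "law \<mu>" and f: "f \<in> borel_measurable borel"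
  shows "(\<lambda>(y, x). f (y + x)) \<in> borel_measurable (borel \<Otimes>\<^sub>M \<mu>)"
proof -
  have [measurable]: "f \<in> borel_measurable borel" by fact
  have "(\<lambda>(y, x). f (y + x)) \<in> borel_measurable (borel \<Otimes>\<^sub>M borel)" by measurable
  then show ?thesis
    by (subst measurable_cong_sets[OF sets_pair_measure_cong[of borel borel \<mu> borel], of borel borel]) (use \<mu> in auto)
qed

lemma pos_op_shift:
  assumes \<mu>: "law \<mu>"
  shows "pos_op (shift_op \<mu>)"
  unfolding pos_op_def
proof (intro conjI ballI allI impI)
  interpret prob_space \<mu> using \<mu> by simp
  fix f g :: "real \<Rightarrow> ennreal" and c y assume f: "f \<in> borel_measurable borel"
  show "shift_op \<mu> f \<in> borel_measurable borel"
    unfolding shift_op_def[abs_def]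
    using borel_measurable_nn_integral[OF measurable_shift2[OF \<mu> f]] by simp
  show "shift_op \<mu> (\<lambda>y. c * f y) y = c * shift_op \<mu> f y"
    unfolding shift_op_def by (intro nn_integral_cmult measurable_shift \<mu> f)
  assume g: "g \<in> borel_measurable borel"
  show "shift_op \<mu> (\<lambda>y. f y + g y) y = shift_op \<mu> f y + shift_op \<mu> g y"
    unfolding shift_op_def by (intro nn_integral_add measurable_shift \<mu> f g)
  assume "\<forall>y. f y \<le> g y"
  then show "shift_op \<mu> f y \<le> shift_op \<mu> g y"
    unfolding shift_op_def by (intro nn_integral_mono) auto
next
  fix f :: "nat \<Rightarrow> real \<Rightarrow> ennreal" and y assume "\<forall>i. f i \<in> borel_measurable borel"
  then show "shift_op \<mu> (\<lambda>y. \<Sum>i. f i y) y = (\<Sum>i. shift_op \<mu> (f i) y)"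
    unfolding shift_op_def by (intro nn_integral_suminf measurable_shift \<mu>) auto
qed

lemma commute_op_shift:
  assumes \<mu>: "law \<mu>" and \<nu>: "law \<nu>"
  shows "commute_op (shift_op \<mu>) (shift_op \<nu>)"
  unfolding commute_op_def
proof (intro ballI ext)
  interpret pair_sigma_finite \<mu> \<nu>
    using \<mu> \<nu> by (simp add: pair_sigma_finite_def prob_space_imp_sigma_finite)
  fix f :: "real \<Rightarrow> ennreal" and y assume [measurable]: "f \<in> borel_measurable borel"
  have "(\<lambda>(x, z). f (y + x + z)) \<in> borel_measurable (borel \<Otimes>\<^sub>M borel)" by measurable
  then have m: "(\<lambda>(x, z). f (y + x + z)) \<in> borel_measurable (\<mu> \<Otimes>\<^sub>M \<nu>)"
    by (subst measurable_cong_sets[OF sets_pair_measure_cong[of \<mu> borel \<nu> borel], of borel borel]) (use \<mu> \<nu> in auto)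
  have "shift_op \<nu> (shift_op \<mu> f) y = (\<integral>\<^sup>+z. \<integral>\<^sup>+x. f (y + x + z) \<partial>\<mu> \<partial>\<nu>)"
    by (simp add: shift_op_def ac_simps)
  also have "\<dots> = (\<integral>\<^sup>+x. \<integral>\<^sup>+z. f (y + x + z) \<partial>\<nu> \<partial>\<mu>)"
    using Fubini[OF m] by simp
  finally show "shift_op \<mu> (shift_op \<nu> f) y = shift_op \<nu> (shift_op \<mu> f) y"
    by (simp add: shift_op_def)
qed

text \<open>The last factor is innermost, which matches integrating out summand \<open>Suc n\<close>
  while the sum of the first \<open>n\<close> is held fixed.\<close>

primrec shift_ops :: "(nat \<Rightarrow> real measure) \<Rightarrow> nat \<Rightarrow> op" where
  "shift_ops \<mu> 0 f = f"
| "shift_ops \<mu> (Suc n) f = shift_ops \<mu> n (shift_op (\<mu> (Suc n)) f)"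

lemma pos_op_shift_ops: "(\<And>j. j \<ge> 1 \<Longrightarrow> law (\<mu> j)) \<Longrightarrow> pos_op (shift_ops \<mu> n)"
proof (induction n)
  case 0
  then show ?case by (simp add: pos_op_def)
next
  case (Suc n)
  then show ?case using pos_op_comp[of "shift_ops \<mu> n" "shift_op (\<mu> (Suc n))"] pos_op_shift[of "\<mu> (Suc n)"] by simp
qed

lemma commute_op_shift_ops:
  assumes "\<And>j. j \<ge> 1 \<Longrightarrow> law (\<mu> j)" "\<And>j. j \<ge> 1 \<Longrightarrow> commute_op (shift_op (\<mu> j)) A"
  shows "commute_op (shift_ops \<mu> n) A"
proof (induction n)
  case 0
  then show ?case by (simp add: commute_op_def)
next
  case (Suc n)
  show ?case using commute_op_comp[OF pos_op_shift Suc assms(2)] assms(1) by simp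
qed

definition sum_op :: "(nat \<Rightarrow> real measure) \<Rightarrow> nat \<Rightarrow> op" where
  "sum_op \<mu> n f y = (\<Sum>j=1..n. shift_op (\<mu> j) f y)"

lemma sum_op_Suc: "sum_op \<mu> (Suc n) = add_op (shift_op (\<mu> (Suc n))) (sum_op \<mu> n)"
  by (simp add: sum_op_def fun_eq_iff add.commute)

lemma pos_op_sum_op: "(\<And>j. j \<ge> 1 \<Longrightarrow> law (\<mu> j)) \<Longrightarrow> pos_op (sum_op \<mu> n)"
proof (induction n)
  case 0
  then show ?case using pos_op_scale[of 0] by (simp add: sum_op_def[abs_def])
next
  case (Suc n)
  then show ?case unfolding sum_op_Suc by (intro pos_op_add_op pos_op_shift) auto
qed

lemma commute_op_sum_op:
  assumes \<mu>: "\<And>j. j \<ge> 1 \<Longrightarrow> law (\<mu> j)" and A: "pos_op A" "\<And>j. j \<ge> 1 \<Longrightarrow> commute_op (shift_op (\<mu> j)) A"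
  shows "commute_op (sum_op \<mu> n) A"
proof (induction n)
  case 0
  have "A (\<lambda>y. 0) = (\<lambda>y. 0)" using pos_op_zero[OF A(1)] by auto
  then show ?case by (simp add: commute_op_def sum_op_def[abs_def])
next
  case (Suc n)
  show ?case unfolding sum_op_Suc
    using \<mu> A Suc by (intro commute_op_add pos_op_sum_op pos_op_shift) auto
qed

text \<open>The bound for the new operator is used while it acts on \<open>f\<close> itself. Its
  exponential is then moved outside the earlier operators by commutation, the induction hypothesis
  is used beneath it, and the exponentials multiply.\<close>

lemma shift_ops_le_exp_op:
  assumes \<mu>: "\<And>j. j \<ge> 1 \<Longrightarrow> law (\<mu> j)" and f: "f \<in> borel_measurable borel"
    and le: "\<And>j y. j \<ge> 1 \<Longrightarrow> j \<le> n \<Longrightarrow> ennreal (exp 1) * shift_op (\<mu> j) f y \<le> exp_op (shift_op (\<mu> j)) f y"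
  shows "ennreal (exp (real n)) * shift_ops \<mu> n f y \<le> exp_op (sum_op \<mu> n) f y"
  using le
proof (induction n arbitrary: y)
  case 0
  have "exp_op (scale_op (ennreal 0)) f y = f y" by (subst exp_op_scale) auto
  then show ?case by (simp add: sum_op_def[abs_def])
next
  case (Suc n)
  let ?T = "shift_op (\<mu> (Suc n))" and ?P = "shift_ops \<mu> n"
  have T: "pos_op ?T" and P: "pos_op ?P" using \<mu> by (auto intro: pos_op_shift pos_op_shift_ops)
  have S: "pos_op (sum_op \<mu> n)" using \<mu> by (intro pos_op_sum_op)
  note m = f pos_op_measurable[OF T] pos_op_measurable[OF P] pos_op_measurable[OF S] measurable_exp_op[OF T] measurable_exp_op[OF S]
    borel_measurable_times_ennreal borel_measurable_const
  have e: "ennreal (exp (real (Suc n))) = ennreal (exp (real n)) * ennreal (exp 1)"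
    by (simp add: exp_add mult.commute flip: ennreal_mult')
  have cT: "commute_op ?T ?P"
    using \<mu> by (intro commute_op_sym[OF commute_op_shift_ops] commute_op_shift) auto
  have cS: "commute_op ?T (sum_op \<mu> n)"
    using \<mu> by (intro commute_op_sym[OF commute_op_sum_op] T commute_op_shift) auto
  have "ennreal (exp (real (Suc n))) * shift_ops \<mu> (Suc n) f y = ennreal (exp (real n)) * ?P (\<lambda>y. ennreal (exp 1) * ?T f y) y"
    by (simp only: e mult.assoc shift_ops.simps pos_op_cmult[OF P m(2)[OF f]])
  also have "\<dots> \<le> ennreal (exp (real n)) * ?P (exp_op ?T f) y"
    using Suc.prems by (intro mult_left_mono pos_op_mono[OF P] m) auto
  also have "\<dots> = ennreal (exp (real n)) * exp_op ?T (?P f) y"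
    by (simp add: commute_opD[OF commute_op_exp[OF T P cT] f])
  also have "\<dots> = exp_op ?T (\<lambda>y. ennreal (exp (real n)) * ?P f y) y"
    by (rule exp_op_cmult[OF T, symmetric]) (intro m)
  also have "\<dots> \<le> exp_op ?T (exp_op (sum_op \<mu> n) f) y"
    using Suc by (intro exp_op_mono[OF T] m) auto
  also have "\<dots> = exp_op (sum_op \<mu> (Suc n)) f y"
    unfolding sum_op_Suc by (rule exp_op_add[OF T S cS f, symmetric])
  finally show ?case .
qed

lemma (in prob_space) nn_integral_indep_add:
  fixes X Y :: "'a \<Rightarrow> real"
  assumes XY: "indep_var borel X borel Y" and f: "f \<in> borel_measurable borel"
  shows "(\<integral>\<^sup>+\<omega>. f (X \<omega> + Y \<omega>) \<partial>M) = (\<integral>\<^sup>+\<omega>. shift_op (distr M borel X) f (Y \<omega>) \<partial>M)"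
proof -
  have [measurable]: "f \<in> borel_measurable borel" by fact
  have X[measurable]: "X \<in> borel_measurable M" and Y[measurable]: "Y \<in> borel_measurable M"
    using XY by (auto dest: indep_var_rv1 indep_var_rv2)
  interpret X: prob_space "distr M borel X" by (rule prob_space_distr) simp
  interpret Y: prob_space "distr M borel Y" by (rule prob_space_distr) simp
  interpret pair_sigma_finite "distr M borel X" "distr M borel Y" ..
  have law: "law (distr M borel X)" using X.prob_space_axioms by simp
  have "(\<lambda>z. f (fst z + snd z)) \<in> borel_measurable (borel \<Otimes>\<^sub>M borel)" by measurable
  then have m: "(\<lambda>z. f (fst z + snd z)) \<in> borel_measurable (distr M borel X \<Otimes>\<^sub>M distr M borel Y)"
    by (subst measurable_cong_sets[OF sets_pair_measure_cong[of "distr M borel X" borel "distr M borel Y" borel], of borel borel]) auto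
  have "(\<integral>\<^sup>+\<omega>. f (X \<omega> + Y \<omega>) \<partial>M) = (\<integral>\<^sup>+z. f (fst z + snd z) \<partial>distr M (borel \<Otimes>\<^sub>M borel) (\<lambda>\<omega>. (X \<omega>, Y \<omega>)))"
    by (subst nn_integral_distr) auto
  also have "\<dots> = (\<integral>\<^sup>+z. f (fst z + snd z) \<partial>(distr M borel X \<Otimes>\<^sub>M distr M borel Y))"
    using XY by (simp add: indep_var_distribution_eq)
  also have "\<dots> = (\<integral>\<^sup>+y. \<integral>\<^sup>+x. f (x + y) \<partial>distr M borel X \<partial>distr M borel Y)"
    by (subst nn_integral_snd[symmetric]) (auto intro: m)
  also have "\<dots> = (\<integral>\<^sup>+\<omega>. shift_op (distr M borel X) f (Y \<omega>) \<partial>M)"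
    using pos_op_measurable[OF pos_op_shift[OF law] f]
    by (subst nn_integral_distr[symmetric, of Y]) (auto simp: shift_op_def[abs_def] add.commute)
  finally show ?thesis .
qed

text \<open>The map \<open>e\<close> permits renumbering: summands are counted from 1 here, whereas
  the central limit theorem counts them from 0.\<close>

lemma (in prob_space) nn_integral_indep_sum:
  fixes X :: "'i \<Rightarrow> 'a \<Rightarrow> real" and e :: "nat \<Rightarrow> 'i"
  assumes X: "indep_vars (\<lambda>_. borel) X (e ` {1..})" and e: "inj_on e {1..}" and f: "f \<in> borel_measurable borel"
  shows "(\<integral>\<^sup>+\<omega>. f (\<Sum>j=1..n. X (e j) \<omega>) \<partial>M) = shift_ops (\<lambda>j. distr M borel (X (e j))) n f 0"
  using f
proof (induction n arbitrary: f)
  case 0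
  then show ?case by (simp add: emeasure_space_1)
next
  case (Suc n)
  have rv: "X (e j) \<in> borel_measurable M" if "j \<ge> 1" for j
    using X that by (auto simp: indep_vars_def)
  have inj: "inj_on e {1..n}" using e by (rule inj_on_subset) auto
  have "indep_vars (\<lambda>_. borel) X (insert (e (Suc n)) (e ` {1..n}))"
    by (rule indep_vars_subset[OF X]) auto
  moreover have "e (Suc n) \<notin> e ` {1..n}"
  proof
    assume "e (Suc n) \<in> e ` {1..n}"
    then obtain j where j: "j \<in> {1..n}" "e (Suc n) = e j" by blast
    then have "Suc n = j" using inj_onD[OF e j(2)] by auto
    with j show False by simp
  qed
  ultimately have "indep_var borel (X (e (Suc n))) borel (\<lambda>\<omega>. \<Sum>i\<in>e ` {1..n}. X i \<omega>)"
    by (intro indep_vars_sum) auto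
  then have "indep_var borel (X (e (Suc n))) borel (\<lambda>\<omega>. \<Sum>j=1..n. X (e j) \<omega>)"
    using inj by (simp add: sum.reindex)
  from nn_integral_indep_add[OF this Suc.prems]
  have "(\<integral>\<^sup>+\<omega>. f (\<Sum>j=1..Suc n. X (e j) \<omega>) \<partial>M) = (\<integral>\<^sup>+\<omega>. shift_op (distr M borel (X (e (Suc n)))) f (\<Sum>j=1..n. X (e j) \<omega>) \<partial>M)"
    by (simp add: add.commute)
  also have "\<dots> = shift_ops (\<lambda>j. distr M borel (X (e j))) n (shift_op (distr M borel (X (e (Suc n)))) f) 0"
    by (intro Suc.IH pos_op_measurable[OF pos_op_shift]) (use rv Suc.prems in \<open>auto intro: prob_space_distr\<close>)
  finally show ?case by simp
qed


section \<open>Symmetric laws acting on powers\<close>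

definition sym_law :: "real measure \<Rightarrow> bool" where
  "sym_law \<mu> \<longleftrightarrow> law \<mu> \<and> (\<forall>g\<in>borel_measurable borel. (\<integral>\<^sup>+x. g (- x) \<partial>\<mu>) = (\<integral>\<^sup>+x. g x \<partial>\<mu>))"

abbreviation pw :: "real \<Rightarrow> real \<Rightarrow> ennreal" where
  "pw p x \<equiv> ennreal (\<bar>x\<bar> powr p)"

lemma measurable_pw: "pw p \<in> borel_measurable borel"
  by measurable

lemma measurable_law_borel:
  fixes g :: "real \<Rightarrow> 'b::topological_space"
  shows "law \<mu> \<Longrightarrow> g \<in> borel_measurable borel \<Longrightarrow> g \<in> borel_measurable \<mu>"
  using measurable_cong_sets[of \<mu> borel borel borel] by auto

lemma shift_op_sym:
  assumes \<mu>: "sym_law \<mu>" and f: "f \<in> borel_measurable borel"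
  shows "2 * shift_op \<mu> f y = (\<integral>\<^sup>+x. f (y + x) + f (y - x) \<partial>\<mu>)"
proof -
  have [measurable]: "f \<in> borel_measurable borel" by fact
  have law: "law \<mu>" using \<mu> by (simp add: sym_law_def)
  have m: "(\<lambda>x. f (y + x)) \<in> borel_measurable borel" by measurable
  have m': "(\<lambda>x. f (y - x)) \<in> borel_measurable borel" by measurable
  have "(\<integral>\<^sup>+x. f (y + - x) \<partial>\<mu>) = (\<integral>\<^sup>+x. f (y + x) \<partial>\<mu>)"
    using bspec[OF conjunct2[OF \<mu>[unfolded sym_law_def]] m] .
  then have "(\<integral>\<^sup>+x. f (y + x) \<partial>\<mu>) + (\<integral>\<^sup>+x. f (y - x) \<partial>\<mu>) = 2 * shift_op \<mu> f y"
    by (simp add: shift_op_def mult_2)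
  then show ?thesis
    by (subst nn_integral_add) (simp_all add: measurable_law_borel[OF law] m m')
qed

lemma pw_sympow: "pw p (y + x) + pw p (y - x) = 2 * ennreal (sympow p y x)"
proof -
  have "pw p (y + x) + pw p (y - x) = ennreal (2 * sympow p y x)"
    by (simp add: sympow_def flip: ennreal_plus)
  then show ?thesis by (subst (asm) ennreal_mult) (auto simp: sympow_def)
qed

lemma measurable_sympow: "(\<lambda>x. ennreal (sympow p y x)) \<in> borel_measurable borel"
  unfolding sympow_def by measurable

lemma shift_op_pw:
  assumes \<mu>: "sym_law \<mu>"
  shows "shift_op \<mu> (pw p) y = (\<integral>\<^sup>+x. ennreal (sympow p y x) \<partial>\<mu>)"
proof -
  have law: "law \<mu>" using \<mu> by (simp add: sym_law_def)
  have "2 * shift_op \<mu> (pw p) y = 2 * (\<integral>\<^sup>+x. ennreal (sympow p y x) \<partial>\<mu>)"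
    unfolding shift_op_sym[OF \<mu> measurable_pw] pw_sympow
    by (intro nn_integral_cmult measurable_law_borel[OF law] measurable_sympow)
  then show ?thesis by (simp add: ennreal_mult_cancel_left)
qed

lemma shift_op_ge:
  assumes \<mu>: "sym_law \<mu>" and p: "p \<ge> 1"
  shows "pw p y \<le> shift_op \<mu> (pw p) y"
proof -
  interpret prob_space \<mu> using \<mu> by (simp add: sym_law_def)
  have "pw p y = (\<integral>\<^sup>+x. pw p y \<partial>\<mu>)" by (simp add: emeasure_space_1)
  also have "\<dots> \<le> shift_op \<mu> (pw p) y"
    unfolding shift_op_pw[OF \<mu>] using p by (intro nn_integral_mono ennreal_leI sympow_ge)
  finally show ?thesis .
qed

text \<open>From \<open>|y + x| \<le> 2 * max |y| |x|\<close>. It turns finiteness of the moment at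
  0 into finiteness at every \<open>y\<close>, with growth of order \<open>|y|^p\<close>.\<close>

lemma shift_op_pw_bound:
  assumes \<mu>: "law \<mu>" and p: "p \<ge> 1"
  shows "shift_op \<mu> (pw p) y \<le> ennreal (2 powr p) * (pw p y + shift_op \<mu> (pw p) 0)"
proof -
  interpret prob_space \<mu> using \<mu> by simp
  have "\<bar>y + x\<bar> powr p \<le> 2 powr p * (\<bar>y\<bar> powr p + \<bar>x\<bar> powr p)" for x
  proof -
    have "\<bar>y + x\<bar> powr p \<le> (2 * max \<bar>y\<bar> \<bar>x\<bar>) powr p" using p by (intro powr_mono2) auto
    also have "\<dots> = 2 powr p * max \<bar>y\<bar> \<bar>x\<bar> powr p" by (simp add: powr_mult)
    also have "\<dots> \<le> 2 powr p * (\<bar>y\<bar> powr p + \<bar>x\<bar> powr p)"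
      by (intro mult_left_mono) (auto simp: max_def)
    finally show ?thesis .
  qed
  then have "shift_op \<mu> (pw p) y \<le> (\<integral>\<^sup>+x. ennreal (2 powr p) * (pw p y + pw p x) \<partial>\<mu>)"
    unfolding shift_op_def
    by (intro nn_integral_mono) (simp add: ennreal_leI flip: ennreal_plus ennreal_mult')
  also have "\<dots> = ennreal (2 powr p) * (pw p y + shift_op \<mu> (pw p) 0)"
    by (simp add: nn_integral_cmult nn_integral_add measurable_law_borel[OF \<mu>] emeasure_space_1 shift_op_def)
  finally show ?thesis .
qed

text \<open>\<open>sympow_four_point\<close> integrated over two independent copies of law
  \<open>\<mu>\<close>: formally \<open>(T - 1)^2 f \<ge> 0\<close>, which is the convexity asked
  for by \<open>op_le_exp_op\<close>.\<close>

lemma shift_op_convex: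
  assumes \<mu>: "sym_law \<mu>" and p: "p \<ge> 3"
  shows "2 * shift_op \<mu> (pw p) y \<le> shift_op \<mu> (shift_op \<mu> (pw p)) y + pw p y"
proof -
  have law: "law \<mu>" using \<mu> by (simp add: sym_law_def)
  interpret prob_space \<mu> using law by simp
  let ?T = "shift_op \<mu> (pw p)"
  have T: "?T \<in> borel_measurable borel" by (rule pos_op_measurable[OF pos_op_shift[OF law] measurable_pw])
  note m = measurable_law_borel[OF law] measurable_sympow T borel_measurable_add borel_measurable_const
  have [measurable]: "?T \<in> borel_measurable borel" by (rule T)
  have mT: "(\<lambda>t. ?T (y + t) + ?T (y - t)) \<in> borel_measurable borel" by measurable
  have "?T y + ?T y = (\<integral>\<^sup>+t. \<integral>\<^sup>+x. ennreal (sympow p y x) + ennreal (sympow p y t) \<partial>\<mu> \<partial>\<mu>)"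
    by (simp add: nn_integral_add m emeasure_space_1 shift_op_pw[OF \<mu>])
  also have "\<dots> \<le> (\<integral>\<^sup>+t. \<integral>\<^sup>+x. pw p y + (ennreal (sympow p (y + t) x) + ennreal (sympow p (y - t) x)) / 2 \<partial>\<mu> \<partial>\<mu>)"
  proof (intro nn_integral_mono)
    fix x t
    have nn: "sympow p u v \<ge> 0" for u v by (simp add: sympow_def)
    have half: "(ennreal a + ennreal b) / 2 = ennreal ((a + b) / 2)" if "0 \<le> a" "0 \<le> b" for a b
      using that by (simp add: divide_ennreal flip: ennreal_plus ennreal_numeral)
    have "ennreal (sympow p y x) + ennreal (sympow p y t) = ennreal (sympow p y t + sympow p y x)"
      using nn by (simp add: add.commute)
    also have "\<dots> \<le> ennreal (\<bar>y\<bar> powr p + (sympow p (y + t) x + sympow p (y - t) x) / 2)"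
      by (rule ennreal_leI[OF sympow_four_point[OF p]])
    also have "\<dots> = pw p y + (ennreal (sympow p (y + t) x) + ennreal (sympow p (y - t) x)) / 2"
      unfolding half[OF nn nn] using nn by (intro ennreal_plus) auto
    finally show "ennreal (sympow p y x) + ennreal (sympow p y t) \<le>
        pw p y + (ennreal (sympow p (y + t) x) + ennreal (sympow p (y - t) x)) / 2" .
  qed
  also have "\<dots> = (pw p y + (\<integral>\<^sup>+t. ?T (y + t) + ?T (y - t) \<partial>\<mu>) / 2)"
  proof -
    have [measurable]: "(\<lambda>x. ennreal (sympow p u x)) \<in> borel_measurable \<mu>" for u by (intro m)
    have [measurable]: "(\<lambda>t. ?T (y + t) + ?T (y - t)) \<in> borel_measurable \<mu>" by (intro m mT)
    have inner: "(\<integral>\<^sup>+x. pw p y + (ennreal (sympow p (y + t) x) + ennreal (sympow p (y - t) x)) / 2 \<partial>\<mu>) =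
        pw p y + (?T (y + t) + ?T (y - t)) / 2" for t
      by (simp add: nn_integral_add nn_integral_divide emeasure_space_1 shift_op_pw[OF \<mu>])
    show ?thesis unfolding inner
      by (subst nn_integral_add) (simp_all add: nn_integral_divide emeasure_space_1)
  qed
  also have "\<dots> = pw p y + shift_op \<mu> ?T y"
  proof -
    have "2 * z / 2 = z" for z :: ennreal
      using ennreal_mult_divide_eq[of 2 z] by (simp add: mult.commute)
    then show ?thesis unfolding shift_op_sym[OF \<mu> T, symmetric] by simp
  qed
  finally show ?thesis by (simp add: mult_2 add.commute)
qed

section \<open>Comparison with Gaussian summands\<close>

text \<open>An image measure rather than a density, so that \<open>s = 0\<close> is included as the
  point mass at 0.\<close>

definition gauss :: "real \<Rightarrow> real measure" where
  "gauss s = distr std_normal_distribution borel (\<lambda>z. s * z)"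

lemma law_gauss: "law (gauss s)"
proof -
  interpret prob_space std_normal_distribution by (rule prob_space_normal_density) simp
  show ?thesis unfolding gauss_def by (auto intro!: prob_space_distr)
qed

lemma nn_integral_gauss:
  assumes "f \<in> borel_measurable borel"
  shows "(\<integral>\<^sup>+x. f x \<partial>gauss s) = (\<integral>\<^sup>+z. f (s * z) \<partial>std_normal_distribution)"
  unfolding gauss_def using assms by (subst nn_integral_distr) auto

lemma distr_std_normal_scale:
  assumes "s \<noteq> 0"
  shows "gauss s = density lborel (normal_density 0 \<bar>s\<bar>)"
proof -
  interpret prob_space std_normal_distribution by (rule prob_space_normal_density) simp
  have "distributed std_normal_distribution lborel (\<lambda>x. x) std_normal_density"
    by (auto simp: distributed_def distr_id2 measurable_ident_sets)
  from normal_density_affine[OF this, of s 0] assms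
  have "distributed std_normal_distribution lborel (\<lambda>x. s * x) (normal_density 0 \<bar>s\<bar>)" by simp
  then show ?thesis unfolding gauss_def distributed_def by (auto cong: distr_cong)
qed

lemma sym_law_gauss: "sym_law (gauss s)"
proof -
  have "gauss (- s) = gauss s"
    by (cases "s = 0") (simp_all add: distr_std_normal_scale)
  then have "(\<integral>\<^sup>+x. g (- x) \<partial>gauss s) = (\<integral>\<^sup>+x. g x \<partial>gauss s)" if g: "g \<in> borel_measurable borel" for g
  proof -
    assume eq: "gauss (- s) = gauss s"
    have [measurable]: "g \<in> borel_measurable borel" by fact
    have "(\<integral>\<^sup>+x. g (- x) \<partial>gauss s) = (\<integral>\<^sup>+x. g x \<partial>gauss (- s))"
      by (subst (1 2) nn_integral_gauss) auto
    then show ?thesis by (simp add: eq)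
  qed
  then show ?thesis using law_gauss by (simp add: sym_law_def)
qed

lemma shift_op_gauss_0:
  assumes "f \<in> borel_measurable borel"
  shows "shift_op (gauss 0) f = f"
proof
  fix y
  have [measurable]: "f \<in> borel_measurable borel" by fact
  interpret prob_space std_normal_distribution by (rule prob_space_normal_density) simp
  have "emeasure std_normal_distribution UNIV = 1" using emeasure_space_1 by simp
  then show "shift_op (gauss 0) f y = f y"
    unfolding shift_op_def by (subst nn_integral_gauss) auto
qed

lemma shift_op_gauss_pos:
  assumes "s > 0" "f \<in> borel_measurable borel"
  shows "shift_op (gauss s) f y = (\<integral>\<^sup>+x. ennreal (normal_density 0 s x) * f (y + x) \<partial>lborel)"
proof -
  have [measurable]: "f \<in> borel_measurable borel" by fact
  show ?thesis
    using assms(1) unfolding shift_op_def by (subst distr_std_normal_scale) (auto simp: nn_integral_density)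
qed

lemma shift_op_gauss_gauss:
  assumes s: "s \<ge> 0" and t: "t \<ge> 0" and f: "f \<in> borel_measurable borel"
  shows "shift_op (gauss s) (shift_op (gauss t) f) y = shift_op (gauss (sqrt (s\<^sup>2 + t\<^sup>2))) f y"
proof -
  have T: "shift_op (gauss t) f \<in> borel_measurable borel"
    by (rule pos_op_measurable[OF pos_op_shift[OF law_gauss] f])
  have [measurable]: "f \<in> borel_measurable borel" by fact
  show ?thesis
  proof (cases "s = 0 \<or> t = 0")
    case True
    then show ?thesis using s t by (auto simp: shift_op_gauss_0 f T)
  next
    case False
    with s t have s: "s > 0" and t: "t > 0" by auto
    have st: "sqrt (s\<^sup>2 + t\<^sup>2) > 0" using s by (simp add: add_pos_nonneg)
    have "shift_op (gauss t) f (y + x) = (\<integral>\<^sup>+w. ennreal (normal_density 0 t (w - x)) * f (y + w) \<partial>lborel)" for x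
    proof -
      have "(\<integral>\<^sup>+w. ennreal (normal_density 0 t (w - x)) * f (y + w) \<partial>lborel) =
         ennreal \<bar>1\<bar> * (\<integral>\<^sup>+w. ennreal (normal_density 0 t (x + 1 * w - x)) * f (y + (x + 1 * w)) \<partial>lborel)"
        by (rule nn_integral_real_affine) auto
      then show ?thesis by (simp add: shift_op_gauss_pos[OF t f] add.assoc)
    qed
    then have "shift_op (gauss s) (shift_op (gauss t) f) y =
       (\<integral>\<^sup>+x. ennreal (normal_density 0 s x) * (\<integral>\<^sup>+w. ennreal (normal_density 0 t (w - x)) * f (y + w) \<partial>lborel) \<partial>lborel)"
      by (simp add: shift_op_gauss_pos[OF s T])
    also have "\<dots> = (\<integral>\<^sup>+x. \<integral>\<^sup>+w. ennreal (normal_density 0 s x) * (ennreal (normal_density 0 t (w - x)) * f (y + w)) \<partial>lborel \<partial>lborel)"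
      by (intro nn_integral_cong, subst nn_integral_cmult) auto
    also have "\<dots> = (\<integral>\<^sup>+w. \<integral>\<^sup>+x. ennreal (normal_density 0 s x) * (ennreal (normal_density 0 t (w - x)) * f (y + w)) \<partial>lborel \<partial>lborel)"
    proof (rule lborel_pair.Fubini'[symmetric])
      have "(\<lambda>(x, w). ennreal (normal_density 0 s x) * (ennreal (normal_density 0 t (w - x)) * f (y + w))) \<in> borel_measurable (borel \<Otimes>\<^sub>M borel)"
        unfolding normal_density_def by measurable
      then show "(\<lambda>(x, w). ennreal (normal_density 0 s x) * (ennreal (normal_density 0 t (w - x)) * f (y + w))) \<in> borel_measurable (lborel \<Otimes>\<^sub>M lborel)"
        by (subst measurable_cong_sets[OF sets_pair_measure_cong[OF sets_lborel sets_lborel] refl])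
    qed
    also have "\<dots> = (\<integral>\<^sup>+w. (\<integral>\<^sup>+x. ennreal (normal_density 0 t (w - x) * normal_density 0 s x) \<partial>lborel) * f (y + w) \<partial>lborel)"
      by (intro nn_integral_cong, subst nn_integral_multc[symmetric]) (auto simp: ennreal_mult' mult_ac)
    also have "\<dots> = (\<integral>\<^sup>+w. ennreal (normal_density 0 (sqrt (t\<^sup>2 + s\<^sup>2)) w) * f (y + w) \<partial>lborel)"
      using fun_cong[OF conv_normal_density_zero_mean[OF t s]] by simp
    finally show ?thesis by (simp add: shift_op_gauss_pos[OF st f] add.commute)
  qed
qed

lemma shift_op_gauss_eq:
  assumes "s \<ge> 0" and p: "p > 0"
  shows "shift_op (gauss s) (pw p) 0 = ennreal (s powr p) * shift_op (gauss 1) (pw p) 0"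
proof -
  have [measurable]: "pw p \<in> borel_measurable borel" by (rule measurable_pw)
  show ?thesis
    unfolding shift_op_def
    by (subst (1 2) nn_integral_gauss)
       (use assms in \<open>auto simp: abs_mult powr_mult ennreal_mult' nn_integral_cmult\<close>)
qed

text \<open>The integral of \<open>A + B * x^2\<close> against \<open>\<mu>\<close> depends on
  \<open>\<mu>\<close> through \<open>s\<close> alone, and the majorant was built so that this value
  is at most the Gaussian average.\<close>

lemma shift_op_le_gauss:
  assumes \<mu>: "sym_law \<mu>" and p: "2 < p" "p \<le> 4"
    and s: "s \<ge> 0" "(\<integral>\<^sup>+x. ennreal (x\<^sup>2) \<partial>\<mu>) = ennreal (s\<^sup>2)"
  shows "shift_op \<mu> (pw p) y \<le> (\<integral>\<^sup>+x. pw p x \<partial>\<mu>) + shift_op (gauss s) (pw p) y"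
proof -
  have law: "law \<mu>" using \<mu> by (simp add: sym_law_def)
  interpret prob_space \<mu> using law by simp
  obtain A B where AB: "A \<ge> 0" "B \<ge> 0"
    "\<And>x. sympow p y x \<le> \<bar>x\<bar> powr p + A + B * x\<^sup>2"
    "ennreal (A + B * s\<^sup>2) \<le> (\<integral>\<^sup>+z. ennreal (sympow p y (s * z)) \<partial>std_normal_distribution)"
    using quadratic_majorant[OF p s(1)] by blast
  note m = measurable_law_borel[OF law]
  have "shift_op \<mu> (pw p) y \<le> (\<integral>\<^sup>+x. pw p x + (ennreal A + ennreal B * ennreal (x\<^sup>2)) \<partial>\<mu>)"
    unfolding shift_op_pw[OF \<mu>] using AB
    by (intro nn_integral_mono) (simp add: ennreal_leI add.assoc flip: ennreal_plus ennreal_mult')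
  also have "\<dots> = (\<integral>\<^sup>+x. pw p x \<partial>\<mu>) + ennreal (A + B * s\<^sup>2)"
    using AB s(2) by (simp add: nn_integral_add nn_integral_cmult m emeasure_space_1 ennreal_mult')
  also have "\<dots> \<le> (\<integral>\<^sup>+x. pw p x \<partial>\<mu>) + shift_op (gauss s) (pw p) y"
    unfolding shift_op_pw[OF sym_law_gauss] nn_integral_gauss[OF measurable_sympow]
    by (intro add_left_mono AB)
  finally show ?thesis .
qed

text \<open>Each replaced summand leaves a constant, which passes unchanged through the other
  operators because laws have mass one, and a Gaussian operator, which is commuted to the outside so
  that the induction hypothesis can again be applied to the power itself. The Gaussians then merge
  by adding variances.\<close>

lemma shift_ops_le_gauss:
  assumes \<mu>: "\<And>j. j \<ge> 1 \<Longrightarrow> sym_law (\<mu> j)" and p: "2 < p" "p \<le> 4"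
    and s: "\<And>j. s j \<ge> 0" "\<And>j. j \<ge> 1 \<Longrightarrow> j \<le> n \<Longrightarrow> (\<integral>\<^sup>+x. ennreal (x\<^sup>2) \<partial>\<mu> j) = ennreal ((s j)\<^sup>2)"
  shows "shift_ops \<mu> n (pw p) y \<le> (\<Sum>j=1..n. \<integral>\<^sup>+x. pw p x \<partial>\<mu> j) + shift_op (gauss (sqrt (\<Sum>j=1..n. (s j)\<^sup>2))) (pw p) y"
  using s(2)
proof (induction n arbitrary: y)
  case 0
  then show ?case by (simp add: shift_op_gauss_0)
next
  case (Suc n)
  have law: "law (\<mu> j)" if "j \<ge> 1" for j using \<mu>[OF that] by (simp add: sym_law_def)
  let ?P = "shift_ops \<mu> n" and ?G = "\<lambda>s. shift_op (gauss s)" and ?b = "\<lambda>j. \<integral>\<^sup>+x. pw p x \<partial>\<mu> j"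
  have P: "pos_op ?P" using law by (rule pos_op_shift_ops)
  have G: "pos_op (?G s)" for s by (intro pos_op_shift law_gauss)
  have T: "pos_op (shift_op (\<mu> (Suc n)))" using law by (intro pos_op_shift) auto
  note m = measurable_pw pos_op_measurable[OF P] pos_op_measurable[OF G] pos_op_measurable[OF T] borel_measurable_const
     borel_measurable_add
  have P1: "?P (\<lambda>y. c) y = c" for c y
    using law
  proof (induction n)
    case (Suc n)
    interpret prob_space "\<mu> (Suc n)" using Suc.prems by simp
    have "shift_op (\<mu> (Suc n)) (\<lambda>y. c) = (\<lambda>y. c)" by (simp add: shift_op_def[abs_def] emeasure_space_1)
    then show ?case using Suc by simp
  qed simp
  have "shift_ops \<mu> (Suc n) (pw p) y \<le> ?P (\<lambda>y. ?b (Suc n) + ?G (s (Suc n)) (pw p) y) y"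
    unfolding shift_ops.simps
    using \<mu> p s(1) Suc.prems by (intro pos_op_mono[OF P] m shift_op_le_gauss) auto
  also have "\<dots> = ?b (Suc n) + ?P (?G (s (Suc n)) (pw p)) y"
    by (simp add: pos_op_add[OF P] m P1)
  also have "?P (?G (s (Suc n)) (pw p)) y = ?G (s (Suc n)) (?P (pw p)) y"
  proof -
    have "commute_op ?P (?G (s (Suc n)))"
      by (rule commute_op_shift_ops, erule law, rule commute_op_shift, erule law, rule law_gauss)
    from commute_opD[OF this measurable_pw] show ?thesis by (rule fun_cong)
  qed
  also have "\<dots> \<le> ?G (s (Suc n)) (\<lambda>y. (\<Sum>j=1..n. ?b j) + ?G (sqrt (\<Sum>j=1..n. (s j)\<^sup>2)) (pw p) y) y"
    using Suc by (intro pos_op_mono[OF G] m) auto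
  also have "\<dots> = (\<Sum>j=1..n. ?b j) + ?G (s (Suc n)) (?G (sqrt (\<Sum>j=1..n. (s j)\<^sup>2)) (pw p)) y"
  proof -
    interpret prob_space "gauss (s (Suc n))" using law_gauss by simp
    have "?G (s (Suc n)) (\<lambda>y. c) y = c" for c by (simp add: shift_op_def emeasure_space_1)
    then show ?thesis by (simp add: pos_op_add[OF G] m)
  qed
  also have "?G (s (Suc n)) (?G (sqrt (\<Sum>j=1..n. (s j)\<^sup>2)) (pw p)) y = ?G (sqrt (\<Sum>j=1..Suc n. (s j)\<^sup>2)) (pw p) y"
    by (subst shift_op_gauss_gauss) (auto simp: s sum_nonneg add.commute)
  finally show ?case by (simp add: add_ac add_left_mono)
qed


section \<open>Comparison with compound Poisson sums\<close>

text \<open>The product structure of \<open>R V\<close> in integrated form, with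
  \<open>\<rho>\<close> the law of \<open>R\<close>; only this form is used in the
  estimates.\<close>

definition mixture_law :: "real measure \<Rightarrow> real measure \<Rightarrow> bool" where
  "mixture_law \<nu> \<mu> \<longleftrightarrow> law \<mu> \<and> (\<exists>\<rho>. law \<rho> \<and> (AE r in \<rho>. 0 \<le> r) \<and>
     (\<forall>g\<in>borel_measurable borel. (\<integral>\<^sup>+x. g x \<partial>\<mu>) = (\<integral>\<^sup>+r. \<integral>\<^sup>+w. g (r * w) \<partial>\<nu> \<partial>\<rho>)))"

lemma sym_law_mixture:
  assumes \<nu>: "sym_law \<nu>" and \<mu>: "mixture_law \<nu> \<mu>"
  shows "sym_law \<mu>"
  unfolding sym_law_def
proof (intro conjI ballI)
  obtain \<rho> where \<rho>: "\<And>g. g \<in> borel_measurable borel \<Longrightarrow> (\<integral>\<^sup>+x. g x \<partial>\<mu>) = (\<integral>\<^sup>+r. \<integral>\<^sup>+w. g (r * w) \<partial>\<nu> \<partial>\<rho>)"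
    using \<mu> unfolding mixture_law_def by blast
  show "prob_space \<mu>" "sets \<mu> = sets borel" using \<mu> by (simp_all add: mixture_law_def)
  fix g :: "real \<Rightarrow> ennreal" assume [measurable]: "g \<in> borel_measurable borel"
  have "(\<integral>\<^sup>+w. g (- (r * w)) \<partial>\<nu>) = (\<integral>\<^sup>+w. g (r * w) \<partial>\<nu>)" for r
  proof -
    have m: "(\<lambda>w. g (r * w)) \<in> borel_measurable borel" by measurable
    show ?thesis using bspec[OF conjunct2[OF \<nu>[unfolded sym_law_def]] m] by simp
  qed
  then show "(\<integral>\<^sup>+x. g (- x) \<partial>\<mu>) = (\<integral>\<^sup>+x. g x \<partial>\<mu>)" by (subst (1 2) \<rho>) auto
qed

lemma mixture_law_V_mixture:
  assumes mix: "V_mixture N V M X" and M: "prob_space M"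
  shows "mixture_law (distr N borel V) (distr M borel X)"
proof -
  obtain S :: "(real \<times> real) measure" and R W where S: "prob_space S" "prob_space.indep_var S borel R borel W"
    "\<forall>\<omega>\<in>space S. 0 \<le> R \<omega>" "distr S borel W = distr N borel V"
    and X: "distr M borel X = distr S borel (\<lambda>\<omega>. R \<omega> * W \<omega>)" "X \<in> borel_measurable M"
    using mix unfolding V_mixture_def by blast
  interpret S: prob_space S by fact
  have R[measurable]: "R \<in> borel_measurable S" and W[measurable]: "W \<in> borel_measurable S"
    using S(2) by (auto dest: S.indep_var_rv1 S.indep_var_rv2)
  interpret R: prob_space "distr S borel R" by (rule S.prob_space_distr) simp
  interpret W: prob_space "distr S borel W" by (rule S.prob_space_distr) simp
  show ?thesis
    unfolding mixture_law_def
  proof (intro conjI exI[of _ "distr S borel R"] ballI)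
    show "prob_space (distr M borel X)" using X(2) by (rule prob_space.prob_space_distr[OF M])
    show "AE r in distr S borel R. 0 \<le> r" using S(3) by (subst AE_distr_iff) auto
    fix g :: "real \<Rightarrow> ennreal" assume [measurable]: "g \<in> borel_measurable borel"
    have "(\<lambda>z. g (fst z * snd z)) \<in> borel_measurable (borel \<Otimes>\<^sub>M borel)" by measurable
    then have m: "(\<lambda>z. g (fst z * snd z)) \<in> borel_measurable (distr S borel R \<Otimes>\<^sub>M distr S borel W)"
      by (subst measurable_cong_sets[OF sets_pair_measure_cong[of "distr S borel R" borel "distr S borel W" borel], of borel borel]) auto
    have "(\<integral>\<^sup>+x. g x \<partial>distr M borel X) = (\<integral>\<^sup>+\<omega>. g (R \<omega> * W \<omega>) \<partial>S)"
      unfolding X by (subst nn_integral_distr) auto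
    also have "\<dots> = (\<integral>\<^sup>+z. g (fst z * snd z) \<partial>distr S (borel \<Otimes>\<^sub>M borel) (\<lambda>\<omega>. (R \<omega>, W \<omega>)))"
      by (subst nn_integral_distr) auto
    also have "\<dots> = (\<integral>\<^sup>+z. g (fst z * snd z) \<partial>(distr S borel R \<Otimes>\<^sub>M distr S borel W))"
      using S(2) by (simp add: S.indep_var_distribution_eq)
    also have "\<dots> = (\<integral>\<^sup>+r. \<integral>\<^sup>+w. g (r * w) \<partial>distr S borel W \<partial>distr S borel R)"
      by (subst W.nn_integral_fst[symmetric]) (auto intro: m)
    finally show "(\<integral>\<^sup>+x. g x \<partial>distr M borel X) = (\<integral>\<^sup>+r. \<integral>\<^sup>+w. g (r * w) \<partial>distr N borel V \<partial>distr S borel R)"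
      by (simp add: S(4))
  qed (auto intro: R.prob_space_axioms)
qed

definition scaled :: "real \<Rightarrow> real measure \<Rightarrow> real measure" where
  "scaled c \<nu> = distr \<nu> borel (\<lambda>w. c * w)"

lemma measurable_cmult_law: "law \<nu> \<Longrightarrow> (\<lambda>w::real. c * w) \<in> borel_measurable \<nu>"
  by (rule measurable_law_borel) auto

lemma law_scaled:
  assumes "law \<nu>"
  shows "law (scaled c \<nu>)"
  using assms prob_space.prob_space_distr[of \<nu> "\<lambda>w. c * w" borel] measurable_cmult_law[of \<nu> c]
  by (simp add: scaled_def)

lemma nn_integral_scaled:
  assumes "law \<nu>" "f \<in> borel_measurable borel"
  shows "(\<integral>\<^sup>+x. f x \<partial>scaled c \<nu>) = (\<integral>\<^sup>+w. f (c * w) \<partial>\<nu>)"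
  unfolding scaled_def using assms measurable_cmult_law[of \<nu> c] by (subst nn_integral_distr) auto

lemma sym_law_scaled:
  assumes \<nu>: "sym_law \<nu>"
  shows "sym_law (scaled c \<nu>)"
  unfolding sym_law_def
proof (intro conjI ballI)
  have law: "law \<nu>" using \<nu> by (simp add: sym_law_def)
  show "prob_space (scaled c \<nu>)" "sets (scaled c \<nu>) = sets borel" using law_scaled[OF law] by auto
  fix g :: "real \<Rightarrow> ennreal" assume g[measurable]: "g \<in> borel_measurable borel"
  have m: "(\<lambda>w. g (c * w)) \<in> borel_measurable borel" by measurable
  have m': "(\<lambda>w. g (- w)) \<in> borel_measurable borel" by measurable
  show "(\<integral>\<^sup>+x. g (- x) \<partial>scaled c \<nu>) = (\<integral>\<^sup>+x. g x \<partial>scaled c \<nu>)"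
    using bspec[OF conjunct2[OF \<nu>[unfolded sym_law_def]] m]
    by (simp add: nn_integral_scaled[OF law m'] nn_integral_scaled[OF law g])
qed

lemma funpow_scaled_op:
  assumes T: "pos_op T" and f: "f \<in> borel_measurable borel"
  shows "((\<lambda>f y. c * T f y) ^^ k) f y = c ^ k * (T ^^ k) f y"
proof (induction k arbitrary: y)
  case (Suc k)
  then have "((\<lambda>f y. c * T f y) ^^ k) f = (\<lambda>y. c ^ k * (T ^^ k) f y)" by auto
  then show ?case
    by (simp add: pos_op_cmult[OF T] pos_op_measurable[OF pos_op_funpow[OF T] f] mult.assoc)
qed simp

lemma exp_op_scaled_op:
  assumes T: "pos_op T" and f: "f \<in> borel_measurable borel"
  shows "exp_op (\<lambda>f y. c * T f y) f y = (\<Sum>k. ennreal (1 / fact k) * c ^ k * (T ^^ k) f y)"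
  by (simp add: exp_op_def funpow_scaled_op[OF T f] mult.assoc)

lemma pos_op_scaled_op: "pos_op T \<Longrightarrow> pos_op (\<lambda>f y. c * T f y)"
  using pos_op_comp[OF pos_op_scale] .

text \<open>\<open>E f(y + c V\<^sub>1 + \<dots> + c V\<^sub>\<xi>)\<close> for \<open>\<xi>\<close> Poisson with parameter \<open>l\<close> and independent copies \<open>V\<^sub>j\<close> of law \<open>\<nu>\<close>.\<close>

definition cpois :: "real \<Rightarrow> real \<Rightarrow> real measure \<Rightarrow> op" where
  "cpois l c \<nu> f y = ennreal (exp (- l)) * exp_op (\<lambda>f y. ennreal l * shift_op (scaled c \<nu>) f y) f y"

lemma shift_op_scaled:
  assumes "law \<nu>" "f \<in> borel_measurable borel"
  shows "shift_op (scaled c \<nu>) f y = (\<integral>\<^sup>+w. f (y + c * w) \<partial>\<nu>)"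
proof -
  have [measurable]: "f \<in> borel_measurable borel" by fact
  have "(\<lambda>x. f (y + x)) \<in> borel_measurable borel" by measurable
  then show ?thesis unfolding shift_op_def by (rule nn_integral_scaled[OF assms(1)])
qed

lemma cpois_homogeneous:
  assumes \<nu>: "law \<nu>" and m: "m \<ge> 0"
  shows "cpois l (a * m) \<nu> (pw p) 0 = ennreal (m powr p) * cpois l a \<nu> (pw p) 0"
proof -
  have P: "pos_op (shift_op (scaled c \<nu>))" for c by (intro pos_op_shift law_scaled \<nu>)
  note mP = pos_op_measurable[OF pos_op_funpow[OF P] measurable_pw]
  have "(shift_op (scaled (a * m) \<nu>) ^^ k) (pw p) (m * y) = ennreal (m powr p) * (shift_op (scaled a \<nu>) ^^ k) (pw p) y" for k y
  proof (induction k arbitrary: y)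
    case 0
    then show ?case using m by (simp add: abs_mult powr_mult ennreal_mult')
  next
    case (Suc k)
    have [measurable]: "(shift_op (scaled a \<nu>) ^^ k) (pw p) \<in> borel_measurable borel" by (rule mP)
    have "(shift_op (scaled (a * m) \<nu>) ^^ Suc k) (pw p) (m * y) =
      (\<integral>\<^sup>+w. (shift_op (scaled (a * m) \<nu>) ^^ k) (pw p) (m * (y + a * w)) \<partial>\<nu>)"
      by (simp add: shift_op_scaled[OF \<nu> mP] algebra_simps)
    also have "\<dots> = (\<integral>\<^sup>+w. ennreal (m powr p) * (shift_op (scaled a \<nu>) ^^ k) (pw p) (y + a * w) \<partial>\<nu>)"
      unfolding Suc ..
    also have "\<dots> = ennreal (m powr p) * (\<integral>\<^sup>+w. (shift_op (scaled a \<nu>) ^^ k) (pw p) (y + a * w) \<partial>\<nu>)"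
      by (intro nn_integral_cmult measurable_law_borel[OF \<nu>]) measurable
    finally show ?case by (simp add: shift_op_scaled[OF \<nu> mP])
  qed
  from this[of _ 0] show ?thesis
    by (simp add: cpois_def exp_op_scaled_op[OF P measurable_pw] mult.left_commute[of _ "ennreal (m powr p)"] ennreal_suminf_cmult)
qed

text \<open>The function \<open>F = |y|^p + 1\<close> satisfies \<open>T F \<le> D F\<close> for a
  constant \<open>D\<close>, so on \<open>F\<close> the exponential of \<open>l T\<close> is
  dominated by that of a scalar. The added 1 is what absorbs the constant term of
  \<open>shift_op_pw_bound\<close>.\<close>

lemma cpois_finite:
  assumes \<nu>: "law \<nu>" and p: "p \<ge> 1" and fin: "(\<integral>\<^sup>+x. pw p x \<partial>\<nu>) < \<top>" and l: "l \<ge> 0"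
  shows "cpois l c \<nu> (pw p) y < \<top>"
proof -
  let ?T = "shift_op (scaled c \<nu>)"
  have law: "law (scaled c \<nu>)" by (rule law_scaled[OF \<nu>])
  have T: "pos_op ?T" by (intro pos_op_shift law)
  interpret prob_space "scaled c \<nu>" using law by simp
  have "?T (pw p) 0 = (\<integral>\<^sup>+w. ennreal (\<bar>c\<bar> powr p) * pw p w \<partial>\<nu>)"
    by (simp add: shift_op_scaled[OF \<nu>] abs_mult powr_mult ennreal_mult')
  also have "\<dots> = ennreal (\<bar>c\<bar> powr p) * (\<integral>\<^sup>+w. pw p w \<partial>\<nu>)"
    by (intro nn_integral_cmult measurable_law_borel[OF \<nu>] measurable_pw)
  finally have "?T (pw p) 0 < \<top>" using fin by (simp add: ennreal_mult_less_top)
  then obtain m where m: "?T (pw p) 0 = ennreal m" "m \<ge> 0" by (cases "?T (pw p) 0") auto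
  define D where "D = 2 powr p * (1 + m) + 1"
  have D: "D \<ge> 0" using m by (simp add: D_def)
  let ?F = "\<lambda>y. pw p y + 1"
  have F: "?F \<in> borel_measurable borel" by measurable
  have step: "ennreal l * ?T ?F y \<le> ennreal (l * D) * ?F y" for y
  proof -
    have "?T ?F y = ?T (pw p) y + 1"
      by (subst pos_op_add[OF T]) (auto simp: shift_op_def emeasure_space_1)
    also have "\<dots> \<le> ennreal (2 powr p) * (pw p y + ennreal m) + 1"
      unfolding m(1)[symmetric] by (intro add_right_mono shift_op_pw_bound law p)
    also have "\<dots> = ennreal (2 powr p * (\<bar>y\<bar> powr p + m) + 1)"
      using m by (simp add: ennreal_mult')
    also have "\<dots> \<le> ennreal (D * (\<bar>y\<bar> powr p + 1))"
    proof (rule ennreal_leI)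
      have "0 \<le> 2 powr p * (m * \<bar>y\<bar> powr p) + \<bar>y\<bar> powr p + 2 powr p"
        using m by (intro add_nonneg_nonneg mult_nonneg_nonneg) auto
      then show "2 powr p * (\<bar>y\<bar> powr p + m) + 1 \<le> D * (\<bar>y\<bar> powr p + 1)"
        by (simp add: D_def algebra_simps)
    qed
    also have "\<dots> = ennreal D * ?F y" using D by (simp add: ennreal_mult')
    finally have "ennreal l * ?T ?F y \<le> ennreal l * (ennreal D * ?F y)" by (rule mult_left_mono) simp
    then show ?thesis using l by (simp add: ennreal_mult' mult.assoc)
  qed
  have "exp_op (\<lambda>f y. ennreal l * ?T f y) (pw p) y \<le> exp_op (\<lambda>f y. ennreal l * ?T f y) ?F y"
    by (intro exp_op_mono pos_op_scaled_op T measurable_pw F) simp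
  also have "\<dots> \<le> exp_op (scale_op (ennreal (l * D))) ?F y"
    by (intro exp_op_le_exp_op pos_op_scaled_op T pos_op_scale F step commute_op_sym[OF commute_op_scale])
  also have "\<dots> = ennreal (exp (l * D)) * ?F y" using l D by (intro exp_op_scale) simp
  also have "\<dots> < \<top>" by (simp add: ennreal_mult_less_top)
  finally show ?thesis by (simp add: cpois_def ennreal_mult_less_top)
qed

lemma cpois_pos:
  assumes \<nu>: "law \<nu>" and pos: "(\<integral>\<^sup>+x. pw p x \<partial>\<nu>) > 0" and l: "l > 0" and c: "c \<noteq> 0"
  shows "cpois l c \<nu> (pw p) 0 > 0"
proof -
  let ?T = "shift_op (scaled c \<nu>)"
  have T: "pos_op ?T" by (intro pos_op_shift law_scaled \<nu>)
  have "?T (pw p) 0 = (\<integral>\<^sup>+w. ennreal (\<bar>c\<bar> powr p) * pw p w \<partial>\<nu>)"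
    by (simp add: shift_op_scaled[OF \<nu>] abs_mult powr_mult ennreal_mult')
  also have "\<dots> = ennreal (\<bar>c\<bar> powr p) * (\<integral>\<^sup>+w. pw p w \<partial>\<nu>)"
    by (intro nn_integral_cmult measurable_law_borel[OF \<nu>] measurable_pw)
  also have "\<dots> > 0" using pos c by (simp add: ennreal_zero_less_mult_iff)
  finally have "0 < ennreal l * ?T (pw p) 0" using l by (simp add: ennreal_zero_less_mult_iff)
  also have "\<dots> = (\<Sum>k\<in>{1}. ennreal (1 / fact k) * ennreal l ^ k * (?T ^^ k) (pw p) 0)" by simp
  also have "\<dots> \<le> exp_op (\<lambda>f y. ennreal l * ?T f y) (pw p) 0"
    unfolding exp_op_scaled_op[OF T measurable_pw] by (rule sum_le_suminf) auto
  finally show ?thesis by (simp add: cpois_def ennreal_zero_less_mult_iff)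
qed

lemma measurable_pcoef: "(\<lambda>x. pcoef p y x) \<in> borel_measurable borel"
  unfolding pcoef_def asympow_def sympow_def by measurable

text \<open>The tangent bound \<open>sympow_scale_le\<close> at \<open>\<rho> = r / c\<close> and
  \<open>x = c * w\<close>, integrated over independent \<open>r\<close> and \<open>w\<close>. The
  result is linear in the second and the \<open>p\<close>-th moment of \<open>\<mu>\<close>, with
  coefficients that do not depend on the mixing law.\<close>

lemma shift_op_mixture_le:
  assumes p: "p \<ge> 4" and \<nu>: "sym_law \<nu>" and \<mu>: "mixture_law \<nu> \<mu>" and c: "c > 0"
    and v: "(\<integral>\<^sup>+x. ennreal (x\<^sup>2) \<partial>\<nu>) = ennreal v2" "v2 > 0" "(\<integral>\<^sup>+x. pw p x \<partial>\<nu>) = ennreal vp" "vp > 0"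
  shows "shift_op \<mu> (pw p) y \<le> pw p y
     + (\<integral>\<^sup>+x. ennreal (x\<^sup>2) \<partial>\<mu>) / ennreal (c\<^sup>2 * v2) * (\<integral>\<^sup>+w. ennreal (sympow p y (c * w) - \<bar>y\<bar> powr p - pcoef p y (c * w)) \<partial>\<nu>)
     + (\<integral>\<^sup>+x. pw p x \<partial>\<mu>) / ennreal (c powr p * vp) * (\<integral>\<^sup>+w. ennreal (pcoef p y (c * w)) \<partial>\<nu>)"
    (is "_ \<le> _ + _ * ?b + _ * ?d")
proof -
  have law: "law \<nu>" and law\<mu>: "sym_law \<mu>" using \<nu> sym_law_mixture[OF \<nu> \<mu>] by (auto simp: sym_law_def)
  obtain \<rho> where \<rho>: "law \<rho>" "AE r in \<rho>. 0 \<le> r" "\<And>g. g \<in> borel_measurable borel \<Longrightarrow> (\<integral>\<^sup>+x. g x \<partial>\<mu>) = (\<integral>\<^sup>+r. \<integral>\<^sup>+w. g (r * w) \<partial>\<nu> \<partial>\<rho>)"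
    using \<mu> unfolding mixture_law_def by blast
  interpret \<nu>: prob_space \<nu> using law by simp
  interpret \<rho>: prob_space \<rho> using \<rho>(1) by simp
  note [measurable] = measurable_pcoef
  note m\<nu> = measurable_law_borel[OF law] and m\<rho> = measurable_law_borel[OF \<rho>(1)]
  let ?B = "\<lambda>w. ennreal (sympow p y (c * w) - \<bar>y\<bar> powr p - pcoef p y (c * w))" and ?D = "\<lambda>w. ennreal (pcoef p y (c * w))"
  have mB: "?B \<in> borel_measurable borel" unfolding sympow_def by measurable
  have mD: "?D \<in> borel_measurable borel" by measurable
  have 2: "(\<integral>\<^sup>+r. ennreal ((r / c)\<^sup>2) \<partial>\<rho>) = (\<integral>\<^sup>+x. ennreal (x\<^sup>2) \<partial>\<mu>) / ennreal (c\<^sup>2 * v2)"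
  proof -
    have "(\<integral>\<^sup>+x. ennreal (x\<^sup>2) \<partial>\<mu>) = (\<integral>\<^sup>+r. \<integral>\<^sup>+w. ennreal (r\<^sup>2) * ennreal (w\<^sup>2) \<partial>\<nu> \<partial>\<rho>)"
      by (subst \<rho>(3)) (auto simp: power_mult_distrib ennreal_mult')
    also have "\<dots> = (\<integral>\<^sup>+r. ennreal (c\<^sup>2 * v2) * ennreal ((r / c)\<^sup>2) \<partial>\<rho>)"
    proof (rule nn_integral_cong)
      fix r
      have "(\<integral>\<^sup>+w. ennreal (r\<^sup>2) * ennreal (w\<^sup>2) \<partial>\<nu>) = ennreal (r\<^sup>2) * ennreal v2"
        unfolding v(1)[symmetric] by (intro nn_integral_cmult m\<nu>) measurable
      also have "\<dots> = ennreal (c\<^sup>2 * v2) * ennreal ((r / c)\<^sup>2)"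
        using c v by (simp add: power_divide flip: ennreal_mult')
      finally show "(\<integral>\<^sup>+w. ennreal (r\<^sup>2) * ennreal (w\<^sup>2) \<partial>\<nu>) = \<dots>" .
    qed
    also have "\<dots> = ennreal (c\<^sup>2 * v2) * (\<integral>\<^sup>+r. ennreal ((r / c)\<^sup>2) \<partial>\<rho>)"
      by (intro nn_integral_cmult m\<rho>) measurable
    finally show ?thesis using c v
      by (simp add: ennreal_mult_divide_eq mult.commute[of "ennreal (c\<^sup>2 * v2)"])
  qed
  have p': "(\<integral>\<^sup>+r. pw p (r / c) \<partial>\<rho>) = (\<integral>\<^sup>+x. pw p x \<partial>\<mu>) / ennreal (c powr p * vp)"
  proof -
    have "(\<integral>\<^sup>+x. pw p x \<partial>\<mu>) = (\<integral>\<^sup>+r. \<integral>\<^sup>+w. pw p r * pw p w \<partial>\<nu> \<partial>\<rho>)"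
      by (subst \<rho>(3)) (auto simp: abs_mult powr_mult ennreal_mult')
    also have "\<dots> = (\<integral>\<^sup>+r. ennreal (c powr p * vp) * pw p (r / c) \<partial>\<rho>)"
    proof (rule nn_integral_cong)
      fix r
      have "(\<integral>\<^sup>+w. pw p r * pw p w \<partial>\<nu>) = pw p r * ennreal vp"
        unfolding v(3)[symmetric] by (intro nn_integral_cmult m\<nu>) measurable
      also have "\<dots> = ennreal (c powr p * vp) * pw p (r / c)"
        using c v by (simp add: powr_divide flip: ennreal_mult')
      finally show "(\<integral>\<^sup>+w. pw p r * pw p w \<partial>\<nu>) = \<dots>" .
    qed
    also have "\<dots> = ennreal (c powr p * vp) * (\<integral>\<^sup>+r. pw p (r / c) \<partial>\<rho>)"
      by (intro nn_integral_cmult m\<rho>) measurable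
    finally show ?thesis using c v
      by (simp add: ennreal_mult_divide_eq mult.commute[of "ennreal (c powr p * vp)"])
  qed
  have "shift_op \<mu> (pw p) y = (\<integral>\<^sup>+r. \<integral>\<^sup>+w. ennreal (sympow p y (r * w)) \<partial>\<nu> \<partial>\<rho>)"
    unfolding shift_op_pw[OF law\<mu>] by (rule \<rho>(3)[OF measurable_sympow])
  also have "\<dots> \<le> (\<integral>\<^sup>+r. pw p y + (ennreal ((r / c)\<^sup>2) * ?b + pw p (r / c) * ?d) \<partial>\<rho>)"
  proof (rule nn_integral_mono_AE, use \<rho>(2) in eventually_elim)
    fix r :: real assume r: "0 \<le> r"
    have "(\<integral>\<^sup>+w. ennreal (sympow p y (r * w)) \<partial>\<nu>) \<le> (\<integral>\<^sup>+w. pw p y + (ennreal ((r / c)\<^sup>2) * ?B w + pw p (r / c) * ?D w) \<partial>\<nu>)"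
    proof (rule nn_integral_mono)
      fix w
      have "sympow p y (r / c * (c * w)) \<le> \<bar>y\<bar> powr p + (r / c)\<^sup>2 * (sympow p y (c * w) - \<bar>y\<bar> powr p - pcoef p y (c * w))
        + (r / c) powr p * pcoef p y (c * w)" using p r c by (intro sympow_scale_le) auto
      then show "ennreal (sympow p y (r * w)) \<le> pw p y + (ennreal ((r / c)\<^sup>2) * ?B w + pw p (r / c) * ?D w)"
        using c r pcoef_nonneg[OF p, of y "c * w"] pcoef_le[OF p, of y "c * w"]
        by (simp add: ennreal_leI flip: ennreal_mult' ennreal_plus)
    qed
    also have "\<dots> = pw p y + (ennreal ((r / c)\<^sup>2) * ?b + pw p (r / c) * ?d)"
    proof -
      have mB': "?B \<in> borel_measurable \<nu>" and mD': "?D \<in> borel_measurable \<nu>" by (intro m\<nu> mB mD)+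
      have "(\<integral>\<^sup>+w. k + (a * ?B w + b * ?D w) \<partial>\<nu>) = k + (a * ?b + b * ?d)" for a b k
      proof -
        have "(\<integral>\<^sup>+w. k + (a * ?B w + b * ?D w) \<partial>\<nu>) = (\<integral>\<^sup>+w. k \<partial>\<nu>) + (\<integral>\<^sup>+w. a * ?B w + b * ?D w \<partial>\<nu>)"
          by (intro nn_integral_add borel_measurable_add borel_measurable_times_ennreal mB' mD' borel_measurable_const)
        also have "(\<integral>\<^sup>+w. a * ?B w + b * ?D w \<partial>\<nu>) = (\<integral>\<^sup>+w. a * ?B w \<partial>\<nu>) + (\<integral>\<^sup>+w. b * ?D w \<partial>\<nu>)"
          by (intro nn_integral_add borel_measurable_times_ennreal mB' mD' borel_measurable_const)
        finally show ?thesis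
          by (simp add: nn_integral_cmult[OF mB'] nn_integral_cmult[OF mD'] \<nu>.emeasure_space_1)
      qed
      then show ?thesis .
    qed
    finally show "(\<integral>\<^sup>+w. ennreal (sympow p y (r * w)) \<partial>\<nu>) \<le> \<dots>" .
  qed
  also have "\<dots> = pw p y + ((\<integral>\<^sup>+r. ennreal ((r / c)\<^sup>2) \<partial>\<rho>) * ?b + (\<integral>\<^sup>+r. pw p (r / c) \<partial>\<rho>) * ?d)"
    by (simp add: nn_integral_add nn_integral_multc m\<rho> \<rho>.emeasure_space_1)
  finally show ?thesis unfolding 2 p' by (simp only: add.assoc)
qed

text \<open>The case of equality in \<open>shift_op_mixture_le\<close>: the tangent touches at
  \<open>\<rho> = 1\<close>, that is for the constant mixing variable \<open>c\<close>.\<close>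

lemma shift_op_scaled_split:
  assumes p: "p \<ge> 4" and \<nu>: "sym_law \<nu>"
  shows "shift_op (scaled c \<nu>) (pw p) y = pw p y
     + (\<integral>\<^sup>+w. ennreal (sympow p y (c * w) - \<bar>y\<bar> powr p - pcoef p y (c * w)) \<partial>\<nu>) + (\<integral>\<^sup>+w. ennreal (pcoef p y (c * w)) \<partial>\<nu>)"
proof -
  have law: "law \<nu>" using \<nu> by (auto simp: sym_law_def)
  interpret prob_space \<nu> using law by simp
  note m = measurable_law_borel[OF law]
  note [measurable] = measurable_pcoef
  let ?B = "\<lambda>w. ennreal (sympow p y (c * w) - \<bar>y\<bar> powr p - pcoef p y (c * w))" and ?D = "\<lambda>w. ennreal (pcoef p y (c * w))"
  have mB: "?B \<in> borel_measurable borel" unfolding sympow_def by measurable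
  have mD: "?D \<in> borel_measurable borel" by measurable
  have "shift_op (scaled c \<nu>) (pw p) y = (\<integral>\<^sup>+w. ennreal (sympow p y (c * w)) \<partial>\<nu>)"
    unfolding shift_op_pw[OF sym_law_scaled[OF \<nu>]] by (rule nn_integral_scaled[OF law measurable_sympow])
  also have "\<dots> = (\<integral>\<^sup>+w. pw p y + (?B w + ?D w) \<partial>\<nu>)"
    using pcoef_nonneg[OF p, of y] pcoef_le[OF p, of y] sympow_ge[of p y] p
    by (intro nn_integral_cong) (simp flip: ennreal_plus)
  also have "\<dots> = pw p y + ((\<integral>\<^sup>+w. ?B w \<partial>\<nu>) + (\<integral>\<^sup>+w. ?D w \<partial>\<nu>))"
  proof -
    have mB': "?B \<in> borel_measurable \<nu>" and mD': "?D \<in> borel_measurable \<nu>" by (intro m mB mD)+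
    have "(\<integral>\<^sup>+w. pw p y + (?B w + ?D w) \<partial>\<nu>) = (\<integral>\<^sup>+w. pw p y \<partial>\<nu>) + (\<integral>\<^sup>+w. ?B w + ?D w \<partial>\<nu>)"
      by (intro nn_integral_add borel_measurable_add mB' mD' borel_measurable_const)
    then show ?thesis by (simp add: nn_integral_add[OF mB' mD'] emeasure_space_1)
  qed
  finally show ?thesis by (simp add: add.assoc)
qed

text \<open>Both sums of moments are measured in units of one copy of \<open>c V\<close>, and both
  are at most \<open>l\<close> such units. With the same \<open>l\<close> for both, the two parts of
  the tangent bound recombine into \<open>l\<close> times the generator of
  \<open>c V\<close>.\<close>

lemma shift_ops_le_cpois:
  assumes p: "p \<ge> 4" and \<nu>: "sym_law \<nu>" and \<mu>: "\<And>j. j \<ge> 1 \<Longrightarrow> mixture_law \<nu> (\<mu> j)" and c: "c > 0" and l: "l > 0"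
    and v: "(\<integral>\<^sup>+x. ennreal (x\<^sup>2) \<partial>\<nu>) = ennreal v2" "v2 > 0" "(\<integral>\<^sup>+x. pw p x \<partial>\<nu>) = ennreal vp" "vp > 0"
    and s2: "(\<Sum>j=1..n. \<integral>\<^sup>+x. ennreal (x\<^sup>2) \<partial>\<mu> j) \<le> ennreal (l * (c\<^sup>2 * v2))"
    and sp: "(\<Sum>j=1..n. \<integral>\<^sup>+x. pw p x \<partial>\<mu> j) \<le> ennreal (l * (c powr p * vp))"
  shows "shift_ops \<mu> n (pw p) 0 \<le> cpois l c \<nu> (pw p) 0"
proof -
  have lawN: "law \<nu>" using \<nu> by (simp add: sym_law_def)
  have sym: "sym_law (\<mu> j)" and law: "law (\<mu> j)" if "j \<ge> 1" for j
    using sym_law_mixture[OF \<nu> \<mu>[OF that]] by (auto simp: sym_law_def)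
  let ?T = "shift_op (scaled c \<nu>)" and ?f = "pw p"
  let ?S = "sum_op \<mu> n"
  have T: "pos_op ?T" by (intro pos_op_shift law_scaled lawN)
  have S: "pos_op ?S" using law by (rule pos_op_sum_op)
  have le: "ennreal (exp 1) * shift_op (\<mu> j) ?f y \<le> exp_op (shift_op (\<mu> j)) ?f y" if j: "j \<ge> 1" "j \<le> n" for j y
  proof (rule op_le_exp_op)
    show "pos_op (shift_op (\<mu> j))" by (intro pos_op_shift law j)
    fix y
    have "(\<integral>\<^sup>+x. ?f x \<partial>\<mu> j) \<le> (\<Sum>j=1..n. \<integral>\<^sup>+x. ?f x \<partial>\<mu> j)" using j by (intro member_le_sum) auto
    with sp have "(\<integral>\<^sup>+x. ?f x \<partial>\<mu> j) < \<top>" by (meson ennreal_less_top le_less_trans order.trans)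
    then have "ennreal (2 powr p) * (?f y + shift_op (\<mu> j) ?f 0) < \<top>"
      by (simp add: ennreal_mult_less_top shift_op_def)
    then show "shift_op (\<mu> j) ?f y < \<top>" using shift_op_pw_bound[OF law[OF j(1)], of p y] p by (auto intro: le_less_trans)
    show "2 * shift_op (\<mu> j) ?f y \<le> shift_op (\<mu> j) (shift_op (\<mu> j) ?f) y + ?f y"
      using p by (intro shift_op_convex sym j) auto
  qed auto
  \<comment> \<open>The inequality of generators \<open>S - n \<le> l (T - 1)\<close> on
    \<open>f\<close>, with the negative terms moved across.\<close>
  have step: "?S ?f y + ennreal l * ?f y \<le> ennreal l * ?T ?f y + ennreal (real n) * ?f y" for y
  proof -
    let ?b = "\<integral>\<^sup>+w. ennreal (sympow p y (c * w) - \<bar>y\<bar> powr p - pcoef p y (c * w)) \<partial>\<nu>" and ?d = "\<integral>\<^sup>+w. ennreal (pcoef p y (c * w)) \<partial>\<nu>"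
    have div: "s / ennreal k \<le> ennreal l" if "s \<le> ennreal (l * k)" "k > 0" for s k
    proof -
      have "s / ennreal k \<le> ennreal (l * k) / ennreal k" using that by (intro divide_right_mono_ennreal)
      also have "\<dots> = ennreal l" using that l by (simp add: divide_ennreal)
      finally show ?thesis .
    qed
    have sdiv: "(\<Sum>j=1..n. F j / K) = (\<Sum>j=1..n. F j) / K" for F :: "nat \<Rightarrow> ennreal" and K
      by (simp add: divide_ennreal_def sum_distrib_right)
    have "?S ?f y \<le> (\<Sum>j=1..n. ?f y + (\<integral>\<^sup>+x. ennreal (x\<^sup>2) \<partial>\<mu> j) / ennreal (c\<^sup>2 * v2) * ?b + (\<integral>\<^sup>+x. ?f x \<partial>\<mu> j) / ennreal (c powr p * vp) * ?d)"
      unfolding sum_op_def by (intro sum_mono shift_op_mixture_le p \<nu> \<mu> c v) auto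
    also have "\<dots> = ennreal (real n) * ?f y + (\<Sum>j=1..n. \<integral>\<^sup>+x. ennreal (x\<^sup>2) \<partial>\<mu> j) / ennreal (c\<^sup>2 * v2) * ?b
        + (\<Sum>j=1..n. \<integral>\<^sup>+x. ?f x \<partial>\<mu> j) / ennreal (c powr p * vp) * ?d"
      by (simp only: sum.distrib sdiv sum_distrib_right[symmetric]) (simp add: ennreal_of_nat_eq_real_of_nat)
    also have "\<dots> \<le> ennreal (real n) * ?f y + ennreal l * ?b + ennreal l * ?d"
      using c v by (intro add_mono mult_right_mono div s2 sp) auto
    finally have "?S ?f y + ennreal l * ?f y \<le> ennreal (real n) * ?f y + ennreal l * ?b + ennreal l * ?d + ennreal l * ?f y"
      by (rule add_right_mono)
    also have "\<dots> = ennreal l * ?T ?f y + ennreal (real n) * ?f y"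
      unfolding shift_op_scaled_split[OF p \<nu>] by (simp add: distrib_left ac_simps)
    finally show ?thesis .
  qed
  have cT: "commute_op ?S (\<lambda>f y. ennreal l * ?T f y)"
  proof (rule commute_op_sum_op)
    fix j :: nat assume j: "j \<ge> 1"
    have "commute_op (scale_op (ennreal l)) (shift_op (\<mu> j))" by (intro commute_op_scale pos_op_shift law j)
    moreover have "commute_op ?T (shift_op (\<mu> j))" by (intro commute_op_shift law_scaled lawN law j)
    ultimately show "commute_op (shift_op (\<mu> j)) (\<lambda>f y. ennreal l * ?T f y)"
      using commute_op_comp[OF T] commute_op_sym by blast
  qed (use law T in \<open>auto intro: pos_op_scaled_op\<close>)
  have comm: "commute_op (add_op ?S (scale_op (ennreal l))) (add_op (\<lambda>f y. ennreal l * ?T f y) (scale_op (ennreal (real n))))"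
    by (intro commute_op_add S pos_op_scale pos_op_add_op pos_op_scaled_op T commute_op_scale
        commute_op_sym[OF commute_op_add] commute_op_sym[OF cT])
  have "ennreal (exp l) * (ennreal (exp (real n)) * shift_ops \<mu> n ?f 0) \<le> ennreal (exp l) * exp_op ?S ?f 0"
    by (intro mult_left_mono shift_ops_le_exp_op law measurable_pw le) auto
  also have "\<dots> = exp_op (add_op ?S (scale_op (ennreal l))) ?f 0"
    using l by (intro exp_op_add_scale[symmetric] S measurable_pw) auto
  also have "\<dots> \<le> exp_op (add_op (\<lambda>f y. ennreal l * ?T f y) (scale_op (ennreal (real n)))) ?f 0"
    by (rule exp_op_le_exp_op[OF _ _ comm measurable_pw step]) (intro pos_op_add_op S pos_op_scale pos_op_scaled_op T)+
  also have "\<dots> = ennreal (exp (real n)) * exp_op (\<lambda>f y. ennreal l * ?T f y) ?f 0"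
    by (intro exp_op_add_scale pos_op_scaled_op T measurable_pw) auto
  \<comment> \<open>Both sides still carry the exponentials of the scalars that were moved across;
    one factor removes them and supplies the normalisation of \<open>cpois\<close>.\<close>
  finally have "ennreal (exp (- l - real n)) * (ennreal (exp l) * (ennreal (exp (real n)) * shift_ops \<mu> n ?f 0)) \<le>
      ennreal (exp (- l - real n)) * (ennreal (exp (real n)) * exp_op (\<lambda>f y. ennreal l * ?T f y) ?f 0)"
    by (rule mult_left_mono) simp
  then show ?thesis
    by (simp add: cpois_def mult.assoc[symmetric] ennreal_mult'[symmetric] exp_add[symmetric])
qed


section \<open>Extremal sequences\<close>

lemma epowr_top [simp]: "epowr \<top> a = \<top>"
  by (simp add: epowr_def)

lemma epowr_zero [simp]: "epowr 0 a = 0"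
  by (simp add: epowr_def)

lemma epowr_ennreal: "x \<ge> 0 \<Longrightarrow> epowr (ennreal x) a = ennreal (x powr a)"
  by (simp add: epowr_def)

lemma epowr_one [simp]: "epowr x 1 = x"
  by (cases x) (simp_all add: epowr_ennreal)

lemma epowr_epowr: "epowr (epowr x a) b = epowr x (a * b)"
  by (cases x) (simp_all add: epowr_ennreal powr_powr)

lemma epowr_mono: "x \<le> y \<Longrightarrow> 0 \<le> a \<Longrightarrow> epowr x a \<le> epowr y a"
  by (cases x; cases y) (auto simp: epowr_ennreal top_unique intro!: ennreal_leI powr_mono2)

lemma epowr_le_iff: "a > 0 \<Longrightarrow> epowr x a \<le> epowr y a \<longleftrightarrow> x \<le> y"
  using epowr_mono[of x y a] epowr_mono[of "epowr x a" "epowr y a" "1 / a"] by (auto simp: epowr_epowr)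

lemma epowr_mult: "a > 0 \<Longrightarrow> epowr (x * y) a = epowr x a * epowr y a"
proof (cases x; cases y)
  assume a: "a > 0"
  show "epowr (x * y) a = epowr x a * epowr y a" if "x = ennreal r" "0 \<le> r" "y = ennreal s" "0 \<le> s" for r s
    using that by (simp add: epowr_ennreal powr_mult flip: ennreal_mult')
  show "epowr (x * y) a = epowr x a * epowr y a" if "x = ennreal r" "0 \<le> r" "y = \<top>" for r
    using that a by (cases "r = 0") (simp_all add: epowr_ennreal ennreal_mult_top)
  show "epowr (x * y) a = epowr x a * epowr y a" if "x = \<top>" "y = ennreal s" "0 \<le> s" for s
    using that a by (cases "s = 0") (simp_all add: epowr_ennreal ennreal_top_mult)
qed simp

lemma epowr_max: "0 \<le> a \<Longrightarrow> epowr (max x y) a = max (epowr x a) (epowr y a)"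
  using epowr_mono[of x y a] epowr_mono[of y x a] by (auto simp: max_def antisym)

lemma epowr_less_top [simp]: "epowr x a < \<top> \<longleftrightarrow> x < \<top>"
  by (cases x) (simp_all add: epowr_ennreal)

lemma epowr_eLp_norm: "p > 0 \<Longrightarrow> epowr (eLp_norm M p Y) p = (\<integral>\<^sup>+\<omega>. pw p (Y \<omega>) \<partial>M)"
  by (simp add: eLp_norm_def epowr_epowr)

text \<open>Raising to the power \<open>p\<close> is an order embedding of \<open>ennreal\<close>,
  so nothing is lost when norms or the constant are infinite. All estimates are carried out in the
  form on the right.\<close>

lemma moment_inequality_iff:
  assumes p: "p > 0"
  shows "eLp_norm M p (\<lambda>\<omega>. \<Sum>j=1..n. X j \<omega>)
          \<le> C * max (epowr (\<Sum>j=1..n. epowr (eLp_norm M 2 (X j)) 2) (1 / 2))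
                    (epowr (\<Sum>j=1..n. epowr (eLp_norm M p (X j)) p) (1 / p)) \<longleftrightarrow>
     (\<integral>\<^sup>+\<omega>. pw p (\<Sum>j=1..n. X j \<omega>) \<partial>M) \<le> epowr C p *
        max (epowr (\<Sum>j=1..n. \<integral>\<^sup>+\<omega>. ennreal ((X j \<omega>)\<^sup>2) \<partial>M) (p / 2)) (\<Sum>j=1..n. \<integral>\<^sup>+\<omega>. pw p (X j \<omega>) \<partial>M)"
  (is "?l \<le> ?r \<longleftrightarrow> _")
proof -
  have "?l \<le> ?r \<longleftrightarrow> epowr ?l p \<le> epowr ?r p" using p by (simp add: epowr_le_iff)
  then show ?thesis using p by (simp add: epowr_mult epowr_max epowr_epowr epowr_eLp_norm)
qed

text \<open>The law of \<open>c V\<close> kept with probability \<open>d\<close> and replaced by 0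
  otherwise: the mixture whose \<open>R\<close> takes only the values \<open>c\<close> and 0. All
  extremal summands are of this kind.\<close>

definition bern_law :: "real \<Rightarrow> real \<Rightarrow> real measure \<Rightarrow> real measure" where
  "bern_law d c \<nu> = distr (measure_pmf (bernoulli_pmf d) \<Otimes>\<^sub>M \<nu>) borel (\<lambda>(b, w). if b then c * w else 0)"

context
  fixes \<nu> :: "real measure" and d :: real
  assumes \<nu>: "law \<nu>" and d: "0 \<le> d" "d \<le> 1"
begin

lemma measurable_bern: "(\<lambda>(b, w). if b then c * w else 0) \<in> borel_measurable (measure_pmf (bernoulli_pmf d) \<Otimes>\<^sub>M \<nu>)"
proof -
  have "(\<lambda>(b, w). if b then c * w else 0) \<in> borel_measurable (count_space UNIV \<Otimes>\<^sub>M borel)"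
    by measurable
  then show ?thesis
    by (subst measurable_cong_sets[OF sets_pair_measure_cong[OF sets_measure_pmf_count_space conjunct2[OF \<nu>]] refl])
qed

lemma law_bern: "law (bern_law d c \<nu>)"
proof -
  interpret \<nu>: prob_space \<nu> using \<nu> by simp
  interpret pair_prob_space "measure_pmf (bernoulli_pmf d)" \<nu> ..
  show ?thesis unfolding bern_law_def using measurable_bern by (auto intro: prob_space_distr)
qed

lemma nn_integral_bern:
  assumes g: "g \<in> borel_measurable borel"
  shows "(\<integral>\<^sup>+x. g x \<partial>bern_law d c \<nu>) = ennreal (1 - d) * g 0 + ennreal d * (\<integral>\<^sup>+w. g (c * w) \<partial>\<nu>)"
proof -
  interpret \<nu>: prob_space \<nu> using \<nu> by simp
  interpret pair_prob_space "measure_pmf (bernoulli_pmf d)" \<nu> ..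
  have "(\<integral>\<^sup>+x. g x \<partial>bern_law d c \<nu>) = (\<integral>\<^sup>+z. g ((\<lambda>(b, w). if b then c * w else 0) z) \<partial>(measure_pmf (bernoulli_pmf d) \<Otimes>\<^sub>M \<nu>))"
    unfolding bern_law_def using measurable_bern g by (subst nn_integral_distr) auto
  also have "\<dots> = (\<integral>\<^sup>+b. \<integral>\<^sup>+w. g (if b then c * w else 0) \<partial>\<nu> \<partial>measure_pmf (bernoulli_pmf d))"
    using measurable_compose[OF measurable_bern g] by (subst \<nu>.nn_integral_fst[symmetric]) auto
  also have "\<dots> = ennreal (1 - d) * g 0 + ennreal d * (\<integral>\<^sup>+w. g (c * w) \<partial>\<nu>)"
    using d by (subst nn_integral_measure_pmf_support[of UNIV])
      (auto simp: UNIV_bool \<nu>.emeasure_space_1 mult.commute add.commute)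
  finally show ?thesis .
qed

lemma shift_op_bern:
  assumes g: "g \<in> borel_measurable borel"
  shows "shift_op (bern_law d c \<nu>) g y = ennreal (1 - d) * g y + ennreal d * shift_op (scaled c \<nu>) g y"
proof -
  have [measurable]: "g \<in> borel_measurable borel" by fact
  show ?thesis
    unfolding shift_op_scaled[OF \<nu> g] unfolding shift_op_def by (subst nn_integral_bern) auto
qed

end

lemma V_mixture_bern:
  assumes N: "prob_space N" and V: "V \<in> borel_measurable N" and d: "0 \<le> d" "d \<le> 1" and c: "c \<ge> 0"
    and X: "X \<in> borel_measurable M" "distr M borel X = bern_law d c (distr N borel V)"
  shows "V_mixture N V M X"
  unfolding V_mixture_def
proof (intro conjI X)
  define \<nu> where "\<nu> = distr N borel V"
  have \<nu>: "law \<nu>" unfolding \<nu>_def using prob_space.prob_space_distr[OF N V] by simp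
  define A where "A = distr (measure_pmf (bernoulli_pmf d)) borel (\<lambda>b. if b then c else 0 :: real)"
  have A: "prob_space A" unfolding A_def by (rule measure_pmf.prob_space_distr) simp
  have sA: "sets A = sets borel" by (simp add: A_def)
  have s\<nu>: "sets \<nu> = sets borel" using \<nu> by simp
  interpret A: prob_space A by (rule A)
  interpret \<nu>: prob_space \<nu> using \<nu> by simp
  interpret P: pair_prob_space A \<nu> ..
  \<comment> \<open>The absolute value is taken because a \<open>V_mixture\<close> demands
    \<open>0 \<le> R\<close> at every sample point, while on the product space the first coordinate
    is nonnegative only almost surely.\<close>
  have m1: "(\<lambda>z. \<bar>fst z\<bar>) \<in> borel_measurable (A \<Otimes>\<^sub>M \<nu>)" and m2: "snd \<in> borel_measurable (A \<Otimes>\<^sub>M \<nu>)"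
    by (subst measurable_cong_sets[OF sets_pair_measure_cong[OF sA s\<nu>] refl], measurable)+
  have ma: "abs \<in> borel_measurable A" using sA by (simp add: measurable_cong_sets[OF sA refl])
  have mi: "(\<lambda>x. x) \<in> borel_measurable \<nu>" by (simp add: measurable_cong_sets[OF s\<nu> refl])
  have d1: "distr (A \<Otimes>\<^sub>M \<nu>) borel (\<lambda>z. \<bar>fst z\<bar>) = distr A borel abs"
  proof -
    have "distr A borel abs = distr (distr (A \<Otimes>\<^sub>M \<nu>) A fst) borel abs" by (simp add: \<nu>.distr_pair_fst)
    also have "\<dots> = distr (A \<Otimes>\<^sub>M \<nu>) borel (\<lambda>z. \<bar>fst z\<bar>)"
      using ma by (subst distr_distr) (auto simp: comp_def)
    finally show ?thesis by simp
  qed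
  have d2: "distr (A \<Otimes>\<^sub>M \<nu>) borel snd = \<nu>"
  proof -
    have "distr (A \<Otimes>\<^sub>M \<nu>) borel snd = distr (distr (\<nu> \<Otimes>\<^sub>M A) (A \<Otimes>\<^sub>M \<nu>) (\<lambda>(x, y). (y, x))) borel snd"
      using P.distr_pair_swap by simp
    also have "\<dots> = distr (\<nu> \<Otimes>\<^sub>M A) borel fst"
      using m2 by (subst distr_distr) (auto simp: comp_def split_def)
    also have "\<dots> = distr (\<nu> \<Otimes>\<^sub>M A) \<nu> fst" by (rule distr_cong) (auto simp: s\<nu>)
    finally show ?thesis by (simp add: A.distr_pair_fst)
  qed
  show "\<exists>(S :: (real \<times> real) measure) R W. prob_space S \<and> prob_space.indep_var S borel R borel W \<and>
        (\<forall>\<omega>\<in>space S. 0 \<le> R \<omega>) \<and> distr S borel W = distr N borel V \<and>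
        distr M borel X = distr S borel (\<lambda>\<omega>. R \<omega> * W \<omega>)"
  proof (rule exI[of _ "A \<Otimes>\<^sub>M \<nu>"], rule exI[of _ "\<lambda>z. \<bar>fst z\<bar>"], rule exI[of _ snd], intro conjI)
    show "prob_space (A \<Otimes>\<^sub>M \<nu>)" by (rule P.prob_space_axioms)
    show "distr (A \<Otimes>\<^sub>M \<nu>) borel snd = distr N borel V" using d2 by (simp add: \<nu>_def)
    have "distr A borel abs \<Otimes>\<^sub>M distr \<nu> borel (\<lambda>x. x) = distr (A \<Otimes>\<^sub>M \<nu>) (borel \<Otimes>\<^sub>M borel) (\<lambda>(x, y). (\<bar>x\<bar>, y))"
      by (rule pair_measure_distr[OF ma mi]) (rule prob_space_imp_sigma_finite, rule \<nu>.prob_space_distr[OF mi])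
    moreover have "distr \<nu> borel (\<lambda>x. x) = \<nu>" by (rule distr_id2) (simp add: s\<nu>)
    ultimately show "prob_space.indep_var (A \<Otimes>\<^sub>M \<nu>) borel (\<lambda>z. \<bar>fst z\<bar>) borel snd"
      unfolding P.indep_var_distribution_eq using m1 m2 by (simp add: d1 d2 split_def)
    show "distr M borel X = distr (A \<Otimes>\<^sub>M \<nu>) borel (\<lambda>\<omega>. \<bar>fst \<omega>\<bar> * snd \<omega>)"
    proof -
      have "A \<Otimes>\<^sub>M \<nu> = distr (measure_pmf (bernoulli_pmf d) \<Otimes>\<^sub>M \<nu>) (borel \<Otimes>\<^sub>M borel) (\<lambda>(b, w). (if b then c else 0, w))"
        using pair_measure_distr[of "\<lambda>b. if b then c else 0" "measure_pmf (bernoulli_pmf d)" borel "\<lambda>x. x" \<nu> borel]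
        using \<nu>.sigma_finite_measure_axioms mi
        unfolding \<open>distr \<nu> borel (\<lambda>x. x) = \<nu>\<close> A_def by simp
      then have "distr (A \<Otimes>\<^sub>M \<nu>) borel (\<lambda>\<omega>. \<bar>fst \<omega>\<bar> * snd \<omega>) =
        distr (distr (measure_pmf (bernoulli_pmf d) \<Otimes>\<^sub>M \<nu>) (borel \<Otimes>\<^sub>M borel) (\<lambda>(b, w). (if b then c else 0, w))) borel (\<lambda>\<omega>. \<bar>fst \<omega>\<bar> * snd \<omega>)"
        by simp
      also have "\<dots> = distr (measure_pmf (bernoulli_pmf d) \<Otimes>\<^sub>M \<nu>) borel ((\<lambda>\<omega>. \<bar>fst \<omega>\<bar> * snd \<omega>) \<circ> (\<lambda>(b, w). (if b then c else 0, w)))"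
      proof (rule distr_distr)
        have "(\<lambda>(b, w). (if b then c else 0, w)) \<in> (count_space UNIV \<Otimes>\<^sub>M borel) \<rightarrow>\<^sub>M (borel \<Otimes>\<^sub>M borel)"
          by measurable
        then show "(\<lambda>(b, w). (if b then c else 0, w)) \<in> (measure_pmf (bernoulli_pmf d) \<Otimes>\<^sub>M \<nu>) \<rightarrow>\<^sub>M (borel \<Otimes>\<^sub>M borel)"
          by (subst measurable_cong_sets[OF sets_pair_measure_cong[OF sets_measure_pmf_count_space s\<nu>] refl])
      qed measurable
      also have "\<dots> = bern_law d c \<nu>"
        unfolding bern_law_def using c by (intro distr_cong) auto
      finally show ?thesis using X(2) by (simp add: \<nu>_def)
    qed
  qed auto
qed

lemma sequence_with_laws:
  fixes \<mu> :: "nat \<Rightarrow> real measure"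
  assumes \<mu>: "\<And>j. law (\<mu> j)"
  obtains M :: "(nat \<Rightarrow> real) measure" where "prob_space M"
    "prob_space.indep_vars M (\<lambda>_. borel) (\<lambda>j \<omega>. \<omega> j) UNIV"
    "\<And>j. (\<lambda>\<omega>. \<omega> j) \<in> borel_measurable M" "\<And>j. distr M borel (\<lambda>\<omega>. \<omega> j) = \<mu> j"
proof -
  define M where "M = PiM UNIV \<mu>"
  have M: "prob_space M" unfolding M_def using \<mu> by (intro prob_space_PiM) simp
  interpret prob_space M by (rule M)
  have sM: "sets M = sets (PiM UNIV (\<lambda>_. borel))"
    unfolding M_def using \<mu> by (intro sets_PiM_cong) auto
  have rv: "(\<lambda>\<omega>. \<omega> j) \<in> borel_measurable M" for j
    by (subst measurable_cong_sets[OF sM refl]) measurable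
  have dist: "distr M borel (\<lambda>\<omega>. \<omega> j) = \<mu> j" for j
  proof -
    have "distr M borel (\<lambda>\<omega>. \<omega> j) = distr M (\<mu> j) (\<lambda>\<omega>. \<omega> j)" using \<mu> by (intro distr_cong) auto
    also have "\<dots> = \<mu> j" unfolding M_def using \<mu> by (intro distr_PiM_component) auto
    finally show ?thesis .
  qed
  have "distr M (PiM UNIV (\<lambda>_. borel)) (\<lambda>x. \<lambda>i\<in>UNIV. x i) = M"
    by (simp add: distr_id2 sM restrict_UNIV)
  then have "indep_vars (\<lambda>_. borel) (\<lambda>j \<omega>. \<omega> j) UNIV"
    by (subst indep_vars_iff_distr_eq_PiM) (simp_all add: rv dist, simp add: M_def)
  then show thesis using that M rv dist by blast
qed

text \<open>Independent coordinates of a product measure on sequences serve as test family.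
  Retention probability and size may vary with the index, because the Gaussian case combines many
  small summands with a rare large one.\<close>

lemma admissible_const_lower:
  assumes adm: "admissible_const TYPE(nat \<Rightarrow> real) p N V C" and p: "p > 0"
    and N: "prob_space N" and V: "V \<in> borel_measurable N"
    and d: "\<And>j. 0 \<le> d j" "\<And>j. d j \<le> 1" and c: "\<And>j. c j \<ge> 0" and n: "n \<ge> 1"
    and v: "(\<integral>\<^sup>+x. ennreal (x\<^sup>2) \<partial>distr N borel V) = ennreal v2" "v2 > 0" "(\<integral>\<^sup>+x. pw p x \<partial>distr N borel V) = ennreal vp" "vp > 0"
  shows "shift_ops (\<lambda>j. bern_law (d j) (c j) (distr N borel V)) n (pw p) 0 \<le> epowr C p *
      ennreal (max ((\<Sum>j=1..n. d j * ((c j)\<^sup>2 * v2)) powr (p / 2)) (\<Sum>j=1..n. d j * (c j powr p * vp)))"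
proof -
  define \<nu> where "\<nu> = distr N borel V"
  have \<nu>: "law \<nu>" unfolding \<nu>_def using prob_space.prob_space_distr[OF N V] by simp
  let ?\<mu> = "\<lambda>j. bern_law (d j) (c j) \<nu>"
  have law: "law (?\<mu> j)" for j by (rule law_bern[OF \<nu> d])
  obtain M :: "(nat \<Rightarrow> real) measure" where M: "prob_space M"
    "prob_space.indep_vars M (\<lambda>_. borel) (\<lambda>j \<omega>. \<omega> j) UNIV"
    "\<And>j. (\<lambda>\<omega>. \<omega> j) \<in> borel_measurable M" "\<And>j. distr M borel (\<lambda>\<omega>. \<omega> j) = ?\<mu> j"
    using sequence_with_laws[of ?\<mu>] law by metis
  interpret prob_space M by fact
  have ind: "indep_vars (\<lambda>_. borel) (\<lambda>j \<omega>. \<omega> j) {1..}"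
    by (rule indep_vars_subset[OF M(2)]) auto
  have mix: "\<forall>j\<ge>1. V_mixture N V M (\<lambda>\<omega>. \<omega> j)"
    using V_mixture_bern[OF N V d c M(3)] M(4) by (simp add: \<nu>_def)
  have int: "(\<integral>\<^sup>+\<omega>. g (\<omega> j) \<partial>M) = ennreal (1 - d j) * g 0 + ennreal (d j) * (\<integral>\<^sup>+w. g (c j * w) \<partial>\<nu>)"
    if "g \<in> borel_measurable borel" for g j
  proof -
    have "(\<integral>\<^sup>+\<omega>. g (\<omega> j) \<partial>M) = (\<integral>\<^sup>+x. g x \<partial>distr M borel (\<lambda>\<omega>. \<omega> j))"
      using that M(3)[of j] by (subst nn_integral_distr) auto
    then show ?thesis using nn_integral_bern[OF \<nu> d that] by (simp add: M(4))
  qed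
  have i2: "(\<integral>\<^sup>+\<omega>. ennreal ((\<omega> j)\<^sup>2) \<partial>M) = ennreal (d j * ((c j)\<^sup>2 * v2))" for j
  proof -
    have "(\<integral>\<^sup>+w. ennreal ((c j * w)\<^sup>2) \<partial>\<nu>) = (\<integral>\<^sup>+w. ennreal ((c j)\<^sup>2) * ennreal (w\<^sup>2) \<partial>\<nu>)"
      by (simp add: power_mult_distrib ennreal_mult')
    also have "\<dots> = ennreal ((c j)\<^sup>2) * ennreal v2"
      unfolding v(1)[symmetric] \<nu>_def[symmetric] by (intro nn_integral_cmult measurable_law_borel[OF \<nu>]) measurable
    finally show ?thesis using d by (subst int) (auto simp: ennreal_mult')
  qed
  have ip: "(\<integral>\<^sup>+\<omega>. pw p (\<omega> j) \<partial>M) = ennreal (d j * (c j powr p * vp))" for j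
  proof -
    have "(\<integral>\<^sup>+w. pw p (c j * w) \<partial>\<nu>) = (\<integral>\<^sup>+w. ennreal (c j powr p) * pw p w \<partial>\<nu>)"
      using c by (simp add: abs_mult powr_mult ennreal_mult')
    also have "\<dots> = ennreal (c j powr p) * ennreal vp"
      unfolding v(3)[symmetric] \<nu>_def[symmetric] by (intro nn_integral_cmult measurable_law_borel[OF \<nu>]) measurable
    finally show ?thesis using d by (subst int) (auto simp: ennreal_mult')
  qed
  have "(\<integral>\<^sup>+\<omega>. pw p (\<Sum>j=1..n. \<omega> j) \<partial>M) \<le> epowr C p *
        max (epowr (\<Sum>j=1..n. \<integral>\<^sup>+\<omega>. ennreal ((\<omega> j)\<^sup>2) \<partial>M) (p / 2)) (\<Sum>j=1..n. \<integral>\<^sup>+\<omega>. pw p (\<omega> j) \<partial>M)"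
    using adm[unfolded admissible_const_def, rule_format, OF M(1) ind _ n] mix
    unfolding moment_inequality_iff[OF p] by blast
  also have "max (epowr (\<Sum>j=1..n. \<integral>\<^sup>+\<omega>. ennreal ((\<omega> j)\<^sup>2) \<partial>M) (p / 2)) (\<Sum>j=1..n. \<integral>\<^sup>+\<omega>. pw p (\<omega> j) \<partial>M) =
     ennreal (max ((\<Sum>j=1..n. d j * ((c j)\<^sup>2 * v2)) powr (p / 2)) (\<Sum>j=1..n. d j * (c j powr p * vp)))"
    unfolding i2 ip using d v
    by (simp add: sum_ennreal epowr_ennreal sum_nonneg ennreal_max_0 max_def ennreal_le_iff)
  also have "(\<integral>\<^sup>+\<omega>. pw p (\<Sum>j=1..n. \<omega> j) \<partial>M) = shift_ops ?\<mu> n (pw p) 0"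
    using nn_integral_indep_sum[of "\<lambda>j \<omega>. \<omega> j" id "pw p" n] ind by (simp add: M(4))
  finally show ?thesis by (simp add: \<nu>_def)
qed


section \<open>The Poisson limit of thinned summands\<close>

lemma shift_ops_const: "shift_ops (\<lambda>_. \<mu>) n f = (shift_op \<mu> ^^ n) f"
  by (induction n arbitrary: f) (simp_all add: funpow_swap1)

lemma funpow_op_cong:
  assumes A: "pos_op A" and eq: "\<And>g. g \<in> borel_measurable borel \<Longrightarrow> A g = B g" and f: "f \<in> borel_measurable borel"
  shows "(A ^^ k) f = (B ^^ k) f"
proof (induction k)
  case (Suc k)
  have "(A ^^ Suc k) f = B ((A ^^ k) f)" using eq[OF pos_op_measurable[OF pos_op_funpow[OF A] f]] by simp
  then show ?case using Suc by simp
qed simp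

lemma binomial_tendsto_Poisson:
  fixes l :: real
  shows "(\<lambda>n. real (n choose k) * (l / n) ^ k * (1 - l / n) ^ (n - k)) \<longlonglongrightarrow> exp (- l) * l ^ k / fact k"
proof -
  have 1: "(\<lambda>n. \<Prod>i=0..<k. (1 - real i / real n) / real (k - i)) \<longlonglongrightarrow> (\<Prod>i=0..<k. (1 - 0) / real (k - i))"
    by (intro tendsto_intros lim_const_over_n) auto
  have 2: "(\<lambda>n. (1 + (- l) / real n) ^ n) \<longlonglongrightarrow> exp (- l)" by (rule tendsto_exp_limit_sequentially)
  have 3: "(\<lambda>n. (1 - l / real n) ^ k) \<longlonglongrightarrow> (1 - 0) ^ k"
    by (intro tendsto_intros lim_const_over_n)
  have fact: "(\<Prod>i=0..<k. (1 - 0) / real (k - i)) = 1 / fact k"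
    by (simp add: prod_dividef fact_prod_rev)
  have "(\<lambda>n. (\<Prod>i=0..<k. (1 - real i / real n) / real (k - i)) * l ^ k * ((1 + (- l) / real n) ^ n / (1 - l / real n) ^ k))
      \<longlonglongrightarrow> 1 / fact k * l ^ k * (exp (- l) / (1 - 0) ^ k)"
    using 1 2 3 unfolding fact by (intro tendsto_intros) auto
  then have lim: "(\<lambda>n. (\<Prod>i=0..<k. (1 - real i / real n) / real (k - i)) * l ^ k * ((1 + (- l) / real n) ^ n / (1 - l / real n) ^ k))
      \<longlonglongrightarrow> exp (- l) * l ^ k / fact k" by (simp add: field_simps)
  show ?thesis
  proof (rule Lim_transform_eventually[OF lim])
    have "eventually (\<lambda>n. real n > \<bar>l\<bar>) sequentially"
      using filterlim_real_sequentially by (simp add: filterlim_at_top_dense)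
    then show "\<forall>\<^sub>F n in sequentially. (\<Prod>i=0..<k. (1 - real i / real n) / real (k - i)) * l ^ k * ((1 + (- l) / real n) ^ n / (1 - l / real n) ^ k)
      = real (n choose k) * (l / n) ^ k * (1 - l / n) ^ (n - k)"
      using eventually_ge_at_top[of k] eventually_gt_at_top[of 0]
    proof eventually_elim
      case (elim n)
      have b: "real (n choose k) = (\<Prod>i=0..<k. (1 - real i / real n) / real (k - i)) * real n ^ k"
      proof -
        have "real (n choose k) = (\<Prod>i=0..<k. real (n - i) / real (k - i))"
          using elim by (subst binomial_altdef_of_nat) auto
        also have "\<dots> = (\<Prod>i=0..<k. (1 - real i / real n) / real (k - i) * real n)"
          using elim by (intro prod.cong) (auto simp: field_simps)
        finally show ?thesis by (simp only: prod.distrib prod_constant card_atLeastLessThan diff_zero)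
      qed
      have "1 - l / real n \<noteq> 0" using elim by (auto simp: field_simps)
      then have "(1 + (- l) / real n) ^ n / (1 - l / real n) ^ k = (1 - l / real n) ^ (n - k)"
        using elim by (simp add: power_diff)
      then show ?case using elim unfolding b by (simp add: power_divide)
    qed
  qed
qed

text \<open>The moment of \<open>n\<close> thinned summands is a binomial average of the iterates.
  Its terms are nonnegative and converge to those of the Poisson average, so every finite partial
  sum of the limit is at most \<open>K\<close>, and no control of the tails is needed.\<close>

lemma cpois_le_const:
  assumes \<nu>: "law \<nu>" and p: "p \<ge> 1" and fin: "(\<integral>\<^sup>+x. pw p x \<partial>\<nu>) < \<top>" and l: "l > 0"
    and le: "\<And>n. real n > l \<Longrightarrow> n \<ge> 1 \<Longrightarrow> shift_ops (\<lambda>_. bern_law (l / real n) a \<nu>) n (pw p) 0 \<le> K"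
  shows "cpois l a \<nu> (pw p) 0 \<le> K"
proof -
  let ?T = "shift_op (scaled a \<nu>)"
  have T: "pos_op ?T" by (intro pos_op_shift law_scaled \<nu>)
  define t where "t k = (?T ^^ k) (pw p) 0" for k
  have cp: "cpois l a \<nu> (pw p) 0 = (\<Sum>k. ennreal (exp (- l) * l ^ k / fact k) * t k)"
  proof -
    have "ennreal (exp (- l)) * (ennreal (1 / fact k) * ennreal l ^ k * t k) = ennreal (exp (- l) * l ^ k / fact k) * t k" for k
      using l by (simp add: ennreal_power flip: mult.assoc ennreal_mult')
    then show ?thesis
      by (simp add: cpois_def exp_op_scaled_op[OF T measurable_pw] t_def flip: ennreal_suminf_cmult)
  qed
  \<comment> \<open>Multiplication by a constant in \<open>ennreal\<close> is continuous when the
    constant is finite. Finiteness of each iterate is read off from that of the whole series, in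
    which it has a positive weight.\<close>
  have t: "t k < \<top>" for k
  proof -
    have "ennreal (exp (- l) * l ^ k / fact k) * t k \<le> (\<Sum>k. ennreal (exp (- l) * l ^ k / fact k) * t k)"
      using sum_le_suminf[of "\<lambda>k. ennreal (exp (- l) * l ^ k / fact k) * t k" "{k}"] by auto
    also have "\<dots> < \<top>" unfolding cp[symmetric] using cpois_finite[OF \<nu> p fin] l by simp
    finally have "ennreal (exp (- l) * l ^ k / fact k) * t k < \<top>" .
    moreover have "0 < exp (- l) * l ^ k / fact k" using l by simp
    ultimately show ?thesis by (auto simp: ennreal_mult_less_top ennreal_eq_0_iff)
  qed
  have "(\<Sum>k<m. ennreal (exp (- l) * l ^ k / fact k) * t k) \<le> K" for m
  proof (rule LIMSEQ_le_const2)
    have "(\<lambda>n. ennreal (real (n choose k) * (l / n) ^ k * (1 - l / n) ^ (n - k))) \<longlonglongrightarrow> ennreal (exp (- l) * l ^ k / fact k)" for k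
      by (intro tendsto_ennrealI binomial_tendsto_Poisson)
    then show "(\<lambda>n. \<Sum>k<m. t k * ennreal (real (n choose k) * (l / n) ^ k * (1 - l / n) ^ (n - k))) \<longlonglongrightarrow> (\<Sum>k<m. ennreal (exp (- l) * l ^ k / fact k) * t k)"
      unfolding mult.commute[of _ "t _"] using t by (intro tendsto_sum ennreal_tendsto_cmult) auto
    obtain n0 where n0: "real n0 > l" using reals_Archimedean2 by blast
    show "\<exists>n0. \<forall>n\<ge>n0. (\<Sum>k<m. t k * ennreal (real (n choose k) * (l / n) ^ k * (1 - l / n) ^ (n - k))) \<le> K"
    \<comment> \<open>\<open>n0\<close> ensures \<open>l < n\<close>, so that \<open>l / n\<close>
      is a probability, and \<open>m\<close> ensures that the first \<open>m\<close> terms occur in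
      the binomial sum.\<close>
    proof (intro exI[of _ "n0 + m + 1"] allI impI)
      fix n assume n: "n0 + m + 1 \<le> n"
      have nl: "real n > l" "n \<ge> 1" "real n > 0" using n n0 l by auto
      define d where "d = l / real n"
      have d: "0 \<le> d" "d \<le> 1" using nl l by (auto simp: d_def)
      let ?A = "\<lambda>f y. ennreal d * ?T f y" and ?B = "scale_op (ennreal (1 - d))"
      have A: "pos_op ?A" by (rule pos_op_scaled_op[OF T])
      have "shift_ops (\<lambda>_. bern_law d a \<nu>) n (pw p) 0 = (shift_op (bern_law d a \<nu>) ^^ n) (pw p) 0"
        by (simp add: shift_ops_const)
      also have "\<dots> = (add_op ?A ?B ^^ n) (pw p) 0"
        by (subst funpow_op_cong[where B = "add_op ?A ?B"])
           (auto simp: fun_eq_iff shift_op_bern[OF \<nu> d] add.commute intro!: pos_op_shift law_bern[OF \<nu> d])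
      also have "\<dots> = (\<Sum>k\<le>n. of_nat (n choose k) * (?A ^^ k) ((?B ^^ (n - k)) (pw p)) 0)"
        by (intro funpow_add_op A pos_op_scale commute_op_sym[OF commute_op_scale] measurable_pw)
      also have "\<dots> = (\<Sum>k\<le>n. t k * ennreal (real (n choose k) * d ^ k * (1 - d) ^ (n - k)))"
      proof (rule sum.cong[OF refl])
        fix k
        have "(?B ^^ (n - k)) (pw p) = (\<lambda>y. ennreal (1 - d) ^ (n - k) * pw p y)" by (intro ext funpow_scale_op)
        then have "(?A ^^ k) ((?B ^^ (n - k)) (pw p)) 0 = ennreal (1 - d) ^ (n - k) * (ennreal d ^ k * t k)"
          by (simp add: pos_op_cmult[OF pos_op_funpow[OF A]] measurable_pw funpow_scaled_op[OF T measurable_pw] t_def)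
        then show "of_nat (n choose k) * (?A ^^ k) ((?B ^^ (n - k)) (pw p)) 0 = t k * ennreal (real (n choose k) * d ^ k * (1 - d) ^ (n - k))"
          using d by (simp add: ennreal_mult' ennreal_power ennreal_of_nat_eq_real_of_nat mult_ac)
      qed
      finally have "(\<Sum>k\<le>n. t k * ennreal (real (n choose k) * d ^ k * (1 - d) ^ (n - k))) \<le> K"
        using le[of n] nl by (simp add: d_def)
      moreover have "(\<Sum>k<m. t k * ennreal (real (n choose k) * d ^ k * (1 - d) ^ (n - k))) \<le>
          (\<Sum>k\<le>n. t k * ennreal (real (n choose k) * d ^ k * (1 - d) ^ (n - k)))"
        using n by (intro sum_mono2) auto
      ultimately show "(\<Sum>k<m. t k * ennreal (real (n choose k) * (l / n) ^ k * (1 - l / n) ^ (n - k))) \<le> K"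
        unfolding d_def by (rule order.trans[rotated])
    qed
  qed
  then show ?thesis unfolding cp by (intro suminf_le_const) auto
qed

text \<open>Skorohod's representation makes the convergence pointwise, and Fatou's lemma gives the
  one-sided estimate, even for unbounded \<open>f\<close>.\<close>

lemma weak_conv_nn_integral_liminf:
  fixes f :: "real \<Rightarrow> real"
  assumes \<mu>: "\<And>n. real_distribution (\<mu> n)" and M: "real_distribution M" and conv: "weak_conv_m \<mu> M"
    and f: "continuous_on UNIV f"
  shows "(\<integral>\<^sup>+x. ennreal (f x) \<partial>M) \<le> liminf (\<lambda>n. \<integral>\<^sup>+x. ennreal (f x) \<partial>\<mu> n)"
proof -
  obtain \<Omega> :: "real measure" and Yn Y where Y: "prob_space \<Omega>" "\<And>n. Yn n \<in> measurable \<Omega> borel"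
    "\<And>n. distr \<Omega> borel (Yn n) = \<mu> n" "Y \<in> measurable \<Omega> lborel" "distr \<Omega> borel Y = M"
    "\<And>x. x \<in> space \<Omega> \<Longrightarrow> (\<lambda>n. Yn n x) \<longlonglongrightarrow> Y x"
    using Skorohod[OF \<mu> M conv] by metis
  have [measurable]: "Yn n \<in> borel_measurable \<Omega>" "Y \<in> borel_measurable \<Omega>" for n using Y(2,4) by auto
  have [measurable]: "f \<in> borel_measurable borel" using f by (rule borel_measurable_continuous_onI)
  have "(\<integral>\<^sup>+x. ennreal (f x) \<partial>M) = (\<integral>\<^sup>+\<omega>. ennreal (f (Y \<omega>)) \<partial>\<Omega>)"
    unfolding Y(5)[symmetric] by (subst nn_integral_distr) auto
  also have "\<dots> = (\<integral>\<^sup>+\<omega>. liminf (\<lambda>n. ennreal (f (Yn n \<omega>))) \<partial>\<Omega>)"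
  proof (rule nn_integral_cong)
    fix \<omega> assume "\<omega> \<in> space \<Omega>"
    then have "(\<lambda>n. ennreal (f (Yn n \<omega>))) \<longlonglongrightarrow> ennreal (f (Y \<omega>))"
      using f Y(6) by (intro tendsto_ennrealI isCont_tendsto_compose[where g = f]) (auto simp: continuous_on_eq_continuous_at)
    then show "ennreal (f (Y \<omega>)) = liminf (\<lambda>n. ennreal (f (Yn n \<omega>)))"
      by (simp add: lim_imp_Liminf)
  qed
  also have "\<dots> \<le> liminf (\<lambda>n. \<integral>\<^sup>+\<omega>. ennreal (f (Yn n \<omega>)) \<partial>\<Omega>)"
    by (rule nn_integral_liminf) auto
  also have "(\<lambda>n. \<integral>\<^sup>+\<omega>. ennreal (f (Yn n \<omega>)) \<partial>\<Omega>) = (\<lambda>n. \<integral>\<^sup>+x. ennreal (f x) \<partial>\<mu> n)"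
    unfolding Y(3)[symmetric] by (subst nn_integral_distr) auto
  finally show ?thesis .
qed

text \<open>Reflection gives \<open>m = - m\<close> for the integral \<open>m\<close>; the default
  value 0 of a divergent Bochner integral is covered by the same computation.\<close>

lemma sym_law_mean:
  assumes \<nu>: "sym_law \<nu>"
  shows "(\<integral>x. x \<partial>\<nu>) = 0"
proof -
  have sets: "sets \<nu> = sets borel" using \<nu> by (simp add: sym_law_def)
  have m: "uminus \<in> borel_measurable \<nu>" "(\<lambda>x. x) \<in> borel_measurable \<nu>"
    by (simp_all add: measurable_cong_sets[OF sets refl])
  have "distr \<nu> borel uminus = \<nu>"
  proof (rule measure_eqI)
    fix A assume "A \<in> sets (distr \<nu> borel uminus)"
    then have A: "A \<in> sets borel" by simp
    then have ind: "indicator A \<in> borel_measurable borel" by simp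
    have "emeasure (distr \<nu> borel uminus) A = (\<integral>\<^sup>+x. indicator A x \<partial>distr \<nu> borel uminus)"
      using A by simp
    also have "\<dots> = (\<integral>\<^sup>+x. indicator A (- x) \<partial>\<nu>)" using m A by (subst nn_integral_distr) auto
    also have "\<dots> = (\<integral>\<^sup>+x. indicator A x \<partial>\<nu>)" using \<nu> ind unfolding sym_law_def by blast
    finally show "emeasure (distr \<nu> borel uminus) A = emeasure \<nu> A" using A sets by simp
  qed (simp add: sets)
  then have "(\<integral>x. x \<partial>\<nu>) = (\<integral>x. x \<partial>distr \<nu> borel uminus)" by simp
  also have "\<dots> = (\<integral>x. - x \<partial>\<nu>)" using m by (subst integral_distr) auto
  finally show ?thesis by simp
qed

lemma gauss_le_liminf:
  assumes \<nu>: "sym_law \<nu>" and p: "p > 0" and v: "(\<integral>\<^sup>+x. ennreal (x\<^sup>2) \<partial>\<nu>) = ennreal v2" "v2 > 0"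
  shows "shift_op (gauss 1) (pw p) 0 \<le> liminf (\<lambda>n. shift_ops (\<lambda>_. scaled (1 / sqrt (real n * v2)) \<nu>) n (pw p) 0)"
proof -
  have law: "law \<nu>" using \<nu> by (simp add: sym_law_def)
  obtain M :: "(nat \<Rightarrow> real) measure" where M: "prob_space M"
    "prob_space.indep_vars M (\<lambda>_. borel) (\<lambda>j \<omega>. \<omega> j) UNIV"
    "\<And>j. (\<lambda>\<omega>. \<omega> j) \<in> borel_measurable M" "\<And>j. distr M borel (\<lambda>\<omega>. \<omega> j) = \<nu>"
    using sequence_with_laws[of "\<lambda>_. \<nu>"] law by metis
  interpret prob_space M by fact
  note [measurable] = M(3)
  have mean: "expectation (\<lambda>\<omega>. \<omega> j) = 0" for j
    using integral_distr[OF M(3)[of j], of "\<lambda>x. x"] sym_law_mean[OF \<nu>] by (simp add: M(4))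
  have nn: "(\<integral>\<^sup>+\<omega>. ennreal ((\<omega> j)\<^sup>2) \<partial>M) = ennreal v2" for j
  proof -
    have "(\<integral>\<^sup>+\<omega>. ennreal ((\<omega> j)\<^sup>2) \<partial>M) = (\<integral>\<^sup>+x. ennreal (x\<^sup>2) \<partial>distr M borel (\<lambda>\<omega>. \<omega> j))"
      by (subst nn_integral_distr) auto
    then show ?thesis by (simp add: M(4) v(1))
  qed
  have int: "integrable M (\<lambda>\<omega>. (\<omega> j)\<^sup>2)" for j by (rule integrableI_nonneg) (auto simp: nn)
  have var: "variance (\<lambda>\<omega>. \<omega> j) = (sqrt v2)\<^sup>2" for j
    using integral_eq_nn_integral[of "\<lambda>\<omega>. (\<omega> j)\<^sup>2" M] nn[of j] v(2) by (simp add: mean)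
  \<comment> \<open>The subtracted 0 is the mean and \<open>(sqrt v2)^2\<close> the variance, in the
    shape required by the central limit theorem.\<close>
  define S where "S n \<omega> = (\<Sum>i<n. \<omega> i - 0) / sqrt (real n * (sqrt v2)\<^sup>2)" for n and \<omega> :: "nat \<Rightarrow> real"
  have Sm[measurable]: "S n \<in> borel_measurable M" for n unfolding S_def by measurable
  have "weak_conv_m (\<lambda>n. distr M borel (S n)) std_normal_distribution"
    unfolding S_def by (rule central_limit_theorem[OF M(2) mean _ int var M(4)]) (use v in simp)
  then have "(\<integral>\<^sup>+x. ennreal (\<bar>x\<bar> powr p) \<partial>std_normal_distribution) \<le> liminf (\<lambda>n. \<integral>\<^sup>+x. ennreal (\<bar>x\<bar> powr p) \<partial>distr M borel (S n))"
    using p by (intro weak_conv_nn_integral_liminf)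
      (auto intro!: real_distribution_distr real_dist_normal_dist continuous_intros continuous_on_powr')
  also have "(\<integral>\<^sup>+x. ennreal (\<bar>x\<bar> powr p) \<partial>std_normal_distribution) = shift_op (gauss 1) (pw p) 0"
    unfolding shift_op_def by (subst nn_integral_gauss) auto
  also have "(\<lambda>n. \<integral>\<^sup>+x. ennreal (\<bar>x\<bar> powr p) \<partial>distr M borel (S n)) = (\<lambda>n. shift_ops (\<lambda>_. scaled (1 / sqrt (real n * v2)) \<nu>) n (pw p) 0)"
  proof
    fix n
    define c where "c = 1 / sqrt (real n * v2)"
    let ?Y = "\<lambda>j (\<omega> :: nat \<Rightarrow> real). c * \<omega> j"
    have Y: "indep_vars (\<lambda>_. borel) ?Y UNIV"
      by (rule indep_vars_compose2[OF M(2)]) simp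
    have dY: "distr M borel (?Y j) = scaled c \<nu>" for j
    proof -
      have "scaled c \<nu> = distr (distr M borel (\<lambda>\<omega>. \<omega> j)) borel (\<lambda>w. c * w)" by (simp add: scaled_def M(4))
      also have "\<dots> = distr M borel (?Y j)" by (subst distr_distr) (auto simp: comp_def)
      finally show ?thesis by simp
    qed
    \<comment> \<open>The central limit theorem sums over \<open>i < n\<close>, whereas
      \<open>shift_ops\<close> counts from 1.\<close>
    have e: "(\<lambda>j::nat. j - 1) ` {1..} = UNIV"
    proof (intro equalityI subsetI)
      fix j :: nat show "j \<in> (\<lambda>j. j - 1) ` {1..}" by (rule image_eqI[of _ _ "Suc j"]) auto
    qed simp
    have "(\<integral>\<^sup>+\<omega>. pw p (\<Sum>j=1..n. ?Y (j - 1) \<omega>) \<partial>M) = shift_ops (\<lambda>_. scaled c \<nu>) n (pw p) 0"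
    proof -
      have "inj_on (\<lambda>j::nat. j - 1) {1..}" by (rule inj_onI) auto
      from nn_integral_indep_sum[OF Y[folded e] this measurable_pw] show ?thesis unfolding dY .
    qed
    moreover have "(\<Sum>j=1..n. ?Y (j - 1) \<omega>) = S n \<omega>" for \<omega>
      using v by (simp add: S_def c_def sum.atLeast1_atMost_eq sum_divide_distrib)
    moreover have "(\<integral>\<^sup>+x. ennreal (\<bar>x\<bar> powr p) \<partial>distr M borel (S n)) = (\<integral>\<^sup>+\<omega>. pw p (S n \<omega>) \<partial>M)"
      by (subst nn_integral_distr) auto
    ultimately show "(\<integral>\<^sup>+x. ennreal (\<bar>x\<bar> powr p) \<partial>distr M borel (S n)) = shift_ops (\<lambda>_. scaled (1 / sqrt (real n * v2)) \<nu>) n (pw p) 0"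
      by (simp add: c_def)
  qed
  finally show ?thesis .
qed

lemma shift_ops_cong:
  assumes "\<And>j g. 1 \<le> j \<Longrightarrow> j \<le> n \<Longrightarrow> g \<in> borel_measurable borel \<Longrightarrow> shift_op (\<mu> j) g = shift_op (\<mu>' j) g"
    and "\<And>j. j \<ge> 1 \<Longrightarrow> law (\<mu>' j)" and "f \<in> borel_measurable borel"
  shows "shift_ops \<mu> n f = shift_ops \<mu>' n f"
  using assms
proof (induction n arbitrary: f)
  case (Suc n)
  have m: "shift_op (\<mu>' (Suc n)) f \<in> borel_measurable borel"
    by (intro pos_op_measurable[OF pos_op_shift] Suc.prems(2,3)) simp
  have "shift_op (\<mu> (Suc n)) f = shift_op (\<mu>' (Suc n)) f" by (rule Suc.prems(1)[OF _ _ Suc.prems(3)]) simp_all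
  moreover have "shift_ops \<mu> n (shift_op (\<mu>' (Suc n)) f) = shift_ops \<mu>' n (shift_op (\<mu>' (Suc n)) f)"
    by (rule Suc.IH[OF Suc.prems(1) Suc.prems(2) m]) simp_all
  ultimately show ?case by (simp only: shift_ops.simps)
qed simp


text \<open>The \<open>n\<close> small copies have total variance 1 and vanishing
  \<open>p\<close>-th moments, and their sum tends to a Gaussian. The rare large copy has
  \<open>p\<close>-th moment 1 and vanishing variance. In the limit the two contributions to the
  moment of the sum add up to the left-hand side, while the maximum on the right tends to 1.\<close>

lemma gauss_lower:
  assumes adm: "admissible_const TYPE(nat \<Rightarrow> real) p N V C" and p: "p > 2"
    and N: "prob_space N" and V: "V \<in> borel_measurable N" and sym: "sym_law (distr N borel V)"
    and v: "(\<integral>\<^sup>+x. ennreal (x\<^sup>2) \<partial>distr N borel V) = ennreal v2" "v2 > 0" "(\<integral>\<^sup>+x. pw p x \<partial>distr N borel V) = ennreal vp" "vp > 0"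
  shows "1 + shift_op (gauss 1) (pw p) 0 \<le> epowr C p"
proof (cases "epowr C p")
  case (real k)
  define \<nu> where "\<nu> = distr N borel V"
  have sym: "sym_law \<nu>" and \<nu>: "law \<nu>" using sym by (simp_all add: \<nu>_def sym_law_def)
  note v = v[folded \<nu>_def]
  define I where "I n = shift_ops (\<lambda>_. scaled (1 / sqrt (real n * v2)) \<nu>) n (pw p) 0" for n
  \<comment> \<open>\<open>r n\<close> is the second moment of the rare summand and
    \<open>s n\<close> the total \<open>p\<close>-th moment of the small ones. Both tend to 0 since
    \<open>p > 2\<close>, so the maximum \<open>m n\<close> tends to 1.\<close>
  define r where "r n = 1 / (real n + 1) * (((real n + 1) / vp) powr (2 / p) * v2)" for n
  define s where "s n = real n * ((1 / sqrt (real n * v2)) powr p * vp)" for n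
  define m where "m n = max ((1 + r n) powr (p / 2)) (s n + 1)" for n
  have bound: "ennreal (1 - 1 / (real n + 1)) * I n + 1 \<le> ennreal k * ennreal (m n)" if n: "n \<ge> 1" for n
  proof -
    define d where "d j = (if j \<le> n then 1 else 1 / (real n + 1))" for j
    \<comment> \<open>The last size has \<open>p\<close>-th power \<open>(n + 1) / vp\<close>; with
      retention probability \<open>1 / (n + 1)\<close> it contributes \<open>p\<close>-th moment
      exactly 1.\<close>
    define c where "c j = (if j \<le> n then 1 / sqrt (real n * v2) else ((real n + 1) / vp) powr (1 / p))" for j
    let ?\<mu> = "\<lambda>j. bern_law (d j) (c j) \<nu>"
    have d: "0 \<le> d j" "d j \<le> 1" for j by (auto simp: d_def)
    have c: "c j \<ge> 0" for j using v by (auto simp: c_def)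
    let ?c = "c (Suc n)" and ?d = "1 / (real n + 1)"
    have c2: "?c\<^sup>2 = ((real n + 1) / vp) powr (2 / p)"
      using v by (simp add: c_def power2_eq_square flip: powr_add)
    have cp: "?c powr p = (real n + 1) / vp"
      using v p by (simp add: c_def powr_powr)
    have sum2: "(\<Sum>j=1..Suc n. d j * ((c j)\<^sup>2 * v2)) = 1 + r n"
    proof -
      have "(\<Sum>j=1..n. d j * ((c j)\<^sup>2 * v2)) = (\<Sum>j=1..n. 1 / real n)"
        using v n by (intro sum.cong) (auto simp: d_def c_def power_divide)
      then show ?thesis using n c2 by (simp add: r_def d_def)
    qed
    have sump: "(\<Sum>j=1..Suc n. d j * (c j powr p * vp)) = s n + 1"
    proof -
      have "(\<Sum>j=1..n. d j * (c j powr p * vp)) = (\<Sum>j=1..n. (1 / sqrt (real n * v2)) powr p * vp)"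
        by (intro sum.cong) (auto simp: d_def c_def)
      moreover have "d (Suc n) * (?c powr p * vp) = 1" using v unfolding cp by (simp add: d_def)
      ultimately show ?thesis by (simp add: s_def)
    qed
    let ?P = "shift_ops (\<lambda>_. scaled (1 / sqrt (real n * v2)) \<nu>) n" and ?T = "shift_op (scaled ?c \<nu>)"
    have P: "pos_op ?P" by (intro pos_op_shift_ops law_scaled \<nu>)
    have T: "pos_op ?T" by (intro pos_op_shift law_scaled \<nu>)
    note m = measurable_pw pos_op_measurable[OF P] pos_op_measurable[OF T]
    have Tn: "shift_op (?\<mu> (Suc n)) (pw p) = (\<lambda>y. ennreal (1 - ?d) * pw p y + ennreal ?d * ?T (pw p) y)"
      using shift_op_bern[OF \<nu> d measurable_pw, of "Suc n" ?c p] by (auto simp: d_def)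
    have mT: "shift_op (?\<mu> (Suc n)) (pw p) \<in> borel_measurable borel"
      by (intro pos_op_measurable[OF pos_op_shift] law_bern[OF \<nu> d] measurable_pw)
    have "shift_ops ?\<mu> (Suc n) (pw p) 0 = ?P (shift_op (?\<mu> (Suc n)) (pw p)) 0"
    proof -
      have "shift_ops ?\<mu> n g = ?P g" if g: "g \<in> borel_measurable borel" for g
      proof (rule shift_ops_cong[OF _ _ g])
        fix j and g :: "real \<Rightarrow> ennreal" assume "1 \<le> j" "j \<le> n" and g: "g \<in> borel_measurable borel"
        then show "shift_op (?\<mu> j) g = shift_op (scaled (1 / sqrt (real n * v2)) \<nu>) g"
          using shift_op_bern[OF \<nu> _ _ g, of 1] by (auto simp: d_def c_def fun_eq_iff)
      qed (intro law_scaled \<nu>)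
      from this[OF mT] show ?thesis by simp
    qed
    also have "\<dots> = ennreal (1 - ?d) * I n + ennreal ?d * ?P (?T (pw p)) 0"
      unfolding Tn I_def
      by (subst pos_op_add[OF P]) (auto simp: pos_op_cmult[OF P] m intro!: borel_measurable_times_ennreal m)
    also have "?P (?T (pw p)) 0 = ?T (?P (pw p)) 0"
      by (subst commute_opD[OF commute_op_shift_ops[of _ ?T] measurable_pw])
        (auto intro!: law_scaled[OF \<nu>] commute_op_shift simp del: One_nat_def)
    finally have eq: "shift_ops ?\<mu> (Suc n) (pw p) 0 = ennreal (1 - ?d) * I n + ennreal ?d * ?T (?P (pw p)) 0" .
    \<comment> \<open>Symmetric summands never decrease \<open>E |y + X|^p\<close>, so on the rare
      event the small copies may be dropped.\<close>
    have ge: "pw p y \<le> shift_ops (\<lambda>_. scaled b \<nu>) i (pw p) y" for b i y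
    proof (induction i arbitrary: y)
      case (Suc i)
      have "pw p y \<le> shift_ops (\<lambda>_. scaled b \<nu>) i (pw p) y" by (rule Suc)
      also have "\<dots> \<le> shift_ops (\<lambda>_. scaled b \<nu>) i (shift_op (scaled b \<nu>) (pw p)) y"
        using p by (intro pos_op_mono[OF pos_op_shift_ops] measurable_pw law_scaled \<nu>
            pos_op_measurable[OF pos_op_shift] shift_op_ge sym_law_scaled sym) auto
      finally show ?case by simp
    qed simp
    have "1 = ennreal ?d * ?T (pw p) 0"
    proof -
      have "?T (pw p) 0 = (\<integral>\<^sup>+w. ennreal (?c powr p) * pw p w \<partial>\<nu>)"
        using c[of "Suc n"] by (simp add: shift_op_scaled[OF \<nu>] abs_mult powr_mult ennreal_mult')
      also have "\<dots> = ennreal (?c powr p) * ennreal vp"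
        unfolding v(3)[symmetric] by (intro nn_integral_cmult measurable_law_borel[OF \<nu>] measurable_pw)
      also have "\<dots> = ennreal (real n + 1)"
        using v by (simp add: cp del: ennreal_plus flip: ennreal_mult')
      finally have "ennreal ?d * ?T (pw p) 0 = ennreal (?d * (real n + 1))"
        by (simp del: ennreal_plus flip: ennreal_mult')
      then show ?thesis by simp
    qed
    also have "\<dots> \<le> ennreal ?d * ?T (?P (pw p)) 0"
      using ge by (intro mult_left_mono pos_op_mono[OF T] m) auto
    finally have "ennreal (1 - ?d) * I n + 1 \<le> shift_ops ?\<mu> (Suc n) (pw p) 0"
      unfolding eq by (rule add_left_mono)
    also have "\<dots> \<le> epowr C p * ennreal (m n)"
      unfolding m_def sum2[symmetric] sump[symmetric] \<nu>_def
      using p by (intro admissible_const_lower adm N V d c v[unfolded \<nu>_def]) auto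
    finally show ?thesis by (simp add: real)
  qed
  have r0: "r \<longlonglongrightarrow> 0"
  proof -
    have "r n = vp powr (- (2 / p)) * v2 * (real n + 1) powr (2 / p - 1)" for n
      using v by (simp add: r_def powr_divide powr_minus powr_diff field_simps)
    then have r: "r = (\<lambda>n. vp powr (- (2 / p)) * v2 * (real n + 1) powr (2 / p - 1))" by (rule ext)
    have "(\<lambda>n. (real n + 1) powr (2 / p - 1)) \<longlonglongrightarrow> 0"
      using p by (intro tendsto_neg_powr filterlim_tendsto_add_at_top[OF tendsto_const, unfolded add.commute[of 1]])
        (auto simp: filterlim_real_sequentially add.commute intro: filterlim_tendsto_add_at_top[OF tendsto_const])
    then show ?thesis unfolding r by (rule tendsto_mult_right_zero)
  qed
  have s0: "s \<longlonglongrightarrow> 0"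
  proof -
    have "s n = vp * v2 powr (- (p / 2)) * real n powr (1 - p / 2)" if "n > 0" for n
    proof -
      have "sqrt (real n * v2) powr p = real n powr (p / 2) * v2 powr (p / 2)"
        using v that by (simp add: powr_powr powr_mult flip: powr_half_sqrt)
      then have "s n = real n * (1 / (real n powr (p / 2) * v2 powr (p / 2)) * vp)"
        using v that by (simp add: s_def powr_divide)
      moreover have "real n powr (1 - p / 2) = real n / real n powr (p / 2)"
        using that by (simp only: powr_diff) simp
      moreover have "x * (1 / (a * b) * y) = y * (1 / b) * (x / a)" for x y a b :: real
        by (simp add: mult.commute)
      ultimately show ?thesis by (simp only: powr_minus_divide)
    qed
    moreover have "(\<lambda>n. vp * v2 powr (- (p / 2)) * real n powr (1 - p / 2)) \<longlonglongrightarrow> 0"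
      using p by (intro tendsto_mult_right_zero tendsto_neg_powr filterlim_real_sequentially) auto
    ultimately show ?thesis
      by (elim Lim_transform_eventually) (auto intro: eventually_mono[OF eventually_gt_at_top[of 0]])
  qed
  have m1: "m \<longlonglongrightarrow> 1"
  proof -
    have "m \<longlonglongrightarrow> max ((1 + 0) powr (p / 2)) (0 + 1)"
      unfolding m_def[abs_def] by (intro tendsto_max tendsto_powr tendsto_add tendsto_const r0 s0) auto
    then show ?thesis by simp
  qed
  \<comment> \<open>The bound on \<open>I n\<close> obtained by solving \<open>bound\<close> for it;
    its limit is \<open>k - 1\<close>.\<close>
  define u where "u n = (k * m n - 1) / (1 - 1 / (real n + 1))" for n
  have mpos: "m n \<ge> 0" for n by (simp add: m_def le_max_iff_disj)
  have In: "I n \<le> ennreal (u n) \<and> 1 \<le> k * m n" if n: "n \<ge> 1" for n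
  proof (cases "I n")
    case (real i)
    have "ennreal ((1 - 1 / (real n + 1)) * i + 1) \<le> ennreal (k * m n)"
    proof -
      have "0 \<le> (1 - 1 / (real n + 1)) * i" using real by (intro mult_nonneg_nonneg) auto
      then have "ennreal ((1 - 1 / (real n + 1)) * i + 1) = ennreal ((1 - 1 / (real n + 1)) * i) + ennreal 1"
        by (intro ennreal_plus) auto
      also have "\<dots> = ennreal (1 - 1 / (real n + 1)) * I n + 1"
        using real by (simp add: ennreal_mult'')
      also have "\<dots> \<le> ennreal k * ennreal (m n)" by (rule bound[OF n])
      also have "\<dots> = ennreal (k * m n)" using \<open>0 \<le> k\<close> by (rule ennreal_mult'[symmetric])
      finally show ?thesis .
    qed
    then have le: "(1 - 1 / (real n + 1)) * i + 1 \<le> k * m n"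
      using \<open>0 \<le> k\<close> mpos[of n] by (simp add: ennreal_le_iff)
    have pos: "1 - 1 / (real n + 1) > 0" using n by simp
    then have "i \<le> u n" using le by (simp add: u_def pos_le_divide_eq mult.commute)
    moreover have "0 \<le> (1 - 1 / (real n + 1)) * i" using pos real by simp
    with le have "1 \<le> k * m n" by linarith
    ultimately show ?thesis using real by (simp add: ennreal_leI)
  next
    case top
    have "ennreal (1 - 1 / (real n + 1)) * I n + 1 = \<top>" using n top by (simp add: ennreal_mult_top)
    then show ?thesis using bound[OF n] by (simp add: ennreal_mult_eq_top_iff top_unique flip: ennreal_mult')
  qed
  have "u \<longlonglongrightarrow> (k * 1 - 1) / (1 - 0)"
  proof -
    have "(\<lambda>n. 1 / (real n + 1)) \<longlonglongrightarrow> 0"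
      using LIMSEQ_inverse_real_of_nat by (simp add: inverse_eq_divide add.commute)
    then show ?thesis unfolding u_def[abs_def] by (intro tendsto_intros m1) auto
  qed
  then have "(\<lambda>n. ennreal (u n)) \<longlonglongrightarrow> ennreal (k - 1)" by (intro tendsto_ennrealI) simp
  then have lim: "liminf (\<lambda>n. ennreal (u n)) = ennreal (k - 1)" by (simp add: lim_imp_Liminf)
  have "shift_op (gauss 1) (pw p) 0 \<le> liminf I"
    unfolding I_def[abs_def] using p by (intro gauss_le_liminf sym v) auto
  also have "\<dots> \<le> liminf (\<lambda>n. ennreal (u n))"
    using In by (intro Liminf_mono eventually_mono[OF eventually_ge_at_top[of 1]]) auto
  finally have 1: "shift_op (gauss 1) (pw p) 0 \<le> ennreal (k - 1)" by (simp add: lim)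
  \<comment> \<open>If \<open>k\<close> were below 1, \<open>ennreal (k - 1)\<close> would be
    truncated to 0 and adding 1 would not give back \<open>k\<close>.\<close>
  have "1 \<le> k * 1"
    using In by (intro LIMSEQ_le_const[OF tendsto_mult[OF tendsto_const m1]]) auto
  then have "1 + ennreal (k - 1) = ennreal k" by (simp flip: ennreal_1 ennreal_plus)
  then show ?thesis using add_left_mono[OF 1, of 1] real by simp
qed simp

lemma gauss_moment_finite: "p \<le> 4 \<Longrightarrow> p \<ge> 2 \<Longrightarrow> shift_op (gauss 1) (pw p) 0 < \<top>"
proof -
  assume p: "p \<ge> 2" "p \<le> 4"
  have "shift_op (gauss 1) (pw p) 0 = (\<integral>\<^sup>+z. pw p z \<partial>std_normal_distribution)"
    unfolding shift_op_def by (subst nn_integral_gauss) auto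
  also have "\<dots> \<le> (\<integral>\<^sup>+z. ennreal (0 + (2 - p / 2) * z\<^sup>2 + (p / 2 - 1) * z ^ 4) \<partial>std_normal_distribution)"
    using abs_powr_le_quartic[OF p] by (intro nn_integral_mono ennreal_leI) simp
  also have "\<dots> = ennreal (\<integral>z. 0 + (2 - p / 2) * z\<^sup>2 + (p / 2 - 1) * z ^ 4 \<partial>std_normal_distribution)"
    using p by (intro nn_integral_eq_integral std_normal_poly AE_I2) auto
  finally show ?thesis by (auto intro: le_less_trans)
qed

section \<open>The best constants\<close>

lemma nn_integral_pw_distr: "X \<in> borel_measurable M \<Longrightarrow> (\<integral>\<^sup>+x. pw p x \<partial>distr M borel X) = (\<integral>\<^sup>+\<omega>. pw p (X \<omega>) \<partial>M)"
  by (subst nn_integral_distr) auto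

lemma nn_integral_power2_distr: "X \<in> borel_measurable M \<Longrightarrow> (\<integral>\<^sup>+x. ennreal (x\<^sup>2) \<partial>distr M borel X) = (\<integral>\<^sup>+\<omega>. ennreal ((X \<omega>)\<^sup>2) \<partial>M)"
  by (subst nn_integral_distr) auto

context
  fixes p :: real and N :: "'b measure" and V :: "'b \<Rightarrow> real" and M :: "'a measure" and X :: "nat \<Rightarrow> 'a \<Rightarrow> real" and n :: nat
  assumes p: "p > 2" and sym: "sym_law (distr N borel V)"
    and M: "prob_space M" and X: "prob_space.indep_vars M (\<lambda>_. borel) X {1..}" "\<forall>j\<ge>1. V_mixture N V M (X j)"
begin

lemma sum_moment_le_gauss:
  assumes p4: "p \<le> 4"
  shows "(\<integral>\<^sup>+\<omega>. pw p (\<Sum>j=1..n. X j \<omega>) \<partial>M) \<le> (1 + shift_op (gauss 1) (pw p) 0) *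
        max (epowr (\<Sum>j=1..n. \<integral>\<^sup>+\<omega>. ennreal ((X j \<omega>)\<^sup>2) \<partial>M) (p / 2)) (\<Sum>j=1..n. \<integral>\<^sup>+\<omega>. pw p (X j \<omega>) \<partial>M)"
    (is "?L \<le> (1 + ?G) * max (epowr ?A _) ?B")
\<comment> \<open>An infinite \<open>p\<close>-th moment makes the right-hand side infinite.
  Otherwise all second moments are finite as well, and the standard deviations \<open>s j\<close>
  are genuine real numbers.\<close>
proof (cases "?B = \<top>")
  case True
  then show ?thesis unfolding True max_top2 by (simp add: ennreal_mult_top)
next
  case False
  interpret prob_space M by (rule M)
  have mix: "mixture_law (distr N borel V) (distr M borel (X j))" if "j \<ge> 1" for j
    using X(2) that by (intro mixture_law_V_mixture M) blast
  have rv: "X j \<in> borel_measurable M" if "j \<ge> 1" for j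
    using X(2) that by (simp add: V_mixture_def)
  have symX: "sym_law (distr M borel (X j))" if "j \<ge> 1" for j
    by (rule sym_law_mixture[OF sym mix[OF that]])
  define s where "s j = sqrt (enn2real (\<integral>\<^sup>+x. ennreal (x\<^sup>2) \<partial>distr M borel (X j)))" for j
  have s: "(\<integral>\<^sup>+x. ennreal (x\<^sup>2) \<partial>distr M borel (X j)) = ennreal ((s j)\<^sup>2)" if j: "j \<ge> 1" "j \<le> n" for j
  proof -
    have "(\<integral>\<^sup>+\<omega>. pw p (X j \<omega>) \<partial>M) \<le> ?B" using j by (intro member_le_sum) auto
    also have "?B < \<top>" using False by (simp only: top.not_eq_extremum)
    finally have fin: "(\<integral>\<^sup>+\<omega>. pw p (X j \<omega>) \<partial>M) < \<top>" .
    have le: "x\<^sup>2 \<le> 1 + \<bar>x\<bar> powr p" for x :: real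
    proof (cases "\<bar>x\<bar> \<le> 1")
      case True
      then have "x\<^sup>2 \<le> 1" by (simp add: abs_square_le_1)
      then show ?thesis by (simp add: add_increasing2)
    next
      case False
      then have "\<bar>x\<bar> powr 2 \<le> \<bar>x\<bar> powr p" using p by (intro powr_mono) auto
      then show ?thesis using False by simp
    qed
    have "(\<integral>\<^sup>+\<omega>. ennreal ((X j \<omega>)\<^sup>2) \<partial>M) \<le> (\<integral>\<^sup>+\<omega>. 1 + pw p (X j \<omega>) \<partial>M)"
      by (intro nn_integral_mono) (simp add: le ennreal_leI flip: ennreal_1 ennreal_plus)
    also have "\<dots> = 1 + (\<integral>\<^sup>+\<omega>. pw p (X j \<omega>) \<partial>M)"
      using rv[OF j(1)] by (subst nn_integral_add) (auto simp: emeasure_space_1)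
    also have "\<dots> < \<top>" using fin by simp
    finally show ?thesis using rv[OF j(1)] by (simp add: s_def nn_integral_power2_distr)
  qed
  let ?\<mu> = "\<lambda>j. distr M borel (X j)"
  define t where "t = (\<Sum>j=1..n. (s j)\<^sup>2)"
  have t: "t \<ge> 0" unfolding t_def by (intro sum_nonneg) auto
  have A: "?A = ennreal t"
  proof -
    have "?A = (\<Sum>j=1..n. ennreal ((s j)\<^sup>2))"
      using s rv by (intro sum.cong) (auto simp: nn_integral_power2_distr)
    then show ?thesis by (simp add: t_def sum_ennreal)
  qed
  have "?L = shift_ops ?\<mu> n (pw p) 0"
    using nn_integral_indep_sum[of X id "pw p" n] X(1) by simp
  also have "\<dots> \<le> (\<Sum>j=1..n. \<integral>\<^sup>+x. pw p x \<partial>?\<mu> j) + shift_op (gauss (sqrt t)) (pw p) 0"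
    unfolding t_def using s p p4 by (intro shift_ops_le_gauss symX) (auto simp: s_def)
  also have "(\<Sum>j=1..n. \<integral>\<^sup>+x. pw p x \<partial>?\<mu> j) = ?B"
    using rv by (intro sum.cong) (auto simp: nn_integral_pw_distr)
  also have "shift_op (gauss (sqrt t)) (pw p) 0 = epowr ?A (p / 2) * ?G"
    using t p unfolding A by (subst shift_op_gauss_eq) (auto simp: epowr_ennreal powr_half_sqrt[symmetric] powr_powr)
  \<comment> \<open>The two terms are bounded separately by the same maximum, which is how the
    constant becomes the sum of 1 and the Gaussian moment.\<close>
  also have "?B + epowr ?A (p / 2) * ?G \<le> max (epowr ?A (p / 2)) ?B + max (epowr ?A (p / 2)) ?B * ?G"
    by (intro add_mono mult_right_mono) auto
  finally show ?thesis by (simp add: distrib_right mult.commute)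
qed

text \<open>The two equations for \<open>a\<close> and \<open>l\<close> make both budgets of
  \<open>shift_ops_le_cpois\<close> equal to 1 for jumps of size \<open>a\<close>. For a general
  maximum \<open>m\<close> the jumps are scaled by \<open>b = m powr (1 / p)\<close>, which
  multiplies the budgets by \<open>b^2\<close> and \<open>b powr p\<close>, and
  \<open>cpois_homogeneous\<close> extracts the factor \<open>m\<close>.\<close>

lemma sum_moment_le_cpois:
  assumes p4: "p \<ge> 4"
    and v: "(\<integral>\<^sup>+x. ennreal (x\<^sup>2) \<partial>distr N borel V) = ennreal v2" "v2 > 0" "(\<integral>\<^sup>+x. pw p x \<partial>distr N borel V) = ennreal vp" "vp > 0"
    and a: "a > 0" and l: "l > 0" "l * (a\<^sup>2 * v2) = 1" "l * (a powr p * vp) = 1"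
  shows "(\<integral>\<^sup>+\<omega>. pw p (\<Sum>j=1..n. X j \<omega>) \<partial>M) \<le> cpois l a (distr N borel V) (pw p) 0 *
        max (epowr (\<Sum>j=1..n. \<integral>\<^sup>+\<omega>. ennreal ((X j \<omega>)\<^sup>2) \<partial>M) (p / 2)) (\<Sum>j=1..n. \<integral>\<^sup>+\<omega>. pw p (X j \<omega>) \<partial>M)"
    (is "?L \<le> ?K * ?m")
proof -
  interpret prob_space M by (rule M)
  define \<nu> where "\<nu> = distr N borel V"
  have \<nu>: "sym_law \<nu>" "law \<nu>" using sym by (simp_all add: \<nu>_def sym_law_def)
  note v = v[folded \<nu>_def]
  let ?A = "\<Sum>j=1..n. \<integral>\<^sup>+\<omega>. ennreal ((X j \<omega>)\<^sup>2) \<partial>M" and ?B = "\<Sum>j=1..n. \<integral>\<^sup>+\<omega>. pw p (X j \<omega>) \<partial>M"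
  have mix: "mixture_law \<nu> (distr M borel (X j))" if "j \<ge> 1" for j
    unfolding \<nu>_def using X(2) that by (intro mixture_law_V_mixture M) blast
  have rv: "X j \<in> borel_measurable M" if "j \<ge> 1" for j
    using X(2) that by (simp add: V_mixture_def)
  let ?\<mu> = "\<lambda>j. distr M borel (X j)"
  have K: "?K < \<top>" "?K > 0"
    using cpois_finite[OF \<nu>(2), of p l a 0] cpois_pos[OF \<nu>(2), of p l a] v l a p by (simp_all add: \<nu>_def)
  have le: "?L \<le> ?K * ennreal m" if m: "m > 0" "?m \<le> ennreal m" for m
  proof -
    define b where "b = m powr (1 / p)"
    have b: "b > 0" "b powr p = m" using m p by (simp_all add: b_def powr_powr)
    have b2: "b\<^sup>2 = m powr (2 / p)" using m by (simp add: b_def power2_eq_square flip: powr_add)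
    have "epowr ?A (p / 2) \<le> epowr (ennreal (b\<^sup>2)) (p / 2)"
      using m p by (simp add: epowr_ennreal b2 powr_powr)
    then have A: "?A \<le> ennreal (b\<^sup>2)" using p by (simp add: epowr_le_iff)
    have B: "?B \<le> ennreal (b powr p)" using m b by simp
    have "?L = shift_ops ?\<mu> n (pw p) 0"
      using nn_integral_indep_sum[of X id "pw p" n] X(1) by simp
    also have "\<dots> \<le> cpois l (a * b) \<nu> (pw p) 0"
    proof (rule shift_ops_le_cpois[OF p4 \<nu>(1) mix _ l(1) v])
      show "0 < a * b" using a b by simp
      have "(\<Sum>j=1..n. \<integral>\<^sup>+x. ennreal (x\<^sup>2) \<partial>?\<mu> j) = ?A"
        using rv by (intro sum.cong) (auto simp: nn_integral_power2_distr)
      moreover have "l * ((a * b)\<^sup>2 * v2) = b\<^sup>2" using l(2) by (simp add: power_mult_distrib algebra_simps)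
      ultimately show "(\<Sum>j=1..n. \<integral>\<^sup>+x. ennreal (x\<^sup>2) \<partial>?\<mu> j) \<le> ennreal (l * ((a * b)\<^sup>2 * v2))" using A by simp
      have "(\<Sum>j=1..n. \<integral>\<^sup>+x. pw p x \<partial>?\<mu> j) = ?B"
        using rv by (intro sum.cong) (auto simp: nn_integral_pw_distr)
      moreover have "l * ((a * b) powr p * vp) = l * (a powr p * vp) * b powr p" using a b by (simp add: powr_mult)
      ultimately show "(\<Sum>j=1..n. \<integral>\<^sup>+x. pw p x \<partial>?\<mu> j) \<le> ennreal (l * ((a * b) powr p * vp))" using B l(3) by simp
    qed
    also have "\<dots> = ennreal m * ?K"
      using cpois_homogeneous[OF \<nu>(2), of b l a p] b by (simp add: \<nu>_def)
    finally show ?thesis by (simp add: mult.commute)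
  qed
  show ?thesis
  proof (cases "?m")
    case (real m)
    show ?thesis
    proof (cases "m = 0")
      \<comment> \<open>The comparison requires jumps of positive size, so a vanishing right-hand
        side is reached through arbitrarily small positive \<open>e\<close>.\<close>
      case True
      obtain k where k: "?K = ennreal k" "k > 0" using K by (cases ?K) auto
      have "?L \<le> 0 + ennreal e" if "e > 0" for e
      proof -
        have "?L \<le> ?K * ennreal (e / k)"
          by (rule le) (use k that in \<open>simp, simp only: real True, simp\<close>)
        also have "\<dots> = ennreal e" unfolding k(1) using k(2) by (simp flip: ennreal_mult')
        finally show ?thesis by simp
      qed
      then have "?L \<le> 0" by (rule ennreal_le_epsilon)
      then show ?thesis by simp
    next
      case False
      have "?L \<le> ?K * ennreal m"
        by (rule le) (use False real in simp, simp only: real)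
      then show ?thesis by (simp only: real)
    qed
  next
    case top
    then show ?thesis using K by (simp add: ennreal_mult_top)
  qed
qed

end


section \<open>The compound Poisson sum with nonzero jumps\<close>

lemma scaled_1:
  assumes "law \<nu>"
  shows "scaled 1 \<nu> = \<nu>"
  using assms by (simp add: scaled_def distr_id2)

lemma (in prob_space) nn_integral_indep_mult:
  fixes X Y :: "'a \<Rightarrow> ennreal"
  assumes ind: "indep_set (sets F) (sets G)" and sp: "space F = space M" "space G = space M"
    and X: "X \<in> borel_measurable F" and Y: "Y \<in> borel_measurable G"
  shows "(\<integral>\<^sup>+\<omega>. X \<omega> * Y \<omega> \<partial>M) = (\<integral>\<^sup>+\<omega>. X \<omega> \<partial>M) * (\<integral>\<^sup>+\<omega>. Y \<omega> \<partial>M)"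
proof -
  note ev = indep_setD_ev1[OF ind] indep_setD_ev2[OF ind]
  have XF: "{X -` A \<inter> space M |A. A \<in> sets borel} \<subseteq> sets F" and YG: "{Y -` A \<inter> space M |A. A \<in> sets borel} \<subseteq> sets G"
    using measurable_sets[OF X] measurable_sets[OF Y] sp by auto
  have rv: "X \<in> borel_measurable M" "Y \<in> borel_measurable M"
    using XF YG ev by (auto intro!: measurableI)
  have "indep_set (sigma_sets (space M) {X -` A \<inter> space M |A. A \<in> sets borel}) (sigma_sets (space M) {Y -` A \<inter> space M |A. A \<in> sets borel})"
    using ind unfolding indep_set_def
  proof (rule indep_sets_mono_sets)
    fix i :: bool
    show "(case i of True \<Rightarrow> sigma_sets (space M) {X -` A \<inter> space M |A. A \<in> sets borel}
         | False \<Rightarrow> sigma_sets (space M) {Y -` A \<inter> space M |A. A \<in> sets borel})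
      \<subseteq> (case i of True \<Rightarrow> sets F | False \<Rightarrow> sets G)"
      using sets.sigma_sets_subset[OF XF] sets.sigma_sets_subset[OF YG] by (cases i) (simp_all add: sp)
  qed
  then have "indep_var borel X borel Y" using rv by (simp add: indep_var_eq)
  then have iv: "indep_vars (\<lambda>_. borel) (case_bool X Y) UNIV"
    unfolding indep_var_def by (rule indep_vars_cong[THEN iffD1, rotated 3]) (auto split: bool.split)
  show ?thesis using indep_vars_nn_integral[OF _ iv] by (simp add: UNIV_bool mult.commute)
qed

text \<open>The sample space is split along the values \<open>k\<close> of \<open>\<xi>\<close>.
  Independence of \<open>\<xi>\<close> from the whole sequence factors each piece, and the sum of
  the first \<open>k\<close> terms contributes the \<open>k\<close>-fold iterate.\<close>

lemma nn_integral_compound_Poisson: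
  assumes S: "prob_space S" and Vt: "prob_space.indep_vars S (\<lambda>_. borel) Vt {1..}"
    and law: "\<And>j. j \<ge> 1 \<Longrightarrow> distr S borel (Vt j) = \<mu>"
    and xi: "\<xi> \<in> measurable S (count_space UNIV)"
    and r: "r > 0" and dist: "distr S (count_space UNIV) \<xi> = measure_pmf (poisson_pmf r)"
    and ind: "prob_space.indep_set S
          (sets (vimage_algebra (space S) \<xi> (count_space UNIV)))
          (sets (vimage_algebra (space S) (\<lambda>\<omega>. \<lambda>j\<in>{1..}. Vt j \<omega>) (PiM {1..} (\<lambda>_. borel))))"
    and f: "f \<in> borel_measurable borel"
  shows "(\<integral>\<^sup>+\<omega>. f (\<Sum>j=1..\<xi> \<omega>. Vt j \<omega>) \<partial>S) = (\<Sum>k. ennreal (exp (- r) * r ^ k / fact k) * (shift_op \<mu> ^^ k) f 0)"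
proof -
  interpret prob_space S by (rule S)
  have [measurable]: "f \<in> borel_measurable borel" by (rule f)
  let ?P = "PiM {1..} (\<lambda>_. borel) :: (nat \<Rightarrow> real) measure"
  define W where "W = (\<lambda>\<omega>. \<lambda>j\<in>{1..}. Vt j \<omega>)"
  let ?F = "vimage_algebra (space S) \<xi> (count_space UNIV)" and ?G = "vimage_algebra (space S) W ?P"
  have rv: "Vt j \<in> borel_measurable S" if "j \<ge> 1" for j
    using Vt that by (auto simp: indep_vars_def)
  have mF: "\<xi> \<in> measurable ?F (count_space UNIV)" by (rule measurable_vimage_algebra1) simp
  have mG: "W \<in> measurable ?G ?P"
    by (rule measurable_vimage_algebra1) (auto simp: W_def space_PiM)
  have sum: "(\<lambda>\<omega>. f (\<Sum>j=1..k. Vt j \<omega>)) \<in> borel_measurable ?G" for k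
  proof -
    have "(\<lambda>w. \<Sum>j=1..k. w j) \<in> borel_measurable ?P"
      by (intro borel_measurable_sum measurable_component_singleton) auto
    from measurable_compose[OF mG measurable_compose[OF this f]]
    have "(\<lambda>\<omega>. f (\<Sum>j=1..k. W \<omega> j)) \<in> borel_measurable ?G" .
    moreover have "(\<Sum>j=1..k. W \<omega> j) = (\<Sum>j=1..k. Vt j \<omega>)" for \<omega>
      by (intro sum.cong) (auto simp: W_def)
    ultimately show ?thesis by (simp only:)
  qed
  have sumS: "(\<lambda>\<omega>. f (\<Sum>j=1..k. Vt j \<omega>)) \<in> borel_measurable S" for k
    using rv by (intro measurable_compose[OF _ f] borel_measurable_sum) auto
  have xiS: "(\<lambda>\<omega>. indicator {k} (\<xi> \<omega>) :: ennreal) \<in> borel_measurable S" for k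
    by (rule measurable_compose[OF xi]) simp
  have "(\<integral>\<^sup>+\<omega>. f (\<Sum>j=1..\<xi> \<omega>. Vt j \<omega>) \<partial>S) = (\<integral>\<^sup>+\<omega>. (\<Sum>k. indicator {k} (\<xi> \<omega>) * f (\<Sum>j=1..k. Vt j \<omega>)) \<partial>S)"
    by (intro nn_integral_cong, subst suminf_finite[of "{\<xi> _}"]) (auto simp: indicator_def)
  also have "\<dots> = (\<Sum>k. \<integral>\<^sup>+\<omega>. indicator {k} (\<xi> \<omega>) * f (\<Sum>j=1..k. Vt j \<omega>) \<partial>S)"
    by (intro nn_integral_suminf borel_measurable_times_ennreal sumS xiS)
  also have "(\<lambda>k. \<integral>\<^sup>+\<omega>. indicator {k} (\<xi> \<omega>) * f (\<Sum>j=1..k. Vt j \<omega>) \<partial>S) =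
      (\<lambda>k. ennreal (exp (- r) * r ^ k / fact k) * (shift_op \<mu> ^^ k) f 0)"
  proof
    fix k
    have "(\<integral>\<^sup>+\<omega>. indicator {k} (\<xi> \<omega>) * f (\<Sum>j=1..k. Vt j \<omega>) \<partial>S) =
       (\<integral>\<^sup>+\<omega>. indicator {k} (\<xi> \<omega>) \<partial>S) * (\<integral>\<^sup>+\<omega>. f (\<Sum>j=1..k. Vt j \<omega>) \<partial>S)"
    proof (rule nn_integral_indep_mult[OF ind[folded W_def]])
      show "(\<lambda>\<omega>. indicator {k} (\<xi> \<omega>)) \<in> borel_measurable ?F" by (rule measurable_compose[OF mF]) simp
    qed (simp_all only: space_vimage_algebra sum)
    also have "(\<integral>\<^sup>+\<omega>. indicator {k} (\<xi> \<omega>) \<partial>S) = (\<integral>\<^sup>+i. indicator {k} i \<partial>distr S (count_space UNIV) \<xi>)"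
      using xi by (subst nn_integral_distr) auto
    also have "\<dots> = ennreal (exp (- r) * r ^ k / fact k)"
      unfolding dist using r by (simp add: emeasure_pmf_single mult.commute)
    also have "(\<integral>\<^sup>+\<omega>. f (\<Sum>j=1..k. Vt j \<omega>) \<partial>S) = shift_ops (\<lambda>j. distr S borel (Vt j)) k f 0"
      using nn_integral_indep_sum[of Vt id f k] Vt f by simp
    also have "\<dots> = shift_ops (\<lambda>_. \<mu>) k f 0"
    proof (rule fun_cong[OF shift_ops_cong[OF _ _ f]])
      show "law \<mu>" using law[of 1] rv[of 1] prob_space_distr[of "Vt 1" borel] by auto
    qed (use law in auto)
    finally show "(\<integral>\<^sup>+\<omega>. indicator {k} (\<xi> \<omega>) * f (\<Sum>j=1..k. Vt j \<omega>) \<partial>S) =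
        ennreal (exp (- r) * r ^ k / fact k) * (shift_op \<mu> ^^ k) f 0" by (simp add: shift_ops_const)
  qed
  finally show ?thesis .
qed

text \<open>Jumps equal to 0 act as the identity, so \<open>l\<close> times the shift by
  \<open>V\<close> is \<open>l * (1 - q)\<close> times the shift by the conditioned variable plus
  the scalar \<open>l * q\<close>. The exponential of this scalar turns the normalisation
  \<open>exp (- l)\<close> into that of the reduced rate; hence the factor
  \<open>1 - P(V = 0)\<close> in the Poisson parameter.\<close>

lemma cpois_conditioned:
  assumes N: "prob_space N" and V: "V \<in> borel_measurable N" and l: "l \<ge> 0" and f: "f \<in> borel_measurable borel"
    and q: "q = measure N {\<omega> \<in> space N. V \<omega> = 0}" "q < 1"
    and \<mu>: "\<mu> = distr (uniform_measure N {\<omega> \<in> space N. V \<omega> \<noteq> 0}) borel V"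
  shows "cpois l 1 (distr N borel V) f y = (\<Sum>k. ennreal (exp (- (l * (1 - q))) * (l * (1 - q)) ^ k / fact k) * (shift_op \<mu> ^^ k) f y)"
proof -
  interpret prob_space N by (rule N)
  note [measurable] = V
  let ?A = "{\<omega> \<in> space N. V \<omega> \<noteq> 0}"
  have A: "?A \<in> sets N" by measurable
  have q01: "0 \<le> q" "q \<le> 1" using q by (auto simp: measure_nonneg)
  have PA: "prob ?A = 1 - q"
  proof -
    have "?A = space N - {\<omega> \<in> space N. V \<omega> = 0}" by auto
    then show ?thesis unfolding q(1) by (simp add: prob_compl)
  qed
  have eA: "emeasure N ?A = ennreal (1 - q)" using PA by (simp add: emeasure_eq_measure)
  have law\<nu>: "law (distr N borel V)" using prob_space_distr[OF V] by simp
  have "prob_space (uniform_measure N ?A)" using q eA by (intro prob_space_uniform_measure) auto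
  then have law\<mu>: "law \<mu>" unfolding \<mu> using prob_space.prob_space_distr[of "uniform_measure N ?A" V borel] V by simp
  let ?T = "shift_op \<mu>" and ?r = "l * (1 - q)"
  have T: "pos_op ?T" by (rule pos_op_shift[OF law\<mu>])
  have split: "ennreal l * shift_op (distr N borel V) g y = ennreal ?r * ?T g y + ennreal (l * q) * g y"
    if [measurable]: "g \<in> borel_measurable borel" for g y
  proof -
    have Tg: "ennreal (1 - q) * ?T g y = (\<integral>\<^sup>+\<omega>. g (y + V \<omega>) * indicator ?A \<omega> \<partial>N)"
    proof -
      have "?T g y = (\<integral>\<^sup>+\<omega>. g (y + V \<omega>) \<partial>uniform_measure N ?A)"
        unfolding shift_op_def \<mu> by (subst nn_integral_distr) auto
      also have "\<dots> = (\<integral>\<^sup>+\<omega>. g (y + V \<omega>) * indicator ?A \<omega> \<partial>N) / ennreal (1 - q)"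
        using A by (subst nn_integral_uniform_measure) (auto simp: eA)
      finally have "?T g y * ennreal (1 - q) = (\<integral>\<^sup>+\<omega>. g (y + V \<omega>) * indicator ?A \<omega> \<partial>N)"
        using q by (simp add: ennreal_divide_times mult_divide_eq_ennreal)
      then show ?thesis by (simp add: mult.commute)
    qed
    have "shift_op (distr N borel V) g y = (\<integral>\<^sup>+\<omega>. g (y + V \<omega>) \<partial>N)"
      unfolding shift_op_def by (subst nn_integral_distr) auto
    also have "\<dots> = (\<integral>\<^sup>+\<omega>. g (y + V \<omega>) * indicator ?A \<omega> + g y * indicator {\<omega> \<in> space N. V \<omega> = 0} \<omega> \<partial>N)"
      by (intro nn_integral_cong) (auto simp: indicator_def)
    also have "\<dots> = (\<integral>\<^sup>+\<omega>. g (y + V \<omega>) * indicator ?A \<omega> \<partial>N) + g y * ennreal q"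
      by (subst nn_integral_add) (auto simp: nn_integral_cmult_indicator emeasure_eq_measure q(1))
    finally have "ennreal l * shift_op (distr N borel V) g y = ennreal l * (ennreal (1 - q) * ?T g y + g y * ennreal q)"
      unfolding Tg by simp
    then show ?thesis using l q01 by (simp add: distrib_left ennreal_mult mult_ac)
  qed
  have "exp_op (\<lambda>f y. ennreal l * shift_op (distr N borel V) f y) f y = exp_op (add_op (\<lambda>f y. ennreal ?r * ?T f y) (scale_op (ennreal (l * q)))) f y"
    unfolding exp_op_def
    by (subst funpow_op_cong[OF pos_op_scaled_op[OF pos_op_shift[OF law\<nu>]] _ f]) (auto simp: split fun_eq_iff)
  also have "\<dots> = ennreal (exp (l * q)) * exp_op (\<lambda>f y. ennreal ?r * ?T f y) f y"
    using l q01 by (intro exp_op_add_scale pos_op_scaled_op T f) auto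
  finally have "cpois l 1 (distr N borel V) f y = ennreal (exp (- l) * exp (l * q)) * exp_op (\<lambda>f y. ennreal ?r * ?T f y) f y"
    by (simp add: cpois_def scaled_1[OF law\<nu>] ennreal_mult' mult.assoc)
  also have "exp (- l) * exp (l * q) = exp (- ?r)"
    by (simp add: algebra_simps flip: exp_add)
  also have "exp_op (\<lambda>f y. ennreal ?r * ?T f y) f y = (\<Sum>k. ennreal (1 / fact k) * ennreal ?r ^ k * (?T ^^ k) f y)"
    by (rule exp_op_scaled_op[OF T f])
  also have "ennreal (exp (- ?r)) * \<dots> = (\<Sum>k. ennreal (exp (- ?r) * ?r ^ k / fact k) * (?T ^^ k) f y)"
  proof -
    have "ennreal (exp (- ?r)) * (ennreal (1 / fact k) * ennreal ?r ^ k * t) = ennreal (exp (- ?r) * ?r ^ k / fact k) * t" for k t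
      using l q01 by (simp add: ennreal_power flip: mult.assoc ennreal_mult')
    then show ?thesis by (simp flip: ennreal_suminf_cmult)
  qed
  finally show ?thesis .
qed

lemma best_constI:
  assumes p: "p > 0" and fin: "K < \<top>"
    and upper: "\<And>(M :: 'a measure) (X :: nat \<Rightarrow> 'a \<Rightarrow> real) (n :: nat). prob_space M \<Longrightarrow> prob_space.indep_vars M (\<lambda>_. borel) X {1..} \<Longrightarrow>
        \<forall>j\<ge>1. V_mixture N V M (X j) \<Longrightarrow>
        (\<integral>\<^sup>+\<omega>. pw p (\<Sum>j=1..n. X j \<omega>) \<partial>M) \<le> K *
        max (epowr (\<Sum>j=1..n. \<integral>\<^sup>+\<omega>. ennreal ((X j \<omega>)\<^sup>2) \<partial>M) (p / 2)) (\<Sum>j=1..n. \<integral>\<^sup>+\<omega>. pw p (X j \<omega>) \<partial>M)"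
    and lower: "\<And>C. admissible_const TYPE(nat \<Rightarrow> real) p N V C \<Longrightarrow> K \<le> epowr C p"
    and C: "epowr C p = K"
  shows "best_const TYPE('a) p N V C"
  unfolding best_const_def
proof (intro conjI allI impI)
  show "C < \<top>" using fin unfolding C[symmetric] by simp
  show "admissible_const TYPE('a) p N V C"
    unfolding admissible_const_def moment_inequality_iff[OF p] C
  proof (intro allI impI)
    fix M :: "'a measure" and X :: "nat \<Rightarrow> 'a \<Rightarrow> real" and n :: nat
    assume hyps: "prob_space M" "prob_space.indep_vars M (\<lambda>_. borel) X {1..}" "\<forall>j\<ge>1. V_mixture N V M (X j)"
    show "(\<integral>\<^sup>+\<omega>. pw p (\<Sum>j=1..n. X j \<omega>) \<partial>M) \<le> K *
        max (epowr (\<Sum>j=1..n. \<integral>\<^sup>+\<omega>. ennreal ((X j \<omega>)\<^sup>2) \<partial>M) (p / 2)) (\<Sum>j=1..n. \<integral>\<^sup>+\<omega>. pw p (X j \<omega>) \<partial>M)"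
      by (rule upper[OF hyps])
  qed
  fix C' assume "admissible_const TYPE(nat \<Rightarrow> real) p N V C'"
  from lower[OF this] show "C \<le> C'" unfolding C[symmetric] using p by (simp add: epowr_le_iff)
qed

theorem corollary2:
  fixes p :: real
    and N :: "'b measure" and V :: "'b \<Rightarrow> real"
    and G :: "'g measure" and Z :: "'g \<Rightarrow> real"
    and S :: "'s measure" and Vt :: "nat \<Rightarrow> 's \<Rightarrow> real" and \<xi> :: "'s \<Rightarrow> nat"
  assumes p: "p > 2"
    and N: "prob_space N"
    and V_sym: "symmetric_rv N V"
    and V_nonzero: "\<not> (AE \<omega> in N. V \<omega> = 0)"
    and V_small_p: "p < 4 \<Longrightarrow> \<exists>\<delta>>0. eLp_norm N (p + \<delta>) V < \<top>"
    and V_large_p: "p \<ge> 4 \<Longrightarrow> eLp_norm N p V < \<top>"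
    and G: "prob_space G"
    and Z: "distributed G lborel Z std_normal_density"
    and S: "prob_space S"
    and Vt_indep: "prob_space.indep_vars S (\<lambda>_. borel) Vt {1..}"
    and Vt_distr: "\<And>j. j \<ge> 1 \<Longrightarrow>
          distr S borel (Vt j) = distr (uniform_measure N {\<omega> \<in> space N. V \<omega> \<noteq> 0}) borel V"
    and xi_meas: "\<xi> \<in> measurable S (count_space UNIV)"
    and xi_distr: "distr S (count_space UNIV) \<xi> =
          measure_pmf (poisson_pmf
            (enn2real (epowr (eLp_norm N p V / eLp_norm N 2 V) (2 * p / (p - 2)))
              * (1 - measure N {\<omega> \<in> space N. V \<omega> = 0})))"
    and xi_Vt_indep: "prob_space.indep_set S
          (sets (vimage_algebra (space S) \<xi> (count_space UNIV)))
          (sets (vimage_algebra (space S) (\<lambda>\<omega>. \<lambda>j\<in>{1..}. Vt j \<omega>) (PiM {1..} (\<lambda>_. borel))))"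
  shows "(p \<le> 4 \<longrightarrow>
            best_const TYPE('a) p N V (epowr (1 + epowr (eLp_norm G p Z) p) (1 / p))) \<and>
         (p \<ge> 4 \<longrightarrow>
            best_const TYPE('a) p N V
              (epowr (epowr (eLp_norm N 2 V) 2 / epowr (eLp_norm N p V) p) (1 / (p - 2))
                * eLp_norm S p (\<lambda>\<omega>. \<Sum>j=1..\<xi> \<omega>. Vt j \<omega>)))"
proof -
  interpret N: prob_space N by (rule N)
  define \<nu> where "\<nu> = distr N borel V"
  have V[measurable]: "V \<in> borel_measurable N" using V_sym by (simp add: symmetric_rv_def)
  have law\<nu>: "law \<nu>" unfolding \<nu>_def using N.prob_space_distr[OF V] by simp
  have sym: "sym_law \<nu>"
    unfolding sym_law_def
  proof (intro conjI ballI)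
    fix g :: "real \<Rightarrow> ennreal" assume [measurable]: "g \<in> borel_measurable borel"
    have "(\<integral>\<^sup>+x. g (- x) \<partial>\<nu>) = (\<integral>\<^sup>+\<omega>. g (- V \<omega>) \<partial>N)"
      unfolding \<nu>_def by (subst nn_integral_distr) auto
    also have "\<dots> = (\<integral>\<^sup>+x. g x \<partial>distr N borel (\<lambda>\<omega>. - V \<omega>))" by (subst nn_integral_distr) auto
    also have "\<dots> = (\<integral>\<^sup>+x. g x \<partial>\<nu>)" using V_sym by (simp add: symmetric_rv_def \<nu>_def)
    finally show "(\<integral>\<^sup>+x. g (- x) \<partial>\<nu>) = (\<integral>\<^sup>+x. g x \<partial>\<nu>)" .
  qed (use law\<nu> in auto)
  have moment_le: "(\<integral>\<^sup>+\<omega>. pw r (V \<omega>) \<partial>N) < \<top>" if r: "0 < r" "r \<le> s" and fin: "eLp_norm N s V < \<top>" for r s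
  proof -
    have "\<bar>x\<bar> powr r \<le> 1 + \<bar>x\<bar> powr s" for x :: real
    proof (cases "\<bar>x\<bar> \<le> 1")
      case True
      then have "\<bar>x\<bar> powr r \<le> 1" using r by (intro powr_le1) auto
      then show ?thesis by (simp add: add_increasing2)
    next
      case False
      then have "\<bar>x\<bar> powr r \<le> \<bar>x\<bar> powr s" using r by (intro powr_mono) auto
      then show ?thesis by simp
    qed
    then have "(\<integral>\<^sup>+\<omega>. pw r (V \<omega>) \<partial>N) \<le> (\<integral>\<^sup>+\<omega>. 1 + pw s (V \<omega>) \<partial>N)"
      by (intro nn_integral_mono) (simp add: ennreal_leI flip: ennreal_1 ennreal_plus)
    also have "\<dots> = 1 + (\<integral>\<^sup>+\<omega>. pw s (V \<omega>) \<partial>N)"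
      by (subst nn_integral_add) (auto simp: N.emeasure_space_1)
    also have "\<dots> = 1 + epowr (eLp_norm N s V) s" using r by (subst epowr_eLp_norm) auto
    also have "\<dots> < \<top>" using fin by simp
    finally show ?thesis .
  qed
  have fin: "(\<integral>\<^sup>+\<omega>. pw r (V \<omega>) \<partial>N) < \<top>" if "0 < r" "r \<le> p" for r
  proof (cases "p < 4")
    case True
    then obtain \<delta> where "\<delta> > 0" "eLp_norm N (p + \<delta>) V < \<top>" using V_small_p by blast
    then show ?thesis using that by (intro moment_le[of r "p + \<delta>"]) auto
  next
    case False
    then show ?thesis using that V_large_p by (intro moment_le[of r p]) auto
  qed
  have pos: "(\<integral>\<^sup>+\<omega>. pw r (V \<omega>) \<partial>N) \<noteq> 0" for r
  proof
    assume "(\<integral>\<^sup>+\<omega>. pw r (V \<omega>) \<partial>N) = 0"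
    then have "AE \<omega> in N. pw r (V \<omega>) = 0" by (subst (asm) nn_integral_0_iff_AE) auto
    then have "AE \<omega> in N. V \<omega> = 0" by eventually_elim (auto simp: ennreal_eq_0_iff dest: antisym[OF _ powr_ge_zero])
    with V_nonzero show False by blast
  qed
  obtain vp where vp: "(\<integral>\<^sup>+\<omega>. pw p (V \<omega>) \<partial>N) = ennreal vp" "vp > 0"
    using fin[of p] pos[of p] p by (cases "\<integral>\<^sup>+\<omega>. pw p (V \<omega>) \<partial>N") (auto simp: less_le)
  obtain v2 where v2: "(\<integral>\<^sup>+\<omega>. pw 2 (V \<omega>) \<partial>N) = ennreal v2" "v2 > 0"
    using fin[of 2] pos[of 2] p by (cases "\<integral>\<^sup>+\<omega>. pw 2 (V \<omega>) \<partial>N") (auto simp: less_le)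
  have v: "(\<integral>\<^sup>+x. ennreal (x\<^sup>2) \<partial>\<nu>) = ennreal v2" "v2 > 0" "(\<integral>\<^sup>+x. pw p x \<partial>\<nu>) = ennreal vp" "vp > 0"
    using v2 vp by (simp_all add: \<nu>_def nn_integral_pw_distr nn_integral_power2_distr)
  show ?thesis
  proof (intro conjI impI)
    assume p4: "p \<le> 4"
    let ?K = "1 + shift_op (gauss 1) (pw p) 0"
    have "(\<integral>\<^sup>+\<omega>. pw p (Z \<omega>) \<partial>G) = (\<integral>\<^sup>+z. pw p z \<partial>std_normal_distribution)"
    proof -
      have "(\<integral>\<^sup>+z. pw p z \<partial>std_normal_distribution) = (\<integral>\<^sup>+z. pw p z \<partial>distr G lborel Z)"
        using Z by (simp add: distributed_def)
      also have "\<dots> = (\<integral>\<^sup>+\<omega>. pw p (Z \<omega>) \<partial>G)"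
        using Z by (subst nn_integral_distr) (auto simp: distributed_def)
      finally show ?thesis by simp
    qed
    also have "\<dots> = shift_op (gauss 1) (pw p) 0"
      unfolding shift_op_def by (subst nn_integral_gauss) auto
    finally have Zp: "epowr (eLp_norm G p Z) p = shift_op (gauss 1) (pw p) 0" using p by (subst epowr_eLp_norm) auto
    show "best_const TYPE('a) p N V (epowr (1 + epowr (eLp_norm G p Z) p) (1 / p))"
    proof (rule best_constI)
      show "?K < \<top>" using gauss_moment_finite[of p] p p4 by simp
      show "epowr (epowr (1 + epowr (eLp_norm G p Z) p) (1 / p)) p = ?K"
        using p by (simp add: epowr_epowr Zp)
      show "?K \<le> epowr C p" if "admissible_const TYPE(nat \<Rightarrow> real) p N V C" for C
        using gauss_lower[OF that p N V sym[unfolded \<nu>_def] v[unfolded \<nu>_def]] .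
    qed (use p p4 sum_moment_le_gauss[OF p sym[unfolded \<nu>_def]] in auto)
  next
    assume p4: "p \<ge> 4"
    \<comment> \<open>\<open>a\<close> and \<open>l\<close> solve \<open>l * a^2 * v2 = 1\<close>
      and \<open>l * a^p * vp = 1\<close>, so that \<open>l\<close> copies of \<open>a V\<close>
      exhaust both constraints. Then \<open>a\<close> is the factor in front of the norm, and
      \<open>l\<close> is the Poisson rate before zero jumps are removed.\<close>
    define a where "a = (v2 / vp) powr (1 / (p - 2))"
    define l where "l = 1 / (a\<^sup>2 * v2)"
    have a: "a > 0" using v by (simp add: a_def)
    have l: "l > 0" "l * (a\<^sup>2 * v2) = 1" using a v by (simp_all add: l_def)
    have "a powr (p - 2) = v2 / vp" using v p by (simp add: a_def powr_powr)
    then have ap: "a powr p = a\<^sup>2 * (v2 / vp)" using a by (simp add: powr_diff field_simps)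
    have lp: "l * (a powr p * vp) = 1" unfolding ap using l v by simp
    let ?K = "cpois l a \<nu> (pw p) 0"
    define q where "q = measure N {\<omega> \<in> space N. V \<omega> = 0}"
    have q: "q < 1"
    proof -
      have "q \<noteq> 1"
      proof
        assume "q = 1"
        then have "AE \<omega> in N. \<omega> \<in> {\<omega> \<in> space N. V \<omega> = 0}" unfolding q_def by (subst N.AE_in_set_eq_1) auto
        then have "AE \<omega> in N. V \<omega> = 0" by eventually_elim simp
        with V_nonzero show False by blast
      qed
      moreover have "q \<le> 1" by (simp add: q_def)
      ultimately show ?thesis by simp
    qed
    have norms: "eLp_norm N p V = ennreal (vp powr (1 / p))" "eLp_norm N 2 V = ennreal (v2 powr (1 / 2))"
      unfolding eLp_norm_def vp(1) v2(1) using v by (simp_all add: epowr_ennreal)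
    have rate: "enn2real (epowr (eLp_norm N p V / eLp_norm N 2 V) (2 * p / (p - 2))) = l"
    proof -
      have "eLp_norm N p V / eLp_norm N 2 V = ennreal (vp powr (1 / p) / v2 powr (1 / 2))"
        unfolding norms using v by (simp add: divide_ennreal)
      then have "enn2real (epowr (eLp_norm N p V / eLp_norm N 2 V) (2 * p / (p - 2))) = vp powr (2 / (p - 2)) / v2 powr (p / (p - 2))"
        using p v by (simp add: epowr_ennreal powr_divide powr_powr)
      also have "p / (p - 2) = 2 / (p - 2) + 1" using p by (simp add: field_simps)
      also have "vp powr (2 / (p - 2)) / v2 powr (2 / (p - 2) + 1) = l"
      proof -
        have "a\<^sup>2 = v2 powr (2 / (p - 2)) / vp powr (2 / (p - 2))"
          using v by (simp add: a_def power2_eq_square powr_divide flip: powr_add)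
        then show ?thesis using v by (simp add: l_def powr_add)
      qed
      finally show ?thesis .
    qed
    have sum: "(\<integral>\<^sup>+\<omega>. pw p (\<Sum>j=1..\<xi> \<omega>. Vt j \<omega>) \<partial>S) = cpois l 1 \<nu> (pw p) 0"
    proof -
      have "(\<integral>\<^sup>+\<omega>. pw p (\<Sum>j=1..\<xi> \<omega>. Vt j \<omega>) \<partial>S) = (\<Sum>k. ennreal (exp (- (l * (1 - q))) * (l * (1 - q)) ^ k / fact k) *
          (shift_op (distr (uniform_measure N {\<omega> \<in> space N. V \<omega> \<noteq> 0}) borel V) ^^ k) (pw p) 0)"
        using xi_distr l q unfolding rate q_def[symmetric]
        by (intro nn_integral_compound_Poisson S Vt_indep Vt_distr xi_meas xi_Vt_indep measurable_pw) auto
      also have "\<dots> = cpois l 1 \<nu> (pw p) 0"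
        unfolding \<nu>_def using l q by (intro cpois_conditioned[symmetric, OF N V _ measurable_pw q_def _ refl]) auto
      finally show ?thesis .
    qed
    have first: "epowr (epowr (eLp_norm N 2 V) 2 / epowr (eLp_norm N p V) p) (1 / (p - 2)) = ennreal a"
    proof -
      have "epowr (eLp_norm N 2 V) 2 = ennreal v2" unfolding v2(1)[symmetric] by (rule epowr_eLp_norm) simp
      moreover have "epowr (eLp_norm N p V) p = ennreal vp"
        unfolding vp(1)[symmetric] using p by (intro epowr_eLp_norm) simp
      ultimately show ?thesis using v by (simp add: divide_ennreal epowr_ennreal a_def)
    qed
    show "best_const TYPE('a) p N V
              (epowr (epowr (eLp_norm N 2 V) 2 / epowr (eLp_norm N p V) p) (1 / (p - 2))
                * eLp_norm S p (\<lambda>\<omega>. \<Sum>j=1..\<xi> \<omega>. Vt j \<omega>))"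
    proof (rule best_constI)
      show "?K < \<top>" using cpois_finite[OF law\<nu>, of p l a 0] p v l by simp
      have "cpois l (1 * a) \<nu> (pw p) 0 = ennreal (a powr p) * cpois l 1 \<nu> (pw p) 0"
        using a by (intro cpois_homogeneous law\<nu>) simp
      then show "epowr (epowr (epowr (eLp_norm N 2 V) 2 / epowr (eLp_norm N p V) p) (1 / (p - 2))
                * eLp_norm S p (\<lambda>\<omega>. \<Sum>j=1..\<xi> \<omega>. Vt j \<omega>)) p = ?K"
        unfolding first using p a by (simp add: epowr_mult epowr_ennreal epowr_eLp_norm sum del: One_nat_def)
    next
      fix C assume adm: "admissible_const TYPE(nat \<Rightarrow> real) p N V C"
      show "?K \<le> epowr C p"
      \<comment> \<open>With \<open>n\<close> copies of \<open>a V\<close> retained with probability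
        \<open>l / n\<close> both sums of moments equal 1 for every \<open>n\<close>, so the bound
        provided by an admissible \<open>C\<close> is the constant \<open>epowr C p\<close>.\<close>
      proof (rule cpois_le_const[OF law\<nu>])
        fix n :: nat assume n: "l < real n" "n \<ge> 1"
        have "shift_ops (\<lambda>_. bern_law (l / real n) a (distr N borel V)) n (pw p) 0 \<le> epowr C p *
            ennreal (max ((\<Sum>j=1..n. l / real n * (a\<^sup>2 * v2)) powr (p / 2)) (\<Sum>j=1..n. l / real n * (a powr p * vp)))"
          using n l a p by (intro admissible_const_lower[OF adm _ N V _ _ _ _ v[unfolded \<nu>_def]]) auto
        also have "(\<Sum>j=1..n. l / real n * (a\<^sup>2 * v2)) = 1" using n l(2) by simp
        also have "(\<Sum>j=1..n. l / real n * (a powr p * vp)) = 1" using n lp by simp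
        finally show "shift_ops (\<lambda>_. bern_law (l / real n) a \<nu>) n (pw p) 0 \<le> epowr C p" by (simp add: \<nu>_def)
      qed (use p v l in auto)
    next
      fix M :: "'a measure" and X :: "nat \<Rightarrow> 'a \<Rightarrow> real" and n :: nat
      assume "prob_space M" "prob_space.indep_vars M (\<lambda>_. borel) X {1..}" "\<forall>j\<ge>1. V_mixture N V M (X j)"
      from sum_moment_le_cpois[OF p sym[unfolded \<nu>_def] this p4 v[unfolded \<nu>_def] a l lp, of n]
      show "(\<integral>\<^sup>+\<omega>. pw p (\<Sum>j=1..n. X j \<omega>) \<partial>M) \<le> ?K *
        max (epowr (\<Sum>j=1..n. \<integral>\<^sup>+\<omega>. ennreal ((X j \<omega>)\<^sup>2) \<partial>M) (p / 2)) (\<Sum>j=1..n. \<integral>\<^sup>+\<omega>. pw p (X j \<omega>) \<partial>M)"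
        by (simp only: \<nu>_def)
    qed (use p in simp)
  qed
qed

end
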